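(* In the topos $\mathrm{Eff}_{\mathcal{J}}$ (defined in the context), let $\Omega$ be the subobject classifier and $N$ the natural numbers object. For any object $X$ which is a subquotient of $N$, the natural map $X\to X^{\Omega}$ is an isomorphism. In particular, this holds for the objects $N$, $N^N$, $\mathcal{N}$ and $\mathcal{N}^{\mathcal{N}}$, where $\mathcal{N}$ is the nonstandard-model $\mathcal{J}$-assembly defined in the context.
   Context: Notation. Fix a recursive coding $\langle a_0,\ldots,a_{n-1}\rangle$ of finite sequences of natural numbers, with recursive projections. $\phi_e$ is the partial recursive function with index $e$. For $A,B\subseteq\mathbb{N}$: $A\to B$ is the set of indices $e$ such that for every $a\in A$, $\phi_e(a)$ is defined and $\phi_e(a)\in B$; $A\wedge B=\{\langle a,b\rangle\mid a\in A,b\in B\}$; ${\uparrow}n=\{m\mid n\le m\}$. Pitts' local operator. $\mathcal{F}A=\bigcup_{n}({\uparrow}n\to A)$ and $\mathcal{J}A=\bigcap\{B\subseteq\mathbb{N}\mid\{0\}\wedge A\subseteq B\text{ and }\{1\}\wedge\mathcal{F}B\subseteq B\}$, for $A\subseteq\mathbb{N}$. An index $e$ ($\mathcal{J}$-)represents $f:\mathbb{N}\to\mathbb{N}$ if $\phi_e$ is total and $\phi_e(n)\in\mathcal{J}\{f(n)\}$ for all $n$. The topos. $\mathrm{Eff}_{\mathcal{J}}$ is the subtopos of Hyland's effective topos determined by the local operator (Lawvere–Tierney topology) induced by $\mathcal{J}$. Equivalently, it is the topos represented by the tripos on $\mathbf{Set}$ whose predicates on a set $I$ are functions $I\to\mathcal{P}(\mathbb{N})$,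 preordered by $p\le q$ iff $\bigcap_{i\in I}(p(i)\to\mathcal{J}q(i))$ is nonempty: its objects are pairs $(X,=)$ of a set $X$ with a $\mathcal{P}(\mathbb{N})$-valued predicate $[x=x']$ on $X\times X$ that is symmetric and transitive in the logic of the tripos, and its morphisms are equivalence classes of functional relations. The subobject classifier $\Omega$ is the object $(\mathcal{P}(\mathbb{N}),=)$ with $[A=B]=(A\to\mathcal{J}B)\wedge(B\to\mathcal{J}A)$. $\mathcal{J}$-assemblies. A $\mathcal{J}$-assembly is a pair $(X,E)$ with $X$ a set and $E$ assigning to each $x\in X$ a nonempty $E(x)\subseteq\mathbb{N}$; a morphism $(X,E)\to(Y,F)$ is a function $f:X\to Y$ with $\bigcap_{x\in X}(E(x)\to\mathcal{J}F(f(x)))$ nonempty. $\mathcal{J}$-assemblies form a full subcategory of $\mathrm{Eff}_{\mathcal{J}}$, with $(X,E)$ viewed as the object where $[x=x']$ is $E(x)$ if $x=x'$ and $\emptyset$ otherwise. The natural numbers object $N$ is the $\mathcal{J}$-assembly $(\mathbb{N},\{\cdot\})$, i.e. $E(n)=\{n\}$. A subquotient of $N$ is a quotient of a subobject of $N$. The natural map $X\to X^{\Omega}$ is the exponential transpose of the projection $X\times\Omega\to X$ (sending $x$ to the constant map with value $x$). The assembly $\mathcal{N}$. Let $\alpha_0,\alpha_1,\ldots$ be an enumeration of all arithmetical functions $\mathbb{N}\to\mathbb{N}$. Put $A_0=\mathbb{N}$. Suppose $A_k$ is infinite and for all $i,j\le k$ one of $\alpha_i<\alpha_j$, $\alpha_i=\alpha_j$,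 $\alpha_i>\alpha_j$ holds throughout $A_k$; let $\beta_1<\cdots<\beta_l$ be the ordered list of the distinct restrictions of $\alpha_0,\ldots,\alpha_k$ to $A_k$. Let $A_{k+1}$ be the first infinite set in the list $\{x\in A_k\mid\alpha_{k+1}(x)<\beta_1(x)\}$, $\{x\in A_k\mid\alpha_{k+1}(x)=\beta_1(x)\}$, $\{x\in A_k\mid\beta_1(x)<\alpha_{k+1}(x)<\beta_2(x)\}$, $\ldots$, $\{x\in A_k\mid\beta_l(x)<\alpha_{k+1}(x)\}$. Let $\psi(0)=0$ and let $\psi(k+1)$ be the least element of $A_{k+1}$ that is $>\psi(k)$. The enumeration is chosen so that the whole construction is recursive in a truth function for arithmetic (which is hyperarithmetical), so that $\psi$ is represented by some index. Arithmetical functions $\alpha,\beta$ are equivalent if $\alpha(\psi(n))=\beta(\psi(n))$ for all large enough $n$; $\mathcal{N}$ is the set of equivalence classes $[\alpha]$, made a $\mathcal{J}$-assembly by $E([\alpha])=\{e\mid\text{for some }\beta\in[\alpha],\ e\text{ represents }n\mapsto\beta(\psi(n))\}$. *)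

theory Defs
  imports Complex_Main "HOL-Library.Nat_Bijection" "HOL-Library.FuncSet"
begin

section \<open>Partial recursive functions\<close>

text \<open>
  The partial recursive functions are generated in the usual unary presentation: binary functions
  are unary functions on codes of pairs (\<^const>\<open>prod_encode\<close>, a primitive recursive bijection).
  The operators below act on arbitrary partial functions, so that they also serve to define
  recursiveness relative to an oracle.
\<close>

definition pf_left :: "nat \<Rightarrow> nat option" where
  "pf_left n = Some (fst (prod_decode n))"

definition pf_right :: "nat \<Rightarrow> nat option" where
  "pf_right n = Some (snd (prod_decode n))"

definition pf_pair :: "(nat \<Rightarrow> nat option) \<Rightarrow> (nat \<Rightarrow> nat option) \<Rightarrow> nat \<Rightarrow> nat option" where
  "pf_pair f g a = Option.bind (f a) (\<lambda>x. Option.bind (g a) (\<lambda>y. Some (prod_encode (x, y))))"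

definition pf_comp :: "(nat \<Rightarrow> nat option) \<Rightarrow> (nat \<Rightarrow> nat option) \<Rightarrow> nat \<Rightarrow> nat option" where
  "pf_comp f g a = Option.bind (g a) f"

text \<open>Primitive recursion: \<open>h (a, 0) = f a\<close> and \<open>h (a, n + 1) = g (a, (n, h (a, n)))\<close>.\<close>

definition pf_prec :: "(nat \<Rightarrow> nat option) \<Rightarrow> (nat \<Rightarrow> nat option) \<Rightarrow> nat \<Rightarrow> nat option" where
  "pf_prec f g c = (case prod_decode c of (a, n) \<Rightarrow>
     rec_nat (f a) (\<lambda>k r. Option.bind r (\<lambda>y. g (prod_encode (a, prod_encode (k, y))))) n)"

text \<open>Minimisation: the least \<open>n\<close> with \<open>f (a, n) = 0\<close> such that \<open>f (a, k)\<close> is defined for all \<open>k < n\<close>.\<close>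

definition pf_mu :: "(nat \<Rightarrow> nat option) \<Rightarrow> nat \<Rightarrow> nat option" where
  "pf_mu f a =
    (if \<exists>n. f (prod_encode (a, n)) = Some 0 \<and> (\<forall>k<n. f (prod_encode (a, k)) \<noteq> None)
     then Some (LEAST n. f (prod_encode (a, n)) = Some 0)
     else None)"

datatype code =
    CZero | CSucc | CLeft | CRight
  | CPair code code | CComp code code | CPrec code code | CMu code

primrec code_eval :: "code \<Rightarrow> nat \<Rightarrow> nat option" where
  "code_eval CZero = (\<lambda>_. Some 0)"
| "code_eval CSucc = (\<lambda>n. Some (Suc n))"
| "code_eval CLeft = pf_left"
| "code_eval CRight = pf_right"
| "code_eval (CPair c d) = pf_pair (code_eval c) (code_eval d)"
| "code_eval (CComp c d) = pf_comp (code_eval c) (code_eval d)"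
| "code_eval (CPrec c d) = pf_prec (code_eval c) (code_eval d)"
| "code_eval (CMu c) = pf_mu (code_eval c)"

text \<open>A bijective Goedel numbering of codes.\<close>

function code_of_nat :: "nat \<Rightarrow> code" where
  "code_of_nat e =
    (if e = 0 then CZero else if e = 1 then CSucc else if e = 2 then CLeft else if e = 3 then CRight
     else let m = (e - 4) div 4; a = fst (prod_decode m); b = snd (prod_decode m) in
       if (e - 4) mod 4 = 0 then CPair (code_of_nat a) (code_of_nat b)
       else if (e - 4) mod 4 = 1 then CComp (code_of_nat a) (code_of_nat b)
       else if (e - 4) mod 4 = 2 then CPrec (code_of_nat a) (code_of_nat b)
       else CMu (code_of_nat m))"
  by pat_completeness auto

lemma fst_prod_decode_le: "fst (prod_decode m) \<le> m"
  by (metis le_prod_encode_1 prod.collapse prod_decode_inverse)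

lemma snd_prod_decode_le: "snd (prod_decode m) \<le> m"
  by (metis le_prod_encode_2 prod.collapse prod_decode_inverse)

termination code_of_nat
proof (relation "measure id", goal_cases)
  have less: "n < e" if "n \<le> (e - 4) div 4" "e \<noteq> 0" "e \<noteq> 1" "e \<noteq> 2" "e \<noteq> 3" for n e :: nat
    using that by linarith
  {
    case 1
    show ?case by simp
  next
    case (2 e m a b)
    then show ?case using fst_prod_decode_le[of m] less[of a e] by simp
  next
    case (3 e m a b)
    then show ?case using snd_prod_decode_le[of m] less[of b e] by simp
  next
    case (4 e m a b)
    then show ?case using fst_prod_decode_le[of m] less[of a e] by simp
  next
    case (5 e m a b)
    then show ?case using snd_prod_decode_le[of m] less[of b e] by simp
  next
    case (6 e m a b)
    then show ?case using fst_prod_decode_le[of m] less[of a e] by simp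
  next
    case (7 e m a b)
    then show ?case using snd_prod_decode_le[of m] less[of b e] by simp
  next
    case (8 e m a b)
    then show ?case using less[of m e] by simp
  }
qed

declare code_of_nat.simps [simp del]

definition \<phi> :: "nat \<Rightarrow> nat \<Rightarrow> nat option" where
  "\<phi> e = code_eval (code_of_nat e)"

text \<open>The partial functions that are partial recursive in the oracle \<open>g\<close>.\<close>

inductive recursive_in :: "(nat \<Rightarrow> nat) \<Rightarrow> (nat \<Rightarrow> nat option) \<Rightarrow> bool" for g where
  "recursive_in g (\<lambda>_. Some 0)"
| "recursive_in g (\<lambda>n. Some (Suc n))"
| "recursive_in g pf_left"
| "recursive_in g pf_right"
| "recursive_in g (\<lambda>n. Some (g n))"
| "recursive_in g u \<Longrightarrow> recursive_in g v \<Longrightarrow> recursive_in g (pf_pair u v)"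
| "recursive_in g u \<Longrightarrow> recursive_in g v \<Longrightarrow> recursive_in g (pf_comp u v)"
| "recursive_in g u \<Longrightarrow> recursive_in g v \<Longrightarrow> recursive_in g (pf_prec u v)"
| "recursive_in g u \<Longrightarrow> recursive_in g (pf_mu u)"


section \<open>Pitts' local operator and the tripos\<close>

definition rarrow :: "nat set \<Rightarrow> nat set \<Rightarrow> nat set" (infixr "\<^bold>\<rightarrow>" 55) where
  "A \<^bold>\<rightarrow> B = {e. \<forall>a\<in>A. \<exists>b\<in>B. \<phi> e a = Some b}"

text \<open>Finite sequences of natural numbers are coded by \<^const>\<open>list_encode\<close>.\<close>

definition rconj :: "nat set \<Rightarrow> nat set \<Rightarrow> nat set" (infixr "\<^bold>\<and>" 60) where
  "A \<^bold>\<and> B = {list_encode [a, b] | a b. a \<in> A \<and> b \<in> B}"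

definition \<F> :: "nat set \<Rightarrow> nat set" where
  "\<F> A = (\<Union>n. {n..} \<^bold>\<rightarrow> A)"

definition \<J> :: "nat set \<Rightarrow> nat set" where
  "\<J> A = \<Inter>{B. {0} \<^bold>\<and> A \<subseteq> B \<and> {1} \<^bold>\<and> \<F> B \<subseteq> B}"

definition represents :: "nat \<Rightarrow> (nat \<Rightarrow> nat) \<Rightarrow> bool" where
  "represents e f \<longleftrightarrow> (\<forall>n. \<exists>m. \<phi> e n = Some m \<and> m \<in> \<J> {f n})"

definition predicates :: "'i set \<Rightarrow> ('i \<Rightarrow> nat set) set" where
  "predicates I = (I \<rightarrow>\<^sub>E UNIV)"

text \<open>The realizers of \<open>p \<le> q\<close>, i.e. of the sentence \<open>\<forall>i\<in>I. p i \<longrightarrow> q i\<close> of the logic of the tripos.\<close>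

definition le_realizers :: "'i set \<Rightarrow> ('i \<Rightarrow> nat set) \<Rightarrow> ('i \<Rightarrow> nat set) \<Rightarrow> nat set" where
  "le_realizers I p q = (\<Inter>i\<in>I. p i \<^bold>\<rightarrow> \<J> (q i))"

definition tripos_le :: "'i set \<Rightarrow> ('i \<Rightarrow> nat set) \<Rightarrow> ('i \<Rightarrow> nat set) \<Rightarrow> bool" where
  "tripos_le I p q \<longleftrightarrow> le_realizers I p q \<noteq> {}"


section \<open>The topos\<close>

text \<open>
  \<open>Eq X x x'\<close> is the predicate \<open>[x = x']\<close>; only its values on \<open>Car X\<close> matter.
\<close>

record 'a eff =
  Car :: "'a set"
  Eq :: "'a \<Rightarrow> 'a \<Rightarrow> nat set"

definition eff_object :: "'a eff \<Rightarrow> bool" where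
  "eff_object X \<longleftrightarrow>
     tripos_le (Car X \<times> Car X) (\<lambda>(x, x'). Eq X x x') (\<lambda>(x, x'). Eq X x' x) \<and>
     tripos_le (Car X \<times> Car X \<times> Car X)
       (\<lambda>(x, x', x''). Eq X x x' \<^bold>\<and> Eq X x' x'') (\<lambda>(x, x', x''). Eq X x x'')"

text \<open>
  The realizers of the sentence ``\<open>F\<close> is a functional relation from \<open>X\<close> to \<open>Y\<close>'': \<open>F\<close> is strict,
  respects equality, is single-valued and total. Existential quantification in the tripos is
  union, since every conclusion is prefixed with \<^const>\<open>\<J>\<close>.
\<close>

definition functional_realizers :: "'a eff \<Rightarrow> 'b eff \<Rightarrow> ('a \<times> 'b \<Rightarrow> nat set) \<Rightarrow> nat set" where
  "functional_realizers X Y F =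
     le_realizers (Car X \<times> Car Y) F (\<lambda>(x, y). Eq X x x \<^bold>\<and> Eq Y y y) \<^bold>\<and>
     le_realizers (Car X \<times> Car X \<times> Car Y \<times> Car Y)
       (\<lambda>(x, x', y, y'). Eq X x x' \<^bold>\<and> F (x, y) \<^bold>\<and> Eq Y y y') (\<lambda>(x, x', y, y'). F (x', y')) \<^bold>\<and>
     le_realizers (Car X \<times> Car Y \<times> Car Y)
       (\<lambda>(x, y, y'). F (x, y) \<^bold>\<and> F (x, y')) (\<lambda>(x, y, y'). Eq Y y y') \<^bold>\<and>
     le_realizers (Car X) (\<lambda>x. Eq X x x) (\<lambda>x. \<Union>y\<in>Car Y. F (x, y))"

definition functional :: "'a eff \<Rightarrow> 'b eff \<Rightarrow> ('a \<times> 'b \<Rightarrow> nat set) set" where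
  "functional X Y = {F \<in> predicates (Car X \<times> Car Y). functional_realizers X Y F \<noteq> {}}"

definition fun_equiv :: "'a eff \<Rightarrow> 'b eff \<Rightarrow> (('a \<times> 'b \<Rightarrow> nat set) \<times> ('a \<times> 'b \<Rightarrow> nat set)) set" where
  "fun_equiv X Y = {(F, G). F \<in> functional X Y \<and> G \<in> functional X Y \<and>
     tripos_le (Car X \<times> Car Y) F G \<and> tripos_le (Car X \<times> Car Y) G F}"

type_synonym ('a, 'b) mor = "('a \<times> 'b \<Rightarrow> nat set) set"

definition hom :: "'a eff \<Rightarrow> 'b eff \<Rightarrow> ('a, 'b) mor set" where
  "hom X Y = functional X Y // fun_equiv X Y"

definition eff_id :: "'a eff \<Rightarrow> ('a, 'a) mor" where
  "eff_id X = fun_equiv X X `` {restrict (\<lambda>(x, x'). Eq X x x') (Car X \<times> Car X)}"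

text \<open>\<open>eff_comp X Y Z g f\<close> is the composite of \<open>f : X \<rightarrow> Y\<close> and \<open>g : Y \<rightarrow> Z\<close>.\<close>

definition eff_comp ::
  "'a eff \<Rightarrow> 'b eff \<Rightarrow> 'c eff \<Rightarrow> ('b, 'c) mor \<Rightarrow> ('a, 'b) mor \<Rightarrow> ('a, 'c) mor" where
  "eff_comp X Y Z g f = (\<Union>F\<in>f. \<Union>G\<in>g.
     fun_equiv X Z `` {restrict (\<lambda>(x, z). \<Union>y\<in>Car Y. F (x, y) \<^bold>\<and> G (y, z)) (Car X \<times> Car Z)})"

definition eff_iso :: "'a eff \<Rightarrow> 'b eff \<Rightarrow> ('a, 'b) mor \<Rightarrow> bool" where
  "eff_iso X Y f \<longleftrightarrow> f \<in> hom X Y \<and>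
     (\<exists>g\<in>hom Y X. eff_comp X Y X g f = eff_id X \<and> eff_comp Y X Y f g = eff_id Y)"

text \<open>
  HOL cannot quantify over types inside a formula, so the test objects in the definitions of
  monomorphism and epimorphism must be carried by a fixed type. The types chosen lose nothing:
  the kernel pair of \<open>f : X \<rightarrow> Y\<close> is an object on the set \<open>Car X \<times> Car X\<close> and its cokernel pair is
  an object on the disjoint sum of \<open>Car Y\<close> with itself, and \<open>f\<close> is monic (epic) as soon as the two
  projections of its kernel pair (the two coprojections of its cokernel pair) coincide.
\<close>

definition eff_mono :: "'a eff \<Rightarrow> 'b eff \<Rightarrow> ('a, 'b) mor \<Rightarrow> bool" where
  "eff_mono X Y f \<longleftrightarrow> f \<in> hom X Y \<and>
     (\<forall>T :: ('a \<times> 'a) eff. eff_object T \<longrightarrow> (\<forall>g\<in>hom T X. \<forall>h\<in>hom T X.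
        eff_comp T X Y f g = eff_comp T X Y f h \<longrightarrow> g = h))"

definition eff_epi :: "'a eff \<Rightarrow> 'b eff \<Rightarrow> ('a, 'b) mor \<Rightarrow> bool" where
  "eff_epi X Y f \<longleftrightarrow> f \<in> hom X Y \<and>
     (\<forall>T :: ('b + 'b) eff. eff_object T \<longrightarrow> (\<forall>g\<in>hom Y T. \<forall>h\<in>hom Y T.
        eff_comp X Y T g f = eff_comp X Y T h f \<longrightarrow> g = h))"

text \<open>
  \<open>X\<close> is a quotient of a subobject \<open>S\<close> of \<open>Y\<close>. The carrier type of \<open>S\<close> is a parameter, so that a
  theorem assuming this with a type variable covers every choice of \<open>S\<close>.
\<close>

definition subquotient :: "'s itself \<Rightarrow> 'a eff \<Rightarrow> 'b eff \<Rightarrow> bool" where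
  "subquotient _ X Y \<longleftrightarrow>
     (\<exists>(S :: 's eff) m q. eff_object S \<and> eff_mono S Y m \<and> eff_epi S X q)"

definition eff_Omega :: "nat set eff" where
  "eff_Omega = \<lparr>Car = UNIV, Eq = (\<lambda>A B. (A \<^bold>\<rightarrow> \<J> B) \<^bold>\<and> (B \<^bold>\<rightarrow> \<J> A))\<rparr>"

definition eff_prod :: "'a eff \<Rightarrow> 'b eff \<Rightarrow> ('a \<times> 'b) eff" where
  "eff_prod X Y = \<lparr>Car = Car X \<times> Car Y, Eq = (\<lambda>(x, y) (x', y'). Eq X x x' \<^bold>\<and> Eq Y y y')\<rparr>"

definition eff_fst :: "'a eff \<Rightarrow> 'b eff \<Rightarrow> ('a \<times> 'b, 'a) mor" where
  "eff_fst X Y = fun_equiv (eff_prod X Y) X ``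
     {restrict (\<lambda>((x, y), x'). Eq X x x' \<^bold>\<and> Eq Y y y) ((Car X \<times> Car Y) \<times> Car X)}"

text \<open>
  \<open>eff_exp Y X\<close> is the exponential \<open>Y\<^sup>X\<close>: \<open>[R = S]\<close> says that \<open>R\<close> is a functional relation from
  \<open>X\<close> to \<open>Y\<close> and that \<open>R\<close> and \<open>S\<close> are equivalent.
\<close>

definition eff_exp :: "'b eff \<Rightarrow> 'a eff \<Rightarrow> ('a \<times> 'b \<Rightarrow> nat set) eff" where
  "eff_exp Y X = \<lparr>Car = predicates (Car X \<times> Car Y),
     Eq = (\<lambda>R S. functional_realizers X Y R \<^bold>\<and>
       le_realizers (Car X \<times> Car Y) R S \<^bold>\<and> le_realizers (Car X \<times> Car Y) S R)\<rparr>"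

text \<open>
  The exponential transpose \<open>Z \<rightarrow> Y\<^sup>X\<close> of \<open>f : Z \<times> X \<rightarrow> Y\<close>. If \<open>F\<close> represents \<open>f\<close>, the transpose is
  represented by the relation ``\<open>z\<close> exists and \<open>F (z, -, -) = R\<close> in \<open>Y\<^sup>X\<close>''.
\<close>

definition eff_transpose ::
  "'c eff \<Rightarrow> 'a eff \<Rightarrow> 'b eff \<Rightarrow> ('c \<times> 'a, 'b) mor \<Rightarrow> ('c, 'a \<times> 'b \<Rightarrow> nat set) mor" where
  "eff_transpose Z X Y f = (\<Union>F\<in>f. fun_equiv Z (eff_exp Y X) ``
     {restrict
       (\<lambda>(z, R). Eq Z z z \<^bold>\<and>
          Eq (eff_exp Y X) (restrict (\<lambda>(x, y). F ((z, x), y)) (Car X \<times> Car Y)) R)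
       (Car Z \<times> Car (eff_exp Y X))})"

text \<open>The natural map \<open>X \<rightarrow> X\<^sup>\<Omega>\<close>.\<close>

definition eff_const :: "'a eff \<Rightarrow> ('a, nat set \<times> 'a \<Rightarrow> nat set) mor" where
  "eff_const X = eff_transpose X eff_Omega X (eff_fst X eff_Omega)"

text \<open>The object given by a \<open>\<J>\<close>-assembly \<open>(X, E)\<close>.\<close>

definition assembly :: "'a set \<Rightarrow> ('a \<Rightarrow> nat set) \<Rightarrow> 'a eff" where
  "assembly X E = \<lparr>Car = X, Eq = (\<lambda>x x'. if x = x' then E x else {})\<rparr>"

definition eff_N :: "nat eff" where
  "eff_N = assembly UNIV (\<lambda>n. {n})"


section \<open>Arithmetical functions and a truth function for arithmetic\<close>

datatype tm = TVar nat | TZero | TSucc tm | TAdd tm tm | TMul tm tm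

datatype fm = FEq tm tm | FNot fm | FAnd fm fm | FAll nat fm

primrec tm_val :: "(nat \<Rightarrow> nat) \<Rightarrow> tm \<Rightarrow> nat" where
  "tm_val s (TVar i) = s i"
| "tm_val s TZero = 0"
| "tm_val s (TSucc t) = Suc (tm_val s t)"
| "tm_val s (TAdd t u) = tm_val s t + tm_val s u"
| "tm_val s (TMul t u) = tm_val s t * tm_val s u"

primrec fm_sat :: "(nat \<Rightarrow> nat) \<Rightarrow> fm \<Rightarrow> bool" where
  "fm_sat s (FEq t u) = (tm_val s t = tm_val s u)"
| "fm_sat s (FNot p) = (\<not> fm_sat s p)"
| "fm_sat s (FAnd p q) = (fm_sat s p \<and> fm_sat s q)"
| "fm_sat s (FAll i p) = (\<forall>n. fm_sat (s(i := n)) p)"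

primrec tm_vars :: "tm \<Rightarrow> nat set" where
  "tm_vars (TVar i) = {i}"
| "tm_vars TZero = {}"
| "tm_vars (TSucc t) = tm_vars t"
| "tm_vars (TAdd t u) = tm_vars t \<union> tm_vars u"
| "tm_vars (TMul t u) = tm_vars t \<union> tm_vars u"

primrec fm_free :: "fm \<Rightarrow> nat set" where
  "fm_free (FEq t u) = tm_vars t \<union> tm_vars u"
| "fm_free (FNot p) = fm_free p"
| "fm_free (FAnd p q) = fm_free p \<union> fm_free q"
| "fm_free (FAll i p) = fm_free p - {i}"

primrec tm_code :: "tm \<Rightarrow> nat" where
  "tm_code (TVar i) = list_encode [0, i]"
| "tm_code TZero = list_encode [1]"
| "tm_code (TSucc t) = list_encode [2, tm_code t]"
| "tm_code (TAdd t u) = list_encode [3, tm_code t, tm_code u]"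
| "tm_code (TMul t u) = list_encode [4, tm_code t, tm_code u]"

primrec fm_code :: "fm \<Rightarrow> nat" where
  "fm_code (FEq t u) = list_encode [0, tm_code t, tm_code u]"
| "fm_code (FNot p) = list_encode [1, fm_code p]"
| "fm_code (FAnd p q) = list_encode [2, fm_code p, fm_code q]"
| "fm_code (FAll i p) = list_encode [3, i, fm_code p]"

definition arithmetical :: "(nat \<Rightarrow> nat) \<Rightarrow> bool" where
  "arithmetical f \<longleftrightarrow>
     (\<exists>p. fm_free p \<subseteq> {0, 1} \<and> (\<forall>s. fm_sat s p \<longleftrightarrow> s 1 = f (s 0)))"

definition truth_fun :: "nat \<Rightarrow> nat" where
  "truth_fun n = (if \<exists>p. fm_code p = n \<and> fm_free p = {} \<and> (\<forall>s. fm_sat s p) then 1 else 0)"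


section \<open>The nonstandard model\<close>

text \<open>
  In this section \<open>a\<close> is the enumeration \<open>\<alpha>\<^sub>0, \<alpha>\<^sub>1, \<dots>\<close>. \<open>ordered_restrictions a k A\<close> is the list
  \<open>\<beta>\<^sub>1 < \<dots> < \<beta>\<^sub>l\<close> of the distinct restrictions of \<open>\<alpha>\<^sub>0, \<dots>, \<alpha>\<^sub>k\<close> to \<open>A\<close>.
\<close>

definition ordered_restrictions ::
  "(nat \<Rightarrow> nat \<Rightarrow> nat) \<Rightarrow> nat \<Rightarrow> nat set \<Rightarrow> (nat \<Rightarrow> nat) list" where
  "ordered_restrictions a k A =
     (THE bs. set bs = (\<lambda>i. restrict (a i) A) ` {..k} \<and>
       sorted_wrt (\<lambda>b c. \<forall>x\<in>A. b x < c x) bs)"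

text \<open>
  The list \<open>{x \<in> A | f x < \<beta>\<^sub>1 x}\<close>, \<open>{x \<in> A | f x = \<beta>\<^sub>1 x}\<close>, \<open>{x \<in> A | \<beta>\<^sub>1 x < f x < \<beta>\<^sub>2 x}\<close>, \<open>\<dots>\<close>,
  \<open>{x \<in> A | \<beta>\<^sub>l x < f x}\<close>; the recursive call restricts \<open>A\<close> to the points above the first bound.
\<close>

primrec cells :: "nat set \<Rightarrow> (nat \<Rightarrow> nat) \<Rightarrow> (nat \<Rightarrow> nat) list \<Rightarrow> nat set list" where
  "cells A f [] = [A]"
| "cells A f (b # bs) =
     {x \<in> A. f x < b x} # {x \<in> A. f x = b x} # cells {x \<in> A. b x < f x} f bs"

lemma cells_example:
  assumes "\<forall>x\<in>A. b x < c x"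
  shows "cells A f [b, c] =
    [{x \<in> A. f x < b x}, {x \<in> A. f x = b x}, {x \<in> A. b x < f x \<and> f x < c x},
     {x \<in> A. f x = c x}, {x \<in> A. c x < f x}]"
  using assms by auto

primrec stage :: "(nat \<Rightarrow> nat \<Rightarrow> nat) \<Rightarrow> nat \<Rightarrow> nat set" where
  "stage a 0 = UNIV"
| "stage a (Suc k) =
     the (find infinite (cells (stage a k) (a (Suc k)) (ordered_restrictions a k (stage a k))))"

primrec \<psi> :: "(nat \<Rightarrow> nat \<Rightarrow> nat) \<Rightarrow> nat \<Rightarrow> nat" where
  "\<psi> a 0 = 0"
| "\<psi> a (Suc k) = (LEAST x. x \<in> stage a (Suc k) \<and> x > \<psi> a k)"

text \<open>
  The whole construction (the enumeration itself, the stages \<open>A\<^sub>k\<close> and \<open>\<psi>\<close>) is recursive in the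
  truth function; functions of two arguments take codes of pairs.
\<close>

definition construction_recursive :: "(nat \<Rightarrow> nat \<Rightarrow> nat) \<Rightarrow> bool" where
  "construction_recursive a \<longleftrightarrow>
     recursive_in truth_fun (\<lambda>c. case prod_decode c of (k, x) \<Rightarrow> Some (a k x)) \<and>
     recursive_in truth_fun
       (\<lambda>c. case prod_decode c of (k, x) \<Rightarrow> Some (if x \<in> stage a k then 1 else 0)) \<and>
     recursive_in truth_fun (\<lambda>k. Some (\<psi> a k))"

definition ns_equiv :: "(nat \<Rightarrow> nat \<Rightarrow> nat) \<Rightarrow> ((nat \<Rightarrow> nat) \<times> (nat \<Rightarrow> nat)) set" where
  "ns_equiv a = {(f, g). arithmetical f \<and> arithmetical g \<and>
     (\<forall>\<^sub>F n in sequentially. f (\<psi> a n) = g (\<psi> a n))}"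

definition ns_model :: "(nat \<Rightarrow> nat \<Rightarrow> nat) \<Rightarrow> (nat \<Rightarrow> nat) set eff" where
  "ns_model a = assembly ({f. arithmetical f} // ns_equiv a)
     (\<lambda>c. {e. \<exists>f\<in>c. represents e (\<lambda>n. f (\<psi> a n))})"

end

theory Submission
  imports Defs
begin

text \<open>
  Two facts carry the theorem. The first is that \<open>\<J>\<close> commutes with binary intersections and preserves
  the empty set (\<open>J_Int\<close>, \<open>J_empty\<close>): a number that lies in \<open>\<J> A\<close> and in \<open>\<J> B\<close> can be treated as a
  number computing one element common to \<open>A\<close> and \<open>B\<close>. Call an object modest if a common realizer of
  the existence of \<open>x\<close> and of \<open>x'\<close> can be converted, uniformly, into a realizer of \<open>x = x'\<close>. The
  numbers are modest, and so is the nonstandard model, because an index represents at most one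
  function. Modesty passes to subobjects, to quotients, and from \<open>Y\<close> to \<open>Y\<^sup>X\<close> for every \<open>X\<close>
  (\<open>modest_subobject\<close>, \<open>modest_quotient\<close>, \<open>modest_exp\<close>). So every object named in the theorem is modest.

  The second fact is that one number realizes the existence of all truth values \<open>p\<close> at once. Let \<open>R\<close>
  be a functional relation from \<open>\<Omega>\<close> to a modest \<open>X\<close>. Its totality realizer, applied to that number,
  yields one \<open>t\<close> that lies in \<open>\<J> (\<Union>x. R (p, x))\<close> for all \<open>p\<close>. For two truth values \<open>p\<close>, \<open>p'\<close> the
  number \<open>t\<close> therefore computes some \<open>a\<close> in \<open>R (p, x) \<inter> R (p', x')\<close>; strictness turns \<open>a\<close> into a common
  realizer of the existence of \<open>x\<close> and \<open>x'\<close>; hence \<open>x = x'\<close>. So \<open>R\<close> is constant, with realizers that do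
  not depend on \<open>p\<close> and \<open>p'\<close>, and its value can be read off at \<open>p = \<top>\<close>. This makes \<open>X \<rightarrow> X\<^sup>\<Omega>\<close>
  surjective in the internal logic (\<open>slice_fst_rel_surjective\<close>); it is injective by evaluation at any
  truth value, and a map with both properties is an isomorphism (\<open>graph_rel_iso\<close>).

  The realizers that this argument needs are written as terms of a call-by-value lambda calculus in
  which every computation is wrapped in \<open>\<J>\<close>. The judgement \<open>\<Gamma> \<turnstile> t \<triangleright> A\<close> says that \<open>t\<close> computes an
  element of \<open>\<J> A\<close> when its variables have the values \<open>\<Gamma>\<close>. The sets of realizers are ordinary sets,
  so the typing derivations are ordinary proofs about fixed elements; uniformity is automatic because
  the term does not mention these elements. Recursion theory enters only in the soundness of the
  calculus: it rests on a universal code, the s-m-n theorem, and the extension of a realizer of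
  \<open>A \<rightarrow> \<J> B\<close> to \<open>\<J> A\<close> (\<open>J_bind\<close>).

  Monomorphisms and epimorphisms are defined by cancellation. Their internal injectivity and
  surjectivity is obtained by testing on the kernel pair, and on a subobject of \<open>X \<times> \<Omega>\<close> in which two
  copies of \<open>X\<close> agree exactly over the image.
\<close>

section \<open>Computable functions\<close>

abbreviation pcode :: "nat \<Rightarrow> nat \<Rightarrow> nat" where "pcode a b \<equiv> prod_encode (a, b)"
abbreviation pfst :: "nat \<Rightarrow> nat" where "pfst n \<equiv> fst (prod_decode n)"
abbreviation psnd :: "nat \<Rightarrow> nat" where "psnd n \<equiv> snd (prod_decode n)"

definition computable :: "(nat \<Rightarrow> nat) \<Rightarrow> bool" where
  "computable f \<longleftrightarrow> (\<exists>c. \<forall>n. code_eval c n = Some (f n))"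

lemma computable_comp: "computable f \<Longrightarrow> computable g \<Longrightarrow> computable (\<lambda>n. f (g n))"
  unfolding computable_def
proof (elim exE)
  fix c d assume "\<forall>n. code_eval c n = Some (f n)" "\<forall>n. code_eval d n = Some (g n)"
  then show "\<exists>c. \<forall>n. code_eval c n = Some (f (g n))"
    by (intro exI[of _ "CComp c d"]) (simp add: pf_comp_def)
qed

lemma computable_pair:
  "computable f \<Longrightarrow> computable g \<Longrightarrow> computable (\<lambda>n. pcode (f n) (g n))"
  unfolding computable_def
proof (elim exE)
  fix c d assume "\<forall>n. code_eval c n = Some (f n)" "\<forall>n. code_eval d n = Some (g n)"
  then show "\<exists>c. \<forall>n. code_eval c n = Some (pcode (f n) (g n))"
    by (intro exI[of _ "CPair c d"]) (simp add: pf_pair_def)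
qed

lemma computable_pfst: "computable f \<Longrightarrow> computable (\<lambda>n. pfst (f n))"
  by (rule computable_comp[of pfst]) (auto simp: computable_def pf_left_def intro: exI[of _ CLeft])

lemma computable_psnd: "computable f \<Longrightarrow> computable (\<lambda>n. psnd (f n))"
  by (rule computable_comp[of psnd]) (auto simp: computable_def pf_right_def intro: exI[of _ CRight])

lemma computable_Suc: "computable f \<Longrightarrow> computable (\<lambda>n. Suc (f n))"
  by (rule computable_comp[of Suc]) (auto simp: computable_def intro: exI[of _ CSucc])

lemma computable_id: "computable (\<lambda>n. n)"
  unfolding computable_def
  by (rule exI[of _ "CPair CLeft CRight"]) (simp add: pf_pair_def pf_left_def pf_right_def)

lemma computable_const: "computable (\<lambda>n. k)"
proof (induction k)
  case 0
  show ?case unfolding computable_def by (rule exI[of _ CZero]) simp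
qed (rule computable_Suc)

lemma computable_rec:
  assumes "computable f" "computable g" "computable h"
  shows "computable (\<lambda>n. rec_nat (f n) (\<lambda>k y. g (pcode n (pcode k y))) (h n))"
proof -
  obtain c d where c: "\<And>n. code_eval c n = Some (f n)" and d: "\<And>n. code_eval d n = Some (g n)"
    using assms unfolding computable_def by blast
  have "code_eval (CPrec c d) (pcode a n) = Some (rec_nat (f a) (\<lambda>k y. g (pcode a (pcode k y))) n)" for a n
    by (induction n) (simp_all add: pf_prec_def c d)
  then have "computable (\<lambda>m. rec_nat (f (pfst m)) (\<lambda>k y. g (pcode (pfst m) (pcode k y))) (psnd m))"
    unfolding computable_def by (metis prod.collapse prod_decode_inverse)
  from computable_comp[OF this computable_pair[OF computable_id assms(3)]] show ?thesis by simp
qed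

lemma computable_pred: "computable f \<Longrightarrow> computable (\<lambda>n. f n - 1)"
proof -
  assume f: "computable f"
  have "rec_nat 0 (\<lambda>k y. pfst (psnd (pcode n (pcode k y)))) m = m - 1" for n m :: nat
    by (cases m) simp_all
  with computable_rec[OF computable_const computable_pfst[OF computable_psnd[OF computable_id]] f, of 0]
  show ?thesis by simp
qed

lemma computable_diff_numeral:
  assumes "computable f" shows "computable (\<lambda>n. f n - k)"
proof (induction k)
  case (Suc k)
  from computable_pred[OF this] show ?case by simp
qed (simp add: assms)

lemma computable_if:
  assumes "computable b" "computable f" "computable g"
  shows "computable (\<lambda>n. if b n = 0 then f n else g n)"
proof -
  have "rec_nat (f n) (\<lambda>k y. g (pfst (pcode n (pcode k y)))) m = (if m = 0 then f n else g n)" for n m :: nat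
    by (cases m) simp_all
  with computable_rec[OF assms(2) computable_comp[OF assms(3) computable_pfst[OF computable_id]] assms(1)]
  show ?thesis by simp
qed

lemma computable_iterate:
  assumes "computable s" "computable f" "computable g"
  shows "computable (\<lambda>n. (s ^^ f n) (g n))"
proof -
  have "rec_nat (g n) (\<lambda>k y. s (psnd (psnd (pcode n (pcode k y))))) m = (s ^^ m) (g n)" for n m :: nat
    by (induction m) simp_all
  with computable_rec[OF assms(3) computable_comp[OF assms(1) computable_psnd[OF computable_psnd[OF computable_id]]] assms(2)]
  show ?thesis by simp
qed

lemma computable_add:
  assumes "computable f" "computable g"
  shows "computable (\<lambda>n. f n + g n)"
proof -
  have "(Suc ^^ m) k = m + k" for m k by (induction m) simp_all
  with computable_iterate[OF computable_Suc[OF computable_id] assms] show ?thesis by simp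
qed

lemma computable_divmod4:
  assumes "computable f"
  shows "computable (\<lambda>n. f n div 4)" "computable (\<lambda>n. f n mod 4)"
proof -
  define s where "s p = (if 3 - psnd p = 0 then pcode (Suc (pfst p)) 0 else pcode (pfst p) (Suc (psnd p)))" for p
  have 3: "computable (\<lambda>n. 3 - f n)" if "computable f" for f :: "nat \<Rightarrow> nat"
  proof -
    have "((\<lambda>m. m - 1) ^^ m) k = k - m" for m k :: nat by (induction m) simp_all
    with computable_iterate[OF computable_pred[OF computable_id] that computable_const[of 3]]
    show ?thesis by simp
  qed
  have "computable s"
    unfolding s_def
    by (intro computable_if computable_pair computable_Suc computable_pfst computable_psnd
        computable_const 3 computable_id)
  moreover have "(s ^^ m) 0 = pcode (m div 4) (m mod 4)" for m
  proof (induction m)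
    case 0
    show ?case by (simp add: prod_encode_def)
  next
    case (Suc m)
    have "m mod 4 < 4" by simp
    moreover have "(s ^^ Suc m) 0 = s (pcode (m div 4) (m mod 4))" by (simp add: Suc)
    moreover have "s (pcode q r) = (if 3 \<le> r then pcode (Suc q) 0 else pcode q (Suc r))" for q r
      by (simp add: s_def)
    ultimately show ?case by (auto simp: div_Suc mod_Suc)
  qed
  ultimately have "computable (\<lambda>n. pcode (f n div 4) (f n mod 4))"
    using computable_iterate[OF _ assms computable_const[of 0], of s] by simp
  from computable_pfst[OF this] computable_psnd[OF this]
  show "computable (\<lambda>n. f n div 4)" "computable (\<lambda>n. f n mod 4)" by simp_all
qed

lemmas computable_intros = computable_if computable_pair computable_Suc computable_pfst computable_psnd
  computable_const computable_id computable_divmod4 computable_diff_numeral computable_add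

section \<open>A universal code\<close>

text \<open>
  The universal code runs a stack machine. A state is a pair of a stack and a current value; the empty
  stack is \<open>0\<close>. Frames carry a tag. Tag \<open>0\<close> holds an index that is to be applied to the current value.
  The other tags say what to do with the value that the frames above return: \<open>1\<close> and \<open>2\<close> after the first
  and the second component of a pair, \<open>3\<close> after a round of primitive recursion (with the index of the
  step, the parameter, and the rounds done and left), \<open>4\<close> after a test of minimisation (with the index
  of the test, the parameter, and the number tested). One step uses total operations only, so that a
  case distinction never evaluates a diverging branch.
\<close>
definition push :: "nat \<Rightarrow> nat \<Rightarrow> nat" where "push fr K = Suc (pcode fr K)"

definition ev_step :: "nat \<Rightarrow> nat \<Rightarrow> nat \<Rightarrow> nat" where
  "ev_step d K v =
    (if d = 0 then pcode K 0 else if d - 1 = 0 then pcode K (Suc v)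
     else if d - 2 = 0 then pcode K (pfst v) else if d - 3 = 0 then pcode K (psnd v)
     else if (d - 4) mod 4 = 0 then
       pcode (push (pcode 0 (pfst ((d - 4) div 4))) (push (pcode 1 (pcode (psnd ((d - 4) div 4)) v)) K)) v
     else if (d - 4) mod 4 - 1 = 0 then
       pcode (push (pcode 0 (psnd ((d - 4) div 4))) (push (pcode 0 (pfst ((d - 4) div 4))) K)) v
     else if (d - 4) mod 4 - 2 = 0 then
       pcode (push (pcode 0 (pfst ((d - 4) div 4)))
         (push (pcode 3 (pcode (psnd ((d - 4) div 4)) (pcode (pfst v) (pcode 0 (psnd v))))) K)) (pfst v)
     else pcode (push (pcode 0 ((d - 4) div 4)) (push (pcode 4 (pcode ((d - 4) div 4) (pcode v 0))) K)) (pcode v 0))"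

definition ret_step :: "nat \<Rightarrow> nat \<Rightarrow> nat \<Rightarrow> nat \<Rightarrow> nat" where
  "ret_step tag d K v =
    (if tag - 1 = 0 then pcode (push (pcode 0 (pfst d)) (push (pcode 2 v) K)) (psnd d)
     else if tag - 2 = 0 then pcode K (pcode d v)
     else if tag - 3 = 0 then
       (if psnd (psnd (psnd d)) = 0 then pcode K v
        else pcode (push (pcode 0 (pfst d)) (push (pcode 3 (pcode (pfst d) (pcode (pfst (psnd d))
          (pcode (Suc (pfst (psnd (psnd d)))) (psnd (psnd (psnd d)) - 1))))) K)) (pcode (pfst (psnd d)) (pcode (pfst (psnd (psnd d))) v)))
     else (if v = 0 then pcode K (psnd (psnd d))
        else pcode (push (pcode 0 (pfst d)) (push (pcode 4 (pcode (pfst d) (pcode (pfst (psnd d)) (Suc (psnd (psnd d)))))) K))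
          (pcode (pfst (psnd d)) (Suc (psnd (psnd d))))))"

definition step :: "nat \<Rightarrow> nat" where
  "step s = (if pfst s = 0 then s
     else if pfst (pfst (pfst s - 1)) = 0 then ev_step (psnd (pfst (pfst s - 1))) (psnd (pfst s - 1)) (psnd s)
     else ret_step (pfst (pfst (pfst s - 1))) (psnd (pfst (pfst s - 1))) (psnd (pfst s - 1)) (psnd s))"

lemma computable_push:
  "computable f \<Longrightarrow> computable g \<Longrightarrow> computable (\<lambda>n. push (f n) (g n))"
  unfolding push_def by (intro computable_Suc computable_pair)

lemma computable_ev_step:
  assumes "computable f" "computable g" "computable h"
  shows "computable (\<lambda>n. ev_step (f n) (g n) (h n))"
proof -
  have "computable (\<lambda>n. ev_step (pfst n) (pfst (psnd n)) (psnd (psnd n)))"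
    unfolding ev_step_def by (intro computable_intros computable_push)
  from computable_comp[OF this, of "\<lambda>n. pcode (f n) (pcode (g n) (h n))"] show ?thesis
    using assms by (simp add: computable_pair)
qed

lemma computable_ret_step:
  assumes "computable e" "computable f" "computable g" "computable h"
  shows "computable (\<lambda>n. ret_step (e n) (f n) (g n) (h n))"
proof -
  have "computable (\<lambda>n. ret_step (pfst n) (pfst (psnd n)) (pfst (psnd (psnd n))) (psnd (psnd (psnd n))))"
    unfolding ret_step_def by (intro computable_intros computable_push)
  from computable_comp[OF this, of "\<lambda>n. pcode (e n) (pcode (f n) (pcode (g n) (h n)))"] show ?thesis
    using assms by (simp add: computable_pair)
qed

lemma computable_step: "computable step"
  unfolding step_def by (intro computable_intros computable_ev_step computable_ret_step)

lemma step_push: "step (pcode (push (pcode tag d) K) v) =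
   (if tag = 0 then ev_step d K v else ret_step tag d K v)"
  by (simp add: step_def push_def)

definition reach :: "nat \<Rightarrow> nat \<Rightarrow> bool" where "reach s t \<longleftrightarrow> (\<exists>n. (step ^^ n) s = t)"

lemma reach_refl: "reach s s"
  unfolding reach_def by (rule exI[of _ 0]) simp

lemma reach_trans: "reach s t \<Longrightarrow> reach t u \<Longrightarrow> reach s u"
  unfolding reach_def by (metis comp_apply funpow_add)

lemma reach_step: "reach (step s) t \<Longrightarrow> reach s t"
  unfolding reach_def by (metis funpow_Suc_right comp_apply)

text \<open>
  Only convergent computations have to be simulated, because membership in \<open>A \<^bold>\<rightarrow> B\<close> restricts an index
  only where it has to converge.
\<close>
definition runs :: "nat \<Rightarrow> bool" where
  "runs e \<longleftrightarrow> (\<forall>v w K. \<phi> e v = Some w \<longrightarrow> reach (pcode (push (pcode 0 e) K) v) (pcode K w))"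

lemma runsD: "runs e \<Longrightarrow> \<phi> e v = Some w \<Longrightarrow> reach (pcode K w) t \<Longrightarrow> reach (pcode (push (pcode 0 e) K) v) t"
  unfolding runs_def using reach_trans by blast

lemma reach_prec:
  assumes b: "runs b"
    and k: "k + m = n"
    and y: "rec_nat (\<phi> a x) (\<lambda>k r. Option.bind r (\<lambda>y. \<phi> b (pcode x (pcode k y)))) k = Some y"
    and w: "rec_nat (\<phi> a x) (\<lambda>k r. Option.bind r (\<lambda>y. \<phi> b (pcode x (pcode k y)))) n = Some w"
  shows "reach (pcode (push (pcode 3 (pcode b (pcode x (pcode k m)))) K) y) (pcode K w)"
  using k y
proof (induction m arbitrary: k y)
  case 0
  with w show ?case
    by - (rule reach_step, simp add: step_push ret_step_def reach_refl)
next
  case (Suc m)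
  let ?r = "rec_nat (\<phi> a x) (\<lambda>k r. Option.bind r (\<lambda>y. \<phi> b (pcode x (pcode k y))))"
  have none: "?r j = None \<Longrightarrow> ?r (j + i) = None" for j i by (induction i) simp_all
  have "?r (Suc k) \<noteq> None"
  proof
    assume "?r (Suc k) = None"
    from none[OF this, of m] have "?r n = None" using Suc.prems(1) by (metis add_Suc_shift)
    with w show False by (metis option.distinct(1))
  qed
  then obtain y' where y': "?r (Suc k) = Some y'" by blast
  with Suc.prems have "\<phi> b (pcode x (pcode k y)) = Some y'" by simp
  moreover have "reach (pcode (push (pcode 3 (pcode b (pcode x (pcode (Suc k) m)))) K) y') (pcode K w)"
    by (rule Suc.IH[OF _ y']) (use Suc.prems(1) in linarith)
  ultimately have "reach (pcode (push (pcode 0 b) (push (pcode 3 (pcode b (pcode x (pcode (Suc k) m)))) K)) (pcode x (pcode k y)))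
      (pcode K w)"
    by (rule runsD[OF b])
  then show ?case
    by - (rule reach_step, simp add: step_push ret_step_def)
qed

lemma reach_mu:
  assumes q: "runs q" and z: "\<phi> q (pcode v n) = Some 0"
    and less: "\<And>j. j < n \<Longrightarrow> \<exists>u. \<phi> q (pcode v j) = Some u \<and> u \<noteq> 0"
    and k: "k + m = n" and y: "\<phi> q (pcode v k) = Some y"
  shows "reach (pcode (push (pcode 4 (pcode q (pcode v k))) K) y) (pcode K n)"
  using k y
proof (induction m arbitrary: k y)
  case 0
  with z show ?case
    by - (rule reach_step, simp add: step_push ret_step_def reach_refl)
next
  case (Suc m)
  have "y \<noteq> 0" using less[of k] Suc.prems by auto
  obtain y' where y': "\<phi> q (pcode v (Suc k)) = Some y'"
    using less[of "Suc k"] z Suc.prems by (cases "Suc k = n") auto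
  have "reach (pcode (push (pcode 4 (pcode q (pcode v (Suc k)))) K) y') (pcode K n)"
    by (rule Suc.IH[OF _ y']) (use Suc.prems(1) in linarith)
  from runsD[OF q y' this] \<open>y \<noteq> 0\<close> show ?case
    by - (rule reach_step, simp add: step_push ret_step_def)
qed

lemma code_of_nat_small:
  "code_of_nat 0 = CZero" "code_of_nat (Suc 0) = CSucc" "code_of_nat 2 = CLeft" "code_of_nat 3 = CRight"
  using code_of_nat.simps[of 0] code_of_nat.simps[of "Suc 0"] code_of_nat.simps[of 2] code_of_nat.simps[of 3]
  by simp_all

lemma code_of_nat_big:
  assumes "4 \<le> e" and "m = (e - 4) div 4"
  shows "(e - 4) mod 4 = 0 \<Longrightarrow> code_of_nat e = CPair (code_of_nat (pfst m)) (code_of_nat (psnd m))"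
    and "(e - 4) mod 4 = 1 \<Longrightarrow> code_of_nat e = CComp (code_of_nat (pfst m)) (code_of_nat (psnd m))"
    and "(e - 4) mod 4 = 2 \<Longrightarrow> code_of_nat e = CPrec (code_of_nat (pfst m)) (code_of_nat (psnd m))"
    and "(e - 4) mod 4 = 3 \<Longrightarrow> code_of_nat e = CMu (code_of_nat m)"
  using assms code_of_nat.simps[of e] by (simp_all add: Let_def)

lemma runs: "runs e"
proof (induction e rule: less_induct)
  case (less e)
  show ?case unfolding runs_def
  proof (intro allI impI)
    fix v w K assume w: "\<phi> e v = Some w"
    define m where "m = (e - 4) div 4"
    have step1: "reach (pcode (push (pcode 0 e) K) v) (pcode K w)" if "reach (ev_step e K v) (pcode K w)"
      using that by - (rule reach_step, simp add: step_push)
    show "reach (pcode (push (pcode 0 e) K) v) (pcode K w)"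
    proof (cases "e < 4")
      case True
      then consider "e = 0" | "e = Suc 0" | "e = 2" | "e = 3" by linarith
      then show ?thesis
        using w by cases (rule step1, simp add: \<phi>_def code_of_nat_small ev_step_def reach_refl
            pf_left_def pf_right_def)+
    next
      case False
      then have e4: "4 \<le> e" by simp
      have m: "m < e" using e4 by (simp add: m_def)
      then have a: "pfst m < e" and b: "psnd m < e"
        using fst_prod_decode_le[of m] snd_prod_decode_le[of m] by linarith+
      note runs_m = less.IH[OF m] less.IH[OF a] less.IH[OF b]
      note big = code_of_nat_big[OF e4 m_def]
      have "(e - 4) mod 4 < 4" by simp
      then consider "(e - 4) mod 4 = 0" | "(e - 4) mod 4 = 1" | "(e - 4) mod 4 = 2" | "(e - 4) mod 4 = 3"
        by linarith
      then show ?thesis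
      proof cases
        case 1
        then obtain x y where x: "\<phi> (pfst m) v = Some x" and y: "\<phi> (psnd m) v = Some y" and "w = pcode x y"
          using w big(1) by (auto simp: \<phi>_def pf_pair_def bind_eq_Some_conv)
        have "reach (pcode (push (pcode 2 x) K) y) (pcode K w)"
          by - (rule reach_step, simp add: step_push ret_step_def reach_refl \<open>w = _\<close>)
        then have "reach (pcode (push (pcode 1 (pcode (psnd m) v)) K) x) (pcode K w)"
          by - (rule reach_step, simp add: step_push ret_step_def runsD[OF runs_m(3) y])
        then show ?thesis using 1 e4
          by - (rule step1, simp add: ev_step_def m_def[symmetric] runsD[OF runs_m(2) x])
      next
        case 2
        then obtain x where x: "\<phi> (psnd m) v = Some x" and y: "\<phi> (pfst m) x = Some w"
          using w big(2) by (auto simp: \<phi>_def pf_comp_def bind_eq_Some_conv)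
        have "reach (pcode (push (pcode 0 (pfst m)) K) x) (pcode K w)"
          by (rule runsD[OF runs_m(2) y reach_refl])
        then show ?thesis using 2 e4
          by - (rule step1, simp add: ev_step_def m_def[symmetric] runsD[OF runs_m(3) x])
      next
        case 3
        define x n where "x = pfst v" and "n = psnd v"
        have rec: "rec_nat (\<phi> (pfst m) x) (\<lambda>k r. Option.bind r (\<lambda>y. \<phi> (psnd m) (pcode x (pcode k y)))) n = Some w"
          using w big(3)[OF 3] by (simp add: \<phi>_def pf_prec_def x_def n_def split: prod.splits)
        have none: "rec_nat None (\<lambda>k r. Option.bind r (\<lambda>y. \<phi> (psnd m) (pcode x (pcode k y)))) n = None" for n
          by (induction n) simp_all
        obtain y where y: "\<phi> (pfst m) x = Some y" using rec none by (cases "\<phi> (pfst m) x") auto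
        have "reach (pcode (push (pcode 3 (pcode (psnd m) (pcode x (pcode 0 n)))) K) y) (pcode K w)"
          by (rule reach_prec[OF runs_m(3) _ _ rec]) (simp_all add: y)
        then show ?thesis using 3 e4
          by - (rule step1, simp add: ev_step_def m_def[symmetric] x_def[symmetric] n_def[symmetric]
              runsD[OF runs_m(2) y])
      next
        case 4
        let ?P = "\<lambda>n. \<phi> m (pcode v n) = Some 0"
        have "pf_mu (\<phi> m) v = Some w" using w big(4)[OF 4] by (simp add: \<phi>_def)
        then obtain n where n: "?P n" "\<And>k. k < n \<Longrightarrow> \<phi> m (pcode v k) \<noteq> None" and w': "w = (LEAST n. ?P n)"
          unfolding pf_mu_def by (auto split: if_splits)
        have "?P w" unfolding w' by (rule LeastI[of ?P]) fact
        have "w \<le> n" unfolding w' by (rule Least_le[of ?P]) fact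
        have less_w: "\<exists>u. \<phi> m (pcode v j) = Some u \<and> u \<noteq> 0" if "j < w" for j
          using n(2)[of j] not_less_Least[of j ?P] that \<open>w \<le> n\<close> unfolding w' by fastforce
        obtain y where y: "\<phi> m (pcode v 0) = Some y"
          using less_w[of 0] \<open>?P w\<close> by (cases "w = 0") auto
        have "reach (pcode (push (pcode 4 (pcode m (pcode v 0))) K) y) (pcode K w)"
          by (rule reach_mu[OF runs_m(1) \<open>?P w\<close> less_w]) (simp_all add: y)
        then show ?thesis using 4 e4
          by - (rule step1, simp add: ev_step_def m_def[symmetric] runsD[OF runs_m(1) y])
      qed
    qed
  qed
qed

text \<open>A state with empty stack is fixed, so any number of steps that empties the stack gives the same value.\<close>
lemma step_halt: "(step ^^ n) (pcode 0 w) = pcode 0 w"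
  by (induction n) (simp_all add: step_def)

lemma universal_code: "\<exists>U. \<forall>e a v. \<phi> e a = Some v \<longrightarrow> code_eval U (pcode e a) = Some v"
proof -
  define init where "init s = pcode (push (pcode 0 (pfst s)) 0) (psnd s)" for s
  have init: "computable init"
    unfolding init_def by (intro computable_intros computable_push)
  have run: "computable (\<lambda>x. (step ^^ psnd x) (init (pfst x)))"
    by (intro computable_iterate computable_step computable_comp[OF init] computable_intros)
  obtain C where C: "\<And>x. code_eval C x = Some (pfst ((step ^^ psnd x) (init (pfst x))))"
    using computable_pfst[OF run] unfolding computable_def by blast
  obtain D where D: "\<And>x. code_eval D x = Some (psnd ((step ^^ psnd x) (init (pfst x))))"
    using computable_psnd[OF run] unfolding computable_def by blast
  have "code_eval (CComp D (CPair (CPair CLeft CRight) (CMu C))) (pcode e a) = Some v"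
    if v: "\<phi> e a = Some v" for e a v
  proof -
    let ?s = "init (pcode e a)"
    obtain n where n: "(step ^^ n) ?s = pcode 0 v"
      using runsD[OF runs v reach_refl, of 0] unfolding reach_def init_def by auto
    define l where "l = (LEAST n. pfst ((step ^^ n) ?s) = 0)"
    have l: "pfst ((step ^^ l) ?s) = 0" unfolding l_def by (rule LeastI[of _ n]) (simp add: n)
    have "l \<le> n" unfolding l_def by (rule Least_le) (simp add: n)
    define w where "w = psnd ((step ^^ l) ?s)"
    have lw: "(step ^^ l) ?s = pcode 0 w" using l unfolding w_def by (metis prod.collapse prod_decode_inverse)
    have "(step ^^ (n - l)) ((step ^^ l) ?s) = (step ^^ n) ?s"
      using \<open>l \<le> n\<close> funpow_add[of "n - l" l step] by simp
    then have "w = v" using step_halt lw n by simp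
    moreover have "pf_mu (code_eval C) (pcode e a) = Some l"
      unfolding pf_mu_def using C n by (auto simp: l_def intro!: exI[of _ n])
    ultimately show ?thesis
      using lw D by (simp add: pf_comp_def pf_pair_def pf_left_def pf_right_def)
  qed
  then show ?thesis by blast
qed

lemma code_of_nat_codes:
  "code_of_nat (4 + 4 * pcode a b) = CPair (code_of_nat a) (code_of_nat b)"
  "code_of_nat (5 + 4 * pcode a b) = CComp (code_of_nat a) (code_of_nat b)"
  "code_of_nat (6 + 4 * pcode a b) = CPrec (code_of_nat a) (code_of_nat b)"
  "code_of_nat (7 + 4 * m) = CMu (code_of_nat m)"
proof -
  have d: "4 \<le> e" "m = (e - 4) div 4" "(e - 4) mod 4 = k" if "e = 4 + k + 4 * m" "k < 4" for e k m :: nat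
    using that by simp_all
  have e: "4 + 4 * pcode a b = 4 + 0 + 4 * pcode a b" by simp
  have l: "(0::nat) < 4" by simp
  show "code_of_nat (4 + 4 * pcode a b) = CPair (code_of_nat a) (code_of_nat b)"
    using code_of_nat_big(1)[OF d(1)[OF e l] d(2)[OF e l] d(3)[OF e l]] unfolding prod_encode_inverse fst_conv snd_conv .
  have e: "5 + 4 * pcode a b = 4 + 1 + 4 * pcode a b" by simp
  have l: "(1::nat) < 4" by simp
  show "code_of_nat (5 + 4 * pcode a b) = CComp (code_of_nat a) (code_of_nat b)"
    using code_of_nat_big(2)[OF d(1)[OF e l] d(2)[OF e l] d(3)[OF e l]] unfolding prod_encode_inverse fst_conv snd_conv .
  have e: "6 + 4 * pcode a b = 4 + 2 + 4 * pcode a b" by simp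
  have l: "(2::nat) < 4" by simp
  show "code_of_nat (6 + 4 * pcode a b) = CPrec (code_of_nat a) (code_of_nat b)"
    using code_of_nat_big(3)[OF d(1)[OF e l] d(2)[OF e l] d(3)[OF e l]] unfolding prod_encode_inverse fst_conv snd_conv .
  have e: "7 + 4 * m = 4 + 3 + 4 * m" by simp
  have l: "(3::nat) < 4" by simp
  show "code_of_nat (7 + 4 * m) = CMu (code_of_nat m)"
    using code_of_nat_big(4)[OF d(1)[OF e l] d(2)[OF e l] d(3)[OF e l]] unfolding prod_encode_inverse fst_conv snd_conv .
qed

lemma code_index_exists: "\<exists>e. \<phi> e = code_eval c"
proof -
  have "\<exists>e. code_of_nat e = c"
    by (induction c) (metis code_of_nat_small code_of_nat_codes)+
  then show ?thesis unfolding \<phi>_def by blast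
qed

text \<open>
  The index of \<open>\<phi> c \<circ> (\<lambda>a. (a, x))\<close> is \<open>5 + 4 * (c, 4 + 4 * (i, k x))\<close>, where \<open>i\<close> is an index of the
  identity and \<open>k x\<close> is an index of the constant \<open>x\<close>, got by iterating composition with the successor.
  Multiplication by \<open>4\<close> is written as a sum.
\<close>
lemma smn: "\<exists>s. computable s \<and> (\<forall>c x a. \<phi> (s (pcode c x)) a = \<phi> c (pcode a x))"
proof -
  have comp: "\<phi> (5 + 4 * pcode a b) = pf_comp (\<phi> a) (\<phi> b)" for a b
    by (simp add: \<phi>_def code_of_nat_codes)
  have pair: "\<phi> (4 + 4 * pcode a b) = pf_pair (\<phi> a) (\<phi> b)" for a b
    by (simp add: \<phi>_def code_of_nat_codes)
  obtain i where i: "\<And>n. \<phi> i n = Some n"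
    using computable_id code_index_exists unfolding computable_def by metis
  define k where "k n = ((\<lambda>m. 5 + (pcode (Suc 0) m + pcode (Suc 0) m + (pcode (Suc 0) m + pcode (Suc 0) m))) ^^ n) 0" for n
  have "\<phi> 0 = (\<lambda>_. Some 0)" "\<phi> (Suc 0) = (\<lambda>n. Some (Suc n))"
    by (simp_all add: \<phi>_def code_of_nat_small)
  moreover have "k (Suc n) = 5 + 4 * pcode (Suc 0) (k n)" for n by (simp add: k_def)
  moreover have "k 0 = 0" by (simp add: k_def)
  ultimately have k: "\<phi> (k n) a = Some n" for n a
    by (induction n) (simp_all add: comp pf_comp_def)
  define s where "s n = (let q = pcode i (k (psnd n)); r = 4 + (q + q + (q + q)); t = pcode (pfst n) r
    in 5 + (t + t + (t + t)))" for n
  have "computable k"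
    unfolding k_def by (intro computable_iterate computable_intros)
  from computable_comp[OF this computable_psnd[OF computable_id]]
  have "computable s" unfolding s_def Let_def by (intro computable_intros)
  moreover have "s (pcode c x) = 5 + 4 * pcode c (4 + 4 * pcode i (k x))" for c x
    by (simp add: s_def Let_def)
  then have "\<phi> (s (pcode c x)) a = \<phi> c (pcode a x)" for c x a
    by (simp add: comp pair pf_comp_def pf_pair_def i k)
  ultimately show ?thesis by blast
qed

section \<open>Pitts' operator\<close>

abbreviation lpair :: "nat \<Rightarrow> nat \<Rightarrow> nat" where "lpair a b \<equiv> list_encode [a, b]"

lemma lpair_inject [simp]: "lpair a b = lpair c d \<longleftrightarrow> a = c \<and> b = d"
  by (auto simp: list_encode_eq)

declare list_encode.simps [simp del]

lemma J_ret: "a \<in> A \<Longrightarrow> lpair 0 a \<in> \<J> A"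
  unfolding \<J>_def rconj_def by blast

lemma J_delay:
  assumes "\<And>m. n \<le> m \<Longrightarrow> \<exists>b\<in>\<J> A. \<phi> c m = Some b"
  shows "lpair 1 c \<in> \<J> A"
  unfolding \<J>_def
proof (intro InterI, clarify)
  fix B assume B: "{0} \<^bold>\<and> A \<subseteq> B" "{1} \<^bold>\<and> \<F> B \<subseteq> B"
  then have "\<J> A \<subseteq> B" unfolding \<J>_def by blast
  with assms have "c \<in> {n..} \<^bold>\<rightarrow> B" unfolding rarrow_def by fastforce
  then have "c \<in> \<F> B" unfolding \<F>_def by blast
  with B(2) show "lpair 1 c \<in> B" unfolding rconj_def by blast
qed

lemma J_induct [consumes 1, case_names ret delay]:
  assumes v: "v \<in> \<J> A"
    and ret: "\<And>a. a \<in> A \<Longrightarrow> P (lpair 0 a)"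
    and delay: "\<And>c n. (\<And>m. n \<le> m \<Longrightarrow> \<exists>b\<in>\<J> A. \<phi> c m = Some b \<and> P b) \<Longrightarrow> P (lpair 1 c)"
  shows "P v"
proof -
  let ?B = "{v \<in> \<J> A. P v}"
  have "{0} \<^bold>\<and> A \<subseteq> ?B" using ret J_ret unfolding rconj_def by blast
  moreover have "lpair 1 c \<in> ?B" if c: "c \<in> \<F> ?B" for c
  proof -
    obtain n where "c \<in> {n..} \<^bold>\<rightarrow> ?B" using c unfolding \<F>_def by blast
    then have n: "\<exists>b\<in>\<J> A. \<phi> c m = Some b \<and> P b" if "n \<le> m" for m
      using that unfolding rarrow_def by fastforce
    have "P (lpair 1 c)" by (rule delay[OF n])
    moreover have "lpair 1 c \<in> \<J> A" by (rule J_delay[of n]) (use n in blast)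
    ultimately show ?thesis by simp
  qed
  then have "{1} \<^bold>\<and> \<F> ?B \<subseteq> ?B" unfolding rconj_def by blast
  ultimately have "\<J> A \<subseteq> ?B" unfolding \<J>_def by blast
  with v show ?thesis by blast
qed

lemma J_mono: "A \<subseteq> B \<Longrightarrow> \<J> A \<subseteq> \<J> B"
proof -
  assume "A \<subseteq> B"
  then have "{0} \<^bold>\<and> A \<subseteq> {0} \<^bold>\<and> B" unfolding rconj_def by blast
  then show ?thesis unfolding \<J>_def by blast
qed

lemma J_retD: "lpair 0 a \<in> \<J> A \<Longrightarrow> a \<in> A"
proof -
  have "v = lpair 0 a \<longrightarrow> a \<in> A" if "v \<in> \<J> A" for v
    using that by (induction rule: J_induct) auto
  then show "lpair 0 a \<in> \<J> A \<Longrightarrow> a \<in> A" by blast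
qed

lemma J_delayD: "lpair 1 c \<in> \<J> A \<Longrightarrow> \<exists>n. \<forall>m\<ge>n. \<exists>b\<in>\<J> A. \<phi> c m = Some b"
proof -
  have "v = lpair 1 c \<longrightarrow> (\<exists>n. \<forall>m\<ge>n. \<exists>b\<in>\<J> A. \<phi> c m = Some b)" if "v \<in> \<J> A" for v
    using that by (induction rule: J_induct) (auto, metis)
  then show "lpair 1 c \<in> \<J> A \<Longrightarrow> \<exists>n. \<forall>m\<ge>n. \<exists>b\<in>\<J> A. \<phi> c m = Some b" by blast
qed

lemma J_empty: "\<J> {} = {}"
proof -
  have False if "v \<in> \<J> {}" for v
    using that by (induction rule: J_induct) auto
  then show ?thesis by blast
qed

text \<open>
  A computation in both \<open>\<J> A\<close> and \<open>\<J> B\<close> takes the same branch for both: the tag \<open>0\<close> or \<open>1\<close> is part of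
  the number. For infinite intersections this fails, since the bounds beyond which the function behind
  a tag \<open>1\<close> is good need not have a common bound.
\<close>
lemma J_Int: "v \<in> \<J> A \<Longrightarrow> v \<in> \<J> B \<Longrightarrow> v \<in> \<J> (A \<inter> B)"
proof (induction rule: J_induct)
  case (ret a)
  then show ?case by (blast intro: J_ret dest: J_retD)
next
  case (delay c n)
  obtain k where k: "\<And>m. k \<le> m \<Longrightarrow> \<exists>b\<in>\<J> B. \<phi> c m = Some b"
    using J_delayD[OF delay.prems] by blast
  show ?case
  proof (rule J_delay[of "max n k"])
    fix m assume m: "max n k \<le> m"
    obtain b where b: "\<phi> c m = Some b" "b \<in> \<J> B \<longrightarrow> b \<in> \<J> (A \<inter> B)" using delay.IH[of m] m by auto
    moreover have "b \<in> \<J> B" using k[of m] m b(1) by auto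
    ultimately show "\<exists>b\<in>\<J> (A \<inter> B). \<phi> c m = Some b" by blast
  qed
qed

text \<open>The index may converge more often than \<open>f\<close>; realizers are not sensitive to this.\<close>
definition partially_computable :: "(nat \<Rightarrow> nat option) \<Rightarrow> bool" where
  "partially_computable f \<longleftrightarrow> (\<exists>e. \<forall>n v. f n = Some v \<longrightarrow> \<phi> e n = Some v)"

lemma partially_computable_apply: "computable f \<Longrightarrow> computable g \<Longrightarrow> partially_computable (\<lambda>n. \<phi> (f n) (g n))"
proof -
  assume "computable f" "computable g"
  then obtain c where c: "\<And>n. code_eval c n = Some (pcode (f n) (g n))"
    using computable_pair unfolding computable_def by blast
  obtain U where U: "\<And>e a v. \<phi> e a = Some v \<Longrightarrow> code_eval U (pcode e a) = Some v"
    using universal_code by blast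
  obtain e where "\<phi> e = code_eval (CComp U c)" using code_index_exists by blast
  with c U show ?thesis unfolding partially_computable_def by (intro exI[of _ e]) (simp add: pf_comp_def)
qed

lemma partially_computable_bind:
  assumes "partially_computable f" "partially_computable g"
  shows "partially_computable (\<lambda>n. Option.bind (f n) (\<lambda>v. g (pcode n v)))"
proof -
  obtain c d where c: "\<And>n v. f n = Some v \<Longrightarrow> \<phi> c n = Some v" and d: "\<And>n v. g n = Some v \<Longrightarrow> \<phi> d n = Some v"
    using assms unfolding partially_computable_def by blast
  obtain e where "\<phi> e = code_eval (CComp (code_of_nat d) (CPair (CPair CLeft CRight) (code_of_nat c)))"
    using code_index_exists by blast
  then have "\<phi> e = pf_comp (\<phi> d) (pf_pair (\<lambda>n. Some n) (\<phi> c))"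
    by (simp add: \<phi>_def pf_pair_def[abs_def] pf_left_def pf_right_def)
  with c d show ?thesis unfolding partially_computable_def
    by (intro exI[of _ e]) (auto simp: pf_comp_def pf_pair_def bind_eq_Some_conv)
qed

lemma computable_lpair: "computable f \<Longrightarrow> computable g \<Longrightarrow> computable (\<lambda>n. lpair (f n) (g n))"
  unfolding list_encode.simps by (intro computable_intros)

lemma lpair_fst: "pfst (lpair a b - 1) = a" and lpair_snd: "pfst (psnd (lpair a b - 1) - 1) = b"
  by (simp_all add: list_encode.simps)

text \<open>
  The extension \<open>j (f, v)\<close> of \<open>f\<close> has to satisfy \<open>j (f, \<langle>0, a\<rangle>) = f a\<close> and
  \<open>j (f, \<langle>1, c\<rangle>) = \<langle>1, \<lambda>m. j (f, c m)\<rangle>\<close>. The recursion is by self-application: \<open>g\<close> takes its own index as a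
  further argument and passes it on, through \<open>k\<close>, to the delayed computations. The two branches are
  selected by choosing an index and an argument before one single application.
\<close>
lemma J_bind: "\<exists>j. \<forall>f v A B. f \<in> A \<^bold>\<rightarrow> \<J> B \<longrightarrow> v \<in> \<J> A \<longrightarrow> (\<exists>b\<in>\<J> B. \<phi> j (pcode f v) = Some b)"
proof -
  obtain s where s: "computable s" "\<And>c x a. \<phi> (s (pcode c x)) a = \<phi> c (pcode a x)" using smn by blast
  \<comment> \<open>\<open>k\<close> maps \<open>(m, (e, (f, c)))\<close> to \<open>\<phi> e (e, (f, \<phi> c m))\<close>.\<close>
  have "partially_computable (\<lambda>x. Option.bind (\<phi> (psnd (psnd (psnd x))) (pfst x)) (\<lambda>v. \<phi> (pfst (psnd (pfst (pcode x v))))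
      (pcode (pfst (psnd (pfst (pcode x v)))) (pcode (pfst (psnd (psnd (pfst (pcode x v))))) (psnd (pcode x v))))))"
    by (rule partially_computable_bind; rule partially_computable_apply) (intro computable_intros)+
  then obtain k where k: "\<And>x v w. \<phi> (psnd (psnd (psnd x))) (pfst x) = Some v \<Longrightarrow>
      \<phi> (pfst (psnd x)) (pcode (pfst (psnd x)) (pcode (pfst (psnd (psnd x))) v)) = Some w \<Longrightarrow> \<phi> k x = Some w"
    unfolding partially_computable_def by - (erule exE, rule that, erule allE, erule allE, erule mp, simp)
  define d where "d x = lpair 1 (s (pcode k x))" for x
  have "computable d"
    unfolding d_def by (intro computable_lpair computable_comp[OF s(1)] computable_intros)
  then obtain h where h: "\<And>x. \<phi> h x = Some (d x)" using code_index_exists unfolding computable_def by metis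
  \<comment> \<open>\<open>g\<close> acts on \<open>(e, (f, v))\<close>; \<open>?hd\<close> and \<open>?tl\<close> read the tag and the content of \<open>v\<close>.\<close>
  let ?hd = "\<lambda>x. pfst (psnd (psnd x) - 1)" and ?tl = "\<lambda>x. pfst (psnd (psnd (psnd x) - 1) - 1)"
  have "partially_computable (\<lambda>x. \<phi> (if ?hd x = 0 then pfst (psnd x) else h)
      (if ?hd x = 0 then ?tl x else pcode (pfst x) (pcode (pfst (psnd x)) (?tl x))))"
    by (rule partially_computable_apply) (intro computable_intros)+
  then obtain g where g: "\<And>x w. \<phi> (if ?hd x = 0 then pfst (psnd x) else h)
      (if ?hd x = 0 then ?tl x else pcode (pfst x) (pcode (pfst (psnd x)) (?tl x))) = Some w \<Longrightarrow> \<phi> g x = Some w"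
    unfolding partially_computable_def by blast
  have g0: "\<phi> g (pcode e (pcode f (lpair 0 a))) = Some w" if "\<phi> f a = Some w" for e f a w
    by (rule g) (simp add: lpair_fst lpair_snd lpair_fst[simplified] lpair_snd[simplified] that)
  have g1: "\<phi> g (pcode e (pcode f (lpair 1 c))) = Some (d (pcode e (pcode f c)))" for e f c
    by (rule g) (simp add: lpair_fst lpair_snd lpair_fst[simplified] lpair_snd[simplified] h)
  have main: "\<exists>b\<in>\<J> B. \<phi> g (pcode g (pcode f v)) = Some b" if f: "f \<in> A \<^bold>\<rightarrow> \<J> B" and v: "v \<in> \<J> A" for f v A B
    using v
  proof (induction rule: J_induct)
    case (ret a)
    with f g0 show ?case unfolding rarrow_def by blast
  next
    case (delay c n)
    have "\<exists>b\<in>\<J> B. \<phi> (s (pcode k (pcode g (pcode f c)))) m = Some b" if m: "n \<le> m" for m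
    proof -
      obtain v b where "\<phi> c m = Some v" "b \<in> \<J> B" "\<phi> g (pcode g (pcode f v)) = Some b"
        using delay.IH[OF m] by blast
      then show ?thesis using k[of "pcode m (pcode g (pcode f c))" v b] by (simp add: s(2))
    qed
    then have "d (pcode g (pcode f c)) \<in> \<J> B" unfolding d_def by (rule J_delay)
    with g1 show ?case by blast
  qed
  have "partially_computable (\<lambda>x. \<phi> g (pcode g x))" by (rule partially_computable_apply) (intro computable_intros)+
  then obtain j where "\<And>x w. \<phi> g (pcode g x) = Some w \<Longrightarrow> \<phi> j x = Some w" unfolding partially_computable_def by blast
  with main show ?thesis by (intro exI[of _ j]) blast
qed

text \<open>Abstraction over an argument that \<open>g\<close> first takes apart and merges with the environment \<open>x\<close>.\<close>
lemma curry_index_exists: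
  assumes "computable g"
  shows "\<exists>e. \<forall>x. \<exists>f. \<phi> e x = Some (lpair 0 f) \<and> (\<forall>a. \<phi> f a = \<phi> c (g (pcode a x)))"
proof -
  obtain s where s: "computable s" "\<And>c x a. \<phi> (s (pcode c x)) a = \<phi> c (pcode a x)" using smn by blast
  obtain k where k: "\<And>x. code_eval k x = Some (g x)" using assms unfolding computable_def by blast
  obtain d where "\<phi> d = code_eval (CComp (code_of_nat c) k)" using code_index_exists by blast
  then have d: "\<phi> d x = \<phi> c (g x)" for x by (simp add: pf_comp_def k \<phi>_def)
  have "computable (\<lambda>x. lpair 0 (s (pcode d x)))"
    by (intro computable_lpair computable_comp[OF s(1)] computable_intros)
  then obtain e where e: "\<And>x. \<phi> e x = Some (lpair 0 (s (pcode d x)))"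
    using code_index_exists unfolding computable_def by metis
  have "\<exists>f. \<phi> e x = Some (lpair 0 f) \<and> (\<forall>a. \<phi> f a = \<phi> c (g (pcode a x)))" for x
    by (intro exI[of _ "s (pcode d x)"]) (simp add: s(2) d e)
  then show ?thesis by blast
qed

section \<open>A lambda calculus of realizers\<close>

definition env :: "nat list \<Rightarrow> nat" where "env \<Gamma> = fold pcode \<Gamma> 0"

text \<open>
  A term assigns to the number of variables in scope an index that acts on the code of their values.
  Variables are de Bruijn levels: \<open>Var i\<close> is the entry \<open>\<Gamma> ! i\<close>, and a binder appends its variable to
  \<open>\<Gamma>\<close>, so a variable keeps its number when the scope grows.
\<close>
type_synonym trm = "nat \<Rightarrow> nat"

definition has :: "nat list \<Rightarrow> trm \<Rightarrow> nat set \<Rightarrow> bool" ("(_ \<turnstile> _ \<triangleright> _)" [50, 51, 51] 50) where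
  "\<Gamma> \<turnstile> t \<triangleright> A \<longleftrightarrow> (\<exists>v\<in>\<J> A. \<phi> (t (length \<Gamma>)) (env \<Gamma>) = Some v)"

text \<open>
  The constructors choose any index with the required behaviour; that there is one is shown together
  with the typing rule of the constructor.
\<close>
definition Var :: "nat \<Rightarrow> trm" where
  "Var i d = (SOME e. \<forall>\<Gamma>. length \<Gamma> = d \<longrightarrow> i < d \<longrightarrow> \<phi> e (env \<Gamma>) = Some (lpair 0 (\<Gamma> ! i)))"

definition Const :: "nat \<Rightarrow> trm" where
  "Const k d = (SOME e. \<forall>x. \<phi> e x = Some (lpair 0 k))"

definition Lam :: "trm \<Rightarrow> trm" where
  "Lam t d = (SOME e. \<forall>x. \<exists>f. \<phi> e x = Some (lpair 0 f) \<and> (\<forall>a. \<phi> f a = \<phi> (t (Suc d)) (pcode a x)))"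

text \<open>\<open>Lam2\<close> and \<open>Lam3\<close> bind the components of an argument that is a pair or a triple.\<close>
definition Lam2 :: "trm \<Rightarrow> trm" where
  "Lam2 t d = (SOME e. \<forall>x. \<exists>f. \<phi> e x = Some (lpair 0 f) \<and>
     (\<forall>a b. \<phi> f (lpair a b) = \<phi> (t (d + 2)) (pcode b (pcode a x))))"

definition Lam3 :: "trm \<Rightarrow> trm" where
  "Lam3 t d = (SOME e. \<forall>x. \<exists>f. \<phi> e x = Some (lpair 0 f) \<and>
     (\<forall>a b c. \<phi> f (lpair a (lpair b c)) = \<phi> (t (d + 3)) (pcode c (pcode b (pcode a x)))))"

definition App :: "trm \<Rightarrow> trm \<Rightarrow> trm" where
  "App t u d = (SOME e. \<forall>x f a A B. \<phi> (t d) x = Some f \<longrightarrow> f \<in> \<J> (A \<^bold>\<rightarrow> \<J> B) \<longrightarrow>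
     \<phi> (u d) x = Some a \<longrightarrow> a \<in> \<J> A \<longrightarrow> (\<exists>b\<in>\<J> B. \<phi> e x = Some b))"

lemma env_append: "env (\<Gamma> @ [a]) = pcode a (env \<Gamma>)"
  by (simp add: env_def)

lemma has_Var: "i < length \<Gamma> \<Longrightarrow> \<Gamma> ! i \<in> A \<Longrightarrow> \<Gamma> \<turnstile> Var i \<triangleright> A"
proof -
  assume i: "i < length \<Gamma>" and A: "\<Gamma> ! i \<in> A"
  let ?d = "length \<Gamma>"
  have lookup: "pfst ((psnd ^^ (length \<Delta> - 1 - i)) (env \<Delta>)) = \<Delta> ! i" if "i < length \<Delta>" for \<Delta>
    using that
  proof (induction \<Delta> rule: rev_induct)
    case (snoc a \<Delta>)
    show ?case
    proof (cases "i = length \<Delta>")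
      case False
      with snoc.prems have lt: "i < length \<Delta>" by simp
      then have "length (\<Delta> @ [a]) - 1 - i = Suc (length \<Delta> - 1 - i)" by simp
      moreover have "(psnd ^^ Suc m) (pcode a (env \<Delta>)) = (psnd ^^ m) (env \<Delta>)" for m
        by (simp del: funpow.simps add: funpow_Suc_right)
      ultimately show ?thesis
        using snoc.IH[OF lt] lt by (simp del: funpow.simps length_append add: env_append nth_append)
    qed (simp add: env_append)
  qed simp
  have "computable (\<lambda>x. lpair 0 (pfst ((psnd ^^ (?d - 1 - i)) x)))"
    by (intro computable_lpair computable_pfst computable_iterate computable_psnd computable_id computable_const)
  then obtain e where "\<And>x. \<phi> e x = Some (lpair 0 (pfst ((psnd ^^ (?d - 1 - i)) x)))"
    using code_index_exists unfolding computable_def by metis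
  then have "\<exists>e. \<forall>\<Delta>. length \<Delta> = ?d \<longrightarrow> i < ?d \<longrightarrow> \<phi> e (env \<Delta>) = Some (lpair 0 (\<Delta> ! i))"
    using lookup by (metis (no_types, lifting))
  from someI_ex[OF this] i have "\<phi> (Var i ?d) (env \<Gamma>) = Some (lpair 0 (\<Gamma> ! i))"
    unfolding Var_def by blast
  with A J_ret show ?thesis unfolding has_def by blast
qed

lemma has_Const: "k \<in> A \<Longrightarrow> \<Gamma> \<turnstile> Const k \<triangleright> A"
proof -
  assume k: "k \<in> A"
  have "\<exists>e. \<forall>x. \<phi> e x = Some (lpair 0 k)"
    using computable_const[of "lpair 0 k"] code_index_exists unfolding computable_def by metis
  from someI_ex[OF this] have "\<phi> (Const k (length \<Gamma>)) (env \<Gamma>) = Some (lpair 0 k)"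
    unfolding Const_def by blast
  with k J_ret show ?thesis unfolding has_def by blast
qed

text \<open>
  The term does not depend on the index \<open>i\<close>, and this is how uniform realizability enters: one proof for
  an arbitrary \<open>i\<close> gives a realizer common to all \<open>i\<close>.
\<close>
lemma has_Lam:
  assumes "\<And>i a. i \<in> I \<Longrightarrow> a \<in> p i \<Longrightarrow> \<Gamma> @ [a] \<turnstile> t \<triangleright> q i"
  shows "\<Gamma> \<turnstile> Lam t \<triangleright> le_realizers I p q"
proof -
  let ?d = "length \<Gamma>"
  have "\<exists>e. \<forall>x. \<exists>f. \<phi> e x = Some (lpair 0 f) \<and> (\<forall>a. \<phi> f a = \<phi> (t (Suc ?d)) (pcode a x))"
    by (rule curry_index_exists[OF computable_id])
  from someI_ex[OF this] obtain f
    where f: "\<phi> (Lam t ?d) (env \<Gamma>) = Some (lpair 0 f)" "\<And>a. \<phi> f a = \<phi> (t (Suc ?d)) (pcode a (env \<Gamma>))"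
    unfolding Lam_def by blast
  have "f \<in> le_realizers I p q"
    unfolding le_realizers_def rarrow_def
    using assms f(2) unfolding has_def env_append by fastforce
  with f(1) J_ret show ?thesis unfolding has_def by blast
qed

lemma has_Lam2:
  assumes "\<And>i v. i \<in> I \<Longrightarrow> v \<in> p i \<Longrightarrow> \<exists>a b. v = lpair a b \<and> \<Gamma> @ [a, b] \<turnstile> t \<triangleright> q i"
  shows "\<Gamma> \<turnstile> Lam2 t \<triangleright> le_realizers I p q"
proof -
  let ?d = "length \<Gamma>" and ?g = "\<lambda>y. pcode (pfst (psnd (pfst y - 1) - 1)) (pcode (pfst (pfst y - 1)) (psnd y))"
  have g: "computable ?g" by (intro computable_intros)
  have "?g (pcode (lpair a b) x) = pcode b (pcode a x)" for a b x
    by (simp only: lpair_fst lpair_snd prod_encode_inverse fst_conv snd_conv)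
  then have "\<exists>e. \<forall>x. \<exists>f. \<phi> e x = Some (lpair 0 f) \<and>
      (\<forall>a b. \<phi> f (lpair a b) = \<phi> (t (?d + 2)) (pcode b (pcode a x)))"
    using curry_index_exists[OF g, of "t (?d + 2)"] by metis
  from someI_ex[OF this] obtain f where f: "\<phi> (Lam2 t ?d) (env \<Gamma>) = Some (lpair 0 f)"
      "\<And>a b. \<phi> f (lpair a b) = \<phi> (t (?d + 2)) (pcode b (pcode a (env \<Gamma>)))"
    unfolding Lam2_def by blast
  have env: "env (\<Gamma> @ [a, b]) = pcode b (pcode a (env \<Gamma>))" for a b by (simp add: env_def)
  have "\<exists>w\<in>\<J> (q i). \<phi> f v = Some w" if iv: "i \<in> I" "v \<in> p i" for i v
  proof -
    obtain a b where "v = lpair a b" "\<Gamma> @ [a, b] \<turnstile> t \<triangleright> q i" using assms[OF iv] by blast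
    then show ?thesis by (simp add: has_def env f(2))
  qed
  then have "f \<in> le_realizers I p q" unfolding le_realizers_def rarrow_def by blast
  with f(1) J_ret show ?thesis unfolding has_def by blast
qed

lemma has_Lam3:
  assumes "\<And>i v. i \<in> I \<Longrightarrow> v \<in> p i \<Longrightarrow> \<exists>a b c. v = lpair a (lpair b c) \<and> \<Gamma> @ [a, b, c] \<turnstile> t \<triangleright> q i"
  shows "\<Gamma> \<turnstile> Lam3 t \<triangleright> le_realizers I p q"
proof -
  let ?d = "length \<Gamma>" and ?f = "\<lambda>y. pfst (y - 1)" and ?s = "\<lambda>y. pfst (psnd (y - 1) - 1)"
  let ?g = "\<lambda>y. pcode (?s (?s (pfst y))) (pcode (?f (?s (pfst y))) (pcode (?f (pfst y)) (psnd y)))"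
  have g: "computable ?g" by (intro computable_intros)
  have "?g (pcode (lpair a (lpair b c)) x) = pcode c (pcode b (pcode a x))" for a b c x
    by (simp only: lpair_fst lpair_snd prod_encode_inverse fst_conv snd_conv)
  then have "\<exists>e. \<forall>x. \<exists>f. \<phi> e x = Some (lpair 0 f) \<and>
      (\<forall>a b c. \<phi> f (lpair a (lpair b c)) = \<phi> (t (?d + 3)) (pcode c (pcode b (pcode a x))))"
    using curry_index_exists[OF g, of "t (?d + 3)"] by metis
  from someI_ex[OF this] obtain f where f: "\<phi> (Lam3 t ?d) (env \<Gamma>) = Some (lpair 0 f)"
      "\<And>a b c. \<phi> f (lpair a (lpair b c)) = \<phi> (t (?d + 3)) (pcode c (pcode b (pcode a (env \<Gamma>))))"
    unfolding Lam3_def by blast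
  have env: "env (\<Gamma> @ [a, b, c]) = pcode c (pcode b (pcode a (env \<Gamma>)))" for a b c by (simp add: env_def)
  have "\<exists>w\<in>\<J> (q i). \<phi> f v = Some w" if iv: "i \<in> I" "v \<in> p i" for i v
  proof -
    obtain a b c where "v = lpair a (lpair b c)" "\<Gamma> @ [a, b, c] \<turnstile> t \<triangleright> q i" using assms[OF iv] by blast
    then show ?thesis by (simp add: has_def env f(2) numeral_3_eq_3)
  qed
  then have "f \<in> le_realizers I p q" unfolding le_realizers_def rarrow_def by blast
  with f(1) J_ret show ?thesis unfolding has_def by blast
qed
lemma has_App_rarrow:
  assumes t: "\<Gamma> \<turnstile> t \<triangleright> A \<^bold>\<rightarrow> \<J> B" and u: "\<Gamma> \<turnstile> u \<triangleright> A"
  shows "\<Gamma> \<turnstile> App t u \<triangleright> B"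
proof -
  let ?d = "length \<Gamma>"
  obtain s where s: "computable s" "\<And>c x a. \<phi> (s (pcode c x)) a = \<phi> c (pcode a x)" using smn by blast
  obtain j where j: "\<And>f v A B. f \<in> A \<^bold>\<rightarrow> \<J> B \<Longrightarrow> v \<in> \<J> A \<Longrightarrow> \<exists>b\<in>\<J> B. \<phi> j (pcode f v) = Some b"
    using J_bind by blast
  have *: "partially_computable (\<phi> e)" for e unfolding partially_computable_def by blast
  have "partially_computable (\<lambda>x. Option.bind (\<phi> (t ?d) x) (\<lambda>f. (\<lambda>y. Option.bind (\<phi> (u ?d) (pfst y))
      (\<lambda>a. \<phi> j (pcode (s (pcode j (psnd (pcode y a)))) (psnd (pfst (pcode y a)))))) (pcode x f)))"
    by (rule partially_computable_bind[OF *], rule partially_computable_bind; rule partially_computable_apply)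
      (intro computable_comp[OF s(1)] computable_intros)+
  then obtain e where e: "\<And>x f a w. \<phi> (t ?d) x = Some f \<Longrightarrow> \<phi> (u ?d) x = Some a \<Longrightarrow>
      \<phi> j (pcode (s (pcode j a)) f) = Some w \<Longrightarrow> \<phi> e x = Some w"
    unfolding partially_computable_def by - (erule exE, rule that, erule allE, erule allE, erule mp, simp)
  have "\<exists>b\<in>\<J> B. \<phi> e x = Some b"
    if 1: "\<phi> (t ?d) x = Some f" "f \<in> \<J> (A \<^bold>\<rightarrow> \<J> B)" and 2: "\<phi> (u ?d) x = Some a" "a \<in> \<J> A" for x f a A B
  proof -
    \<comment> \<open>Both the function and its argument are computations, so \<open>j\<close> is used twice: the outer use runs
      the function computation and the inner use, with index \<open>s (j, a)\<close>, the argument.\<close>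
    have "s (pcode j a) \<in> (A \<^bold>\<rightarrow> \<J> B) \<^bold>\<rightarrow> \<J> B"
      unfolding rarrow_def[of "A \<^bold>\<rightarrow> \<J> B"] using j[OF _ 2(2)] by (simp add: s(2))
    from j[OF this 1(2)] e[OF 1(1) 2(1)] show ?thesis by blast
  qed
  then have "\<exists>e. \<forall>x f a A B. \<phi> (t ?d) x = Some f \<longrightarrow> f \<in> \<J> (A \<^bold>\<rightarrow> \<J> B) \<longrightarrow>
     \<phi> (u ?d) x = Some a \<longrightarrow> a \<in> \<J> A \<longrightarrow> (\<exists>b\<in>\<J> B. \<phi> e x = Some b)"
    by blast
  from someI_ex[OF this] t u show ?thesis unfolding has_def App_def by blast
qed

lemma has_mono: "\<Gamma> \<turnstile> t \<triangleright> A \<Longrightarrow> A \<subseteq> B \<Longrightarrow> \<Gamma> \<turnstile> t \<triangleright> B"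
  unfolding has_def using J_mono by blast

text \<open>
  This rule has no counterpart in logic: it needs the same term on both sides. All uses of modesty go
  through it.
\<close>
lemma has_Int: "\<Gamma> \<turnstile> t \<triangleright> A \<Longrightarrow> \<Gamma> \<turnstile> t \<triangleright> B \<Longrightarrow> \<Gamma> \<turnstile> t \<triangleright> A \<inter> B"
  unfolding has_def using J_Int by fastforce

lemma has_nonempty: "\<Gamma> \<turnstile> t \<triangleright> A \<Longrightarrow> A \<noteq> {}"
  unfolding has_def using J_empty by blast

lemma has_App:
  assumes "\<Gamma> \<turnstile> t \<triangleright> le_realizers I p q" "\<Gamma> \<turnstile> u \<triangleright> p i" "i \<in> I"
  shows "\<Gamma> \<turnstile> App t u \<triangleright> q i"
proof (rule has_App_rarrow[OF has_mono[OF assms(1)] assms(2)])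
  show "le_realizers I p q \<subseteq> p i \<^bold>\<rightarrow> \<J> (q i)"
    using assms(3) unfolding le_realizers_def by blast
qed

definition LetIn :: "trm \<Rightarrow> trm \<Rightarrow> trm" where "LetIn t u = App (Lam u) t"

lemma has_Let:
  assumes "\<Gamma> \<turnstile> t \<triangleright> A" and "\<And>a. a \<in> A \<Longrightarrow> \<Gamma> @ [a] \<turnstile> u \<triangleright> B"
  shows "\<Gamma> \<turnstile> LetIn t u \<triangleright> B"
proof -
  have "\<Gamma> \<turnstile> Lam u \<triangleright> le_realizers {()} (\<lambda>_. A) (\<lambda>_. B)" by (rule has_Lam) (rule assms(2))
  from has_App[OF this assms(1)] show ?thesis unfolding LetIn_def by blast
qed

definition pair_index :: nat where
  "pair_index = (SOME k. \<forall>A B. k \<in> A \<^bold>\<rightarrow> \<J> (B \<^bold>\<rightarrow> \<J> (A \<^bold>\<and> B)))"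

definition fst_index :: nat where
  "fst_index = (SOME k. \<forall>A B. k \<in> (A \<^bold>\<and> B) \<^bold>\<rightarrow> \<J> A)"

definition snd_index :: nat where
  "snd_index = (SOME k. \<forall>A B. k \<in> (A \<^bold>\<and> B) \<^bold>\<rightarrow> \<J> B)"

definition MkPair :: "trm \<Rightarrow> trm \<Rightarrow> trm" where "MkPair t u = App (App (Const pair_index) t) u"
definition Fst :: "trm \<Rightarrow> trm" where "Fst t = App (Const fst_index) t"
definition Snd :: "trm \<Rightarrow> trm" where "Snd t = App (Const snd_index) t"

lemma has_MkPair:
  assumes "\<Gamma> \<turnstile> t \<triangleright> A" "\<Gamma> \<turnstile> u \<triangleright> B"
  shows "\<Gamma> \<turnstile> MkPair t u \<triangleright> A \<^bold>\<and> B"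
proof -
  obtain s where s: "computable s" "\<And>c x a. \<phi> (s (pcode c x)) a = \<phi> c (pcode a x)" using smn by blast
  have "computable (\<lambda>x. lpair 0 (lpair (psnd x) (pfst x)))" by (intro computable_lpair computable_intros)
  then obtain i where i: "\<And>x. \<phi> i x = Some (lpair 0 (lpair (psnd x) (pfst x)))"
    using code_index_exists unfolding computable_def by metis
  have "computable (\<lambda>x. lpair 0 (s (pcode i x)))"
    by (intro computable_lpair computable_comp[OF s(1)] computable_intros)
  then obtain k where k: "\<And>x. \<phi> k x = Some (lpair 0 (s (pcode i x)))"
    using code_index_exists unfolding computable_def by metis
  have "s (pcode i a) \<in> B \<^bold>\<rightarrow> \<J> (A \<^bold>\<and> B)" if "a \<in> A" for a A B
    using that unfolding rarrow_def by (auto simp: s(2) i rconj_def intro!: J_ret)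
  then have "\<exists>k. \<forall>A B. k \<in> A \<^bold>\<rightarrow> \<J> (B \<^bold>\<rightarrow> \<J> (A \<^bold>\<and> B))"
    unfolding rarrow_def[of _ "\<J> (_ \<^bold>\<rightarrow> _)"] by (intro exI[of _ k]) (simp add: k J_ret)
  from someI_ex[OF this] have "\<Gamma> \<turnstile> Const pair_index \<triangleright> A \<^bold>\<rightarrow> \<J> (B \<^bold>\<rightarrow> \<J> (A \<^bold>\<and> B))"
    unfolding pair_index_def by (blast intro: has_Const)
  from has_App_rarrow[OF has_App_rarrow[OF this assms(1)] assms(2)] show ?thesis unfolding MkPair_def .
qed

lemma has_Fst:
  assumes "\<Gamma> \<turnstile> t \<triangleright> A \<^bold>\<and> B"
  shows "\<Gamma> \<turnstile> Fst t \<triangleright> A"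
proof -
  have "computable (\<lambda>x. lpair 0 (pfst (x - 1)))" by (intro computable_lpair computable_intros)
  then obtain k where k: "\<And>x. \<phi> k x = Some (lpair 0 (pfst (x - 1)))"
    using code_index_exists unfolding computable_def by metis
  have "k \<in> (A \<^bold>\<and> B) \<^bold>\<rightarrow> \<J> A" for A B
    using lpair_fst unfolding rarrow_def by (auto simp: k rconj_def lpair_fst[simplified] intro!: J_ret)
  then have "\<exists>k. \<forall>A B. k \<in> (A \<^bold>\<and> B) \<^bold>\<rightarrow> \<J> A" by blast
  from someI_ex[OF this] have "\<Gamma> \<turnstile> Const fst_index \<triangleright> (A \<^bold>\<and> B) \<^bold>\<rightarrow> \<J> A"
    unfolding fst_index_def by (blast intro: has_Const)
  from has_App_rarrow[OF this assms] show ?thesis unfolding Fst_def .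
qed

lemma has_Snd:
  assumes "\<Gamma> \<turnstile> t \<triangleright> A \<^bold>\<and> B"
  shows "\<Gamma> \<turnstile> Snd t \<triangleright> B"
proof -
  have "computable (\<lambda>x. lpair 0 (pfst (psnd (x - 1) - 1)))" by (intro computable_lpair computable_intros)
  then obtain k where k: "\<And>x. \<phi> k x = Some (lpair 0 (pfst (psnd (x - 1) - 1)))"
    using code_index_exists unfolding computable_def by metis
  have "k \<in> (A \<^bold>\<and> B) \<^bold>\<rightarrow> \<J> B" for A B
    using lpair_snd unfolding rarrow_def by (auto simp: k rconj_def lpair_snd[simplified] intro!: J_ret)
  then have "\<exists>k. \<forall>A B. k \<in> (A \<^bold>\<and> B) \<^bold>\<rightarrow> \<J> B" by blast
  from someI_ex[OF this] have "\<Gamma> \<turnstile> Const snd_index \<triangleright> (A \<^bold>\<and> B) \<^bold>\<rightarrow> \<J> B"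
    unfolding snd_index_def by (blast intro: has_Const)
  from has_App_rarrow[OF this assms] show ?thesis unfolding Snd_def .
qed

lemma tripos_leI:
  assumes "\<And>i a. i \<in> I \<Longrightarrow> a \<in> p i \<Longrightarrow> [a] \<turnstile> t \<triangleright> q i"
  shows "tripos_le I p q"
  unfolding tripos_le_def using has_nonempty[OF has_Lam[of I p "[]" t q]] assms by simp

lemma tripos_leE:
  assumes "tripos_le I p q"
  obtains t where "\<And>\<Gamma>. \<Gamma> \<turnstile> t \<triangleright> le_realizers I p q"
  using assms has_Const unfolding tripos_le_def by blast

lemma tripos_leI2:
  assumes "\<And>i v. i \<in> I \<Longrightarrow> v \<in> p i \<Longrightarrow> \<exists>a b. v = lpair a b \<and> [a, b] \<turnstile> t \<triangleright> q i"
  shows "tripos_le I p q"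
  unfolding tripos_le_def using has_nonempty[OF has_Lam2[of I p "[]" t q]] assms by simp

lemma tripos_leI3:
  assumes "\<And>i v. i \<in> I \<Longrightarrow> v \<in> p i \<Longrightarrow> \<exists>a b c. v = lpair a (lpair b c) \<and> [a, b, c] \<turnstile> t \<triangleright> q i"
  shows "tripos_le I p q"
  unfolding tripos_le_def using has_nonempty[OF has_Lam3[of I p "[]" t q]] assms by simp

lemma has_UN: "\<Gamma> \<turnstile> t \<triangleright> A y \<Longrightarrow> y \<in> Y \<Longrightarrow> \<Gamma> \<turnstile> t \<triangleright> (\<Union>y\<in>Y. A y)"
  by (rule has_mono) auto

lemma has_Let_UN:
  assumes "\<Gamma> \<turnstile> t \<triangleright> (\<Union>y\<in>Y. A y)" and "\<And>y a. y \<in> Y \<Longrightarrow> a \<in> A y \<Longrightarrow> \<Gamma> @ [a] \<turnstile> u \<triangleright> B"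
  shows "\<Gamma> \<turnstile> LetIn t u \<triangleright> B"
  by (rule has_Let[OF assms(1)]) (use assms(2) in blast)

section \<open>Functional relations\<close>

text \<open>
  Names for the four components of a realizer \<open>f\<close> of ``\<open>F\<close> is a functional relation'', applied to
  arguments: strictness, compatibility with equality, single-valuedness, totality.
\<close>
definition Strict :: "trm \<Rightarrow> trm \<Rightarrow> trm" where "Strict f u = App (Fst f) u"
definition Respect :: "trm \<Rightarrow> trm \<Rightarrow> trm \<Rightarrow> trm \<Rightarrow> trm" where "Respect f u v w = App (Fst (Snd f)) (MkPair u (MkPair v w))"
definition Single :: "trm \<Rightarrow> trm \<Rightarrow> trm \<Rightarrow> trm" where "Single f u v = App (Fst (Snd (Snd f))) (MkPair u v)"
definition Total :: "trm \<Rightarrow> trm \<Rightarrow> trm" where "Total f u = App (Snd (Snd (Snd f))) u"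

lemma has_Strict:
  assumes "\<Gamma> \<turnstile> f \<triangleright> functional_realizers X Y F" "\<Gamma> \<turnstile> u \<triangleright> F (x, y)" "x \<in> Car X" "y \<in> Car Y"
  shows "\<Gamma> \<turnstile> Strict f u \<triangleright> Eq X x x \<^bold>\<and> Eq Y y y"
  using has_App[OF has_Fst[OF assms(1)[unfolded functional_realizers_def]] assms(2)] assms(3,4)
  unfolding Strict_def by simp

lemma has_Respect:
  assumes "\<Gamma> \<turnstile> f \<triangleright> functional_realizers X Y F" "\<Gamma> \<turnstile> u \<triangleright> Eq X x x'" "\<Gamma> \<turnstile> v \<triangleright> F (x, y)" "\<Gamma> \<turnstile> w \<triangleright> Eq Y y y'"
    "x \<in> Car X" "x' \<in> Car X" "y \<in> Car Y" "y' \<in> Car Y"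
  shows "\<Gamma> \<turnstile> Respect f u v w \<triangleright> F (x', y')"
  using has_App[where i = "(x, x', y, y')", OF has_Fst[OF has_Snd[OF assms(1)[unfolded functional_realizers_def]]]]
    has_MkPair[OF assms(2) has_MkPair[OF assms(3,4)]] assms(5-8)
  unfolding Respect_def by simp

lemma has_Single:
  assumes "\<Gamma> \<turnstile> f \<triangleright> functional_realizers X Y F" "\<Gamma> \<turnstile> u \<triangleright> F (x, y)" "\<Gamma> \<turnstile> v \<triangleright> F (x, y')"
    "x \<in> Car X" "y \<in> Car Y" "y' \<in> Car Y"
  shows "\<Gamma> \<turnstile> Single f u v \<triangleright> Eq Y y y'"
  using has_App[where i = "(x, y, y')", OF has_Fst[OF has_Snd[OF has_Snd[OF assms(1)[unfolded functional_realizers_def]]]]]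
    has_MkPair[OF assms(2,3)] assms(4-6)
  unfolding Single_def by simp

lemma has_Total:
  assumes "\<Gamma> \<turnstile> f \<triangleright> functional_realizers X Y F" "\<Gamma> \<turnstile> u \<triangleright> Eq X x x" "x \<in> Car X"
  shows "\<Gamma> \<turnstile> Total f u \<triangleright> (\<Union>y\<in>Car Y. F (x, y))"
  using has_App[OF has_Snd[OF has_Snd[OF has_Snd[OF assms(1)[unfolded functional_realizers_def]]]] assms(2,3)]
  unfolding Total_def by simp

definition Functional :: "trm \<Rightarrow> trm \<Rightarrow> trm \<Rightarrow> trm \<Rightarrow> trm" where
  "Functional s r g t = MkPair (Lam s) (MkPair (Lam3 r) (MkPair (Lam2 g) (Lam t)))"

lemma has_Functional:
  assumes "\<And>x y a. x \<in> Car X \<Longrightarrow> y \<in> Car Y \<Longrightarrow> a \<in> F (x, y) \<Longrightarrow> \<Gamma> @ [a] \<turnstile> s \<triangleright> Eq X x x \<^bold>\<and> Eq Y y y"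
    and "\<And>x x' y y' a b c. x \<in> Car X \<Longrightarrow> x' \<in> Car X \<Longrightarrow> y \<in> Car Y \<Longrightarrow> y' \<in> Car Y \<Longrightarrow>
      a \<in> Eq X x x' \<Longrightarrow> b \<in> F (x, y) \<Longrightarrow> c \<in> Eq Y y y' \<Longrightarrow> \<Gamma> @ [a, b, c] \<turnstile> r \<triangleright> F (x', y')"
    and "\<And>x y y' a b. x \<in> Car X \<Longrightarrow> y \<in> Car Y \<Longrightarrow> y' \<in> Car Y \<Longrightarrow>
      a \<in> F (x, y) \<Longrightarrow> b \<in> F (x, y') \<Longrightarrow> \<Gamma> @ [a, b] \<turnstile> g \<triangleright> Eq Y y y'"
    and "\<And>x a. x \<in> Car X \<Longrightarrow> a \<in> Eq X x x \<Longrightarrow> \<Gamma> @ [a] \<turnstile> t \<triangleright> (\<Union>y\<in>Car Y. F (x, y))"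
  shows "\<Gamma> \<turnstile> Functional s r g t \<triangleright> functional_realizers X Y F"
  unfolding functional_realizers_def Functional_def
proof (intro has_MkPair)
  show "\<Gamma> \<turnstile> Lam s \<triangleright> le_realizers (Car X \<times> Car Y) F (\<lambda>(x, y). Eq X x x \<^bold>\<and> Eq Y y y)"
    by (rule has_Lam) (auto intro: assms(1))
  show "\<Gamma> \<turnstile> Lam3 r \<triangleright> le_realizers (Car X \<times> Car X \<times> Car Y \<times> Car Y)
     (\<lambda>(x, x', y, y'). Eq X x x' \<^bold>\<and> F (x, y) \<^bold>\<and> Eq Y y y') (\<lambda>(x, x', y, y'). F (x', y'))"
  proof (rule has_Lam3)
    fix i v assume "i \<in> Car X \<times> Car X \<times> Car Y \<times> Car Y"
      "v \<in> (case i of (x, x', y, y') \<Rightarrow> Eq X x x' \<^bold>\<and> F (x, y) \<^bold>\<and> Eq Y y y')"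
    then obtain x x' y y' a b c where *: "i = (x, x', y, y')" "x \<in> Car X" "x' \<in> Car X" "y \<in> Car Y" "y' \<in> Car Y"
      "v = lpair a (lpair b c)" "a \<in> Eq X x x'" "b \<in> F (x, y)" "c \<in> Eq Y y y'" by (auto simp: rconj_def)
    from assms(2)[OF *(2-5,7-9)] * show "\<exists>a b c. v = lpair a (lpair b c) \<and>
      \<Gamma> @ [a, b, c] \<turnstile> r \<triangleright> (case i of (x, x', y, y') \<Rightarrow> F (x', y'))" by auto
  qed
  show "\<Gamma> \<turnstile> Lam2 g \<triangleright> le_realizers (Car X \<times> Car Y \<times> Car Y)
     (\<lambda>(x, y, y'). F (x, y) \<^bold>\<and> F (x, y')) (\<lambda>(x, y, y'). Eq Y y y')"
  proof (rule has_Lam2)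
    fix i v assume "i \<in> Car X \<times> Car Y \<times> Car Y" "v \<in> (case i of (x, y, y') \<Rightarrow> F (x, y) \<^bold>\<and> F (x, y'))"
    then obtain x y y' a b where *: "i = (x, y, y')" "x \<in> Car X" "y \<in> Car Y" "y' \<in> Car Y"
      "v = lpair a b" "a \<in> F (x, y)" "b \<in> F (x, y')" by (auto simp: rconj_def)
    from assms(3)[OF *(2-4,6,7)] * show "\<exists>a b. v = lpair a b \<and>
      \<Gamma> @ [a, b] \<turnstile> g \<triangleright> (case i of (x, y, y') \<Rightarrow> Eq Y y y')" by auto
  qed
  show "\<Gamma> \<turnstile> Lam t \<triangleright> le_realizers (Car X) (\<lambda>x. Eq X x x) (\<lambda>x. \<Union>y\<in>Car Y. F (x, y))"
    by (rule has_Lam) (rule assms(4))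
qed

lemma functionalI:
  assumes "[] \<turnstile> f \<triangleright> functional_realizers X Y F" "F \<in> predicates (Car X \<times> Car Y)"
  shows "F \<in> functional X Y"
  using has_nonempty[OF assms(1)] assms(2) unfolding functional_def by simp

lemma functionalE:
  assumes "F \<in> functional X Y"
  obtains f where "\<And>\<Gamma>. \<Gamma> \<turnstile> f \<triangleright> functional_realizers X Y F"
  using assms has_Const unfolding functional_def by blast

lemma tripos_le_refl: "tripos_le I p p"
  by (rule tripos_leI[where t = "Var 0"]) (simp add: has_Var)

lemma tripos_le_trans: "tripos_le I p q \<Longrightarrow> tripos_le I q r \<Longrightarrow> tripos_le I p r"
proof (elim tripos_leE)
  fix t u assume t: "\<And>\<Gamma>. \<Gamma> \<turnstile> t \<triangleright> le_realizers I p q" and u: "\<And>\<Gamma>. \<Gamma> \<turnstile> u \<triangleright> le_realizers I q r"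
  show ?thesis
    by (rule tripos_leI[where t = "App u (App t (Var 0))"]) (rule has_App[OF u has_App[OF t]]; simp add: has_Var)
qed

text \<open>
  The statement is internal: the realizers of functionality and equivalence are inputs. It serves for
  relations that are given from outside (\<open>functional_transport\<close>) and for the elements of an exponential,
  whose realizers are data (\<open>eff_object_exp\<close>).
\<close>

lemma functional_realizers_transport:
  "tripos_le UNIV
    (\<lambda>(F, G). functional_realizers X Y F \<^bold>\<and> le_realizers (Car X \<times> Car Y) F G \<^bold>\<and> le_realizers (Car X \<times> Car Y) G F)
    (\<lambda>(F, G). functional_realizers X Y G)"
proof (rule tripos_leI3)
  fix i v
  assume "v \<in> (case i of (F, G) \<Rightarrow>
    functional_realizers X Y F \<^bold>\<and> le_realizers (Car X \<times> Car Y) F G \<^bold>\<and> le_realizers (Car X \<times> Car Y) G F)"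
  then obtain F G f a b where i: "i = (F, G)" and v: "v = lpair f (lpair a b)"
    and fab: "f \<in> functional_realizers X Y F" "a \<in> le_realizers (Car X \<times> Car Y) F G"
      "b \<in> le_realizers (Car X \<times> Car Y) G F"
    by (cases i) (auto simp: rconj_def)
  have V: "[f, a, b] @ \<Delta> \<turnstile> Var 0 \<triangleright> functional_realizers X Y F"
    "[f, a, b] @ \<Delta> \<turnstile> Var 1 \<triangleright> le_realizers (Car X \<times> Car Y) F G"
    "[f, a, b] @ \<Delta> \<turnstile> Var 2 \<triangleright> le_realizers (Car X \<times> Car Y) G F" for \<Delta>
    using fab by (simp_all add: has_Var)
  have "[f, a, b] \<turnstile> Functional (Strict (Var 0) (App (Var 2) (Var 3)))
      (App (Var 1) (Respect (Var 0) (Var 3) (App (Var 2) (Var 4)) (Var 5)))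
      (Single (Var 0) (App (Var 2) (Var 3)) (App (Var 2) (Var 4)))
      (LetIn (Total (Var 0) (Var 3)) (App (Var 1) (Var 4)))
    \<triangleright> functional_realizers X Y G"
  proof (rule has_Functional)
    fix x y g assume "x \<in> Car X" "y \<in> Car Y" and g: "g \<in> G (x, y)"
    then show "[f, a, b] @ [g] \<turnstile> Strict (Var 0) (App (Var 2) (Var 3)) \<triangleright> Eq X x x \<^bold>\<and> Eq Y y y"
      by (intro has_Strict[OF V(1) has_App[OF V(3)]]) (simp_all add: has_Var)
  next
    fix x x' y y' c g d assume xy: "x \<in> Car X" "x' \<in> Car X" "y \<in> Car Y" "y' \<in> Car Y"
      and "c \<in> Eq X x x'" "g \<in> G (x, y)" "d \<in> Eq Y y y'"
    then show "[f, a, b] @ [c, g, d] \<turnstile> App (Var 1) (Respect (Var 0) (Var 3) (App (Var 2) (Var 4)) (Var 5)) \<triangleright> G (x', y')"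
      by (intro has_App[OF V(2) has_Respect[where x = x and y = y, OF V(1) _ has_App[OF V(3)]]])
        (simp_all add: has_Var)
  next
    fix x y y' g g' assume "x \<in> Car X" "y \<in> Car Y" "y' \<in> Car Y" and "g \<in> G (x, y)" "g' \<in> G (x, y')"
    then show "[f, a, b] @ [g, g'] \<turnstile> Single (Var 0) (App (Var 2) (Var 3)) (App (Var 2) (Var 4)) \<triangleright> Eq Y y y'"
      by (intro has_Single[where x = x, OF V(1) has_App[OF V(3)] has_App[OF V(3)]]) (simp_all add: has_Var)
  next
    fix x c assume x: "x \<in> Car X" and "c \<in> Eq X x x"
    then have "[f, a, b] @ [c] \<turnstile> Total (Var 0) (Var 3) \<triangleright> (\<Union>y\<in>Car Y. F (x, y))"
      by (intro has_Total[OF V(1)]) (simp_all add: has_Var)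
    then show "[f, a, b] @ [c] \<turnstile> LetIn (Total (Var 0) (Var 3)) (App (Var 1) (Var 4)) \<triangleright> (\<Union>y\<in>Car Y. G (x, y))"
    proof (rule has_Let_UN)
      fix y d assume y: "y \<in> Car Y" "d \<in> F (x, y)"
      have "[f, a, b] @ [c, d] \<turnstile> App (Var 1) (Var 4) \<triangleright> G (x, y)"
        by (rule has_App[OF V(2)]) (simp_all add: has_Var x y)
      then show "([f, a, b] @ [c]) @ [d] \<turnstile> App (Var 1) (Var 4) \<triangleright> (\<Union>y\<in>Car Y. G (x, y))"
        using y by (auto intro: has_UN)
    qed
  qed
  with i v show "\<exists>a b c. v = lpair a (lpair b c) \<and> [a, b, c] \<turnstile> Functional (Strict (Var 0) (App (Var 2) (Var 3)))
      (App (Var 1) (Respect (Var 0) (Var 3) (App (Var 2) (Var 4)) (Var 5)))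
      (Single (Var 0) (App (Var 2) (Var 3)) (App (Var 2) (Var 4)))
      (LetIn (Total (Var 0) (Var 3)) (App (Var 1) (Var 4))) \<triangleright> (case i of (F, G) \<Rightarrow> functional_realizers X Y G)"
    by auto
qed

abbreviation equivalent :: "'i set \<Rightarrow> ('i \<Rightarrow> nat set) \<Rightarrow> ('i \<Rightarrow> nat set) \<Rightarrow> bool" where
  "equivalent I p q \<equiv> tripos_le I p q \<and> tripos_le I q p"

lemma functional_transport:
  assumes F: "F \<in> functional X Y" and FG: "equivalent (Car X \<times> Car Y) F G" and G: "G \<in> predicates (Car X \<times> Car Y)"
  shows "G \<in> functional X Y"
proof -
  obtain t where t: "\<And>\<Gamma>. \<Gamma> \<turnstile> t \<triangleright> le_realizers UNIV
    (\<lambda>(F, G). functional_realizers X Y F \<^bold>\<and> le_realizers (Car X \<times> Car Y) F G \<^bold>\<and> le_realizers (Car X \<times> Car Y) G F)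
    (\<lambda>(F, G). functional_realizers X Y G)"
    by (rule tripos_leE[OF functional_realizers_transport]) blast
  obtain f where f: "\<And>\<Gamma>. \<Gamma> \<turnstile> f \<triangleright> functional_realizers X Y F" by (rule functionalE[OF F]) blast
  obtain a where a: "\<And>\<Gamma>. \<Gamma> \<turnstile> a \<triangleright> le_realizers (Car X \<times> Car Y) F G" by (rule tripos_leE[OF conjunct1[OF FG]]) blast
  obtain b where b: "\<And>\<Gamma>. \<Gamma> \<turnstile> b \<triangleright> le_realizers (Car X \<times> Car Y) G F" by (rule tripos_leE[OF conjunct2[OF FG]]) blast
  have "[] \<turnstile> App t (MkPair f (MkPair a b)) \<triangleright> functional_realizers X Y G"
    using has_App[where i = "(F, G)", OF t] has_MkPair[OF f has_MkPair[OF a b]] by simp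
  then show ?thesis by (rule functionalI[OF _ G])
qed

section \<open>Morphisms as classes of relations\<close>

abbreviation rel_class :: "'a eff \<Rightarrow> 'b eff \<Rightarrow> ('a \<times> 'b \<Rightarrow> nat set) \<Rightarrow> ('a, 'b) mor" where
  "rel_class X Y F \<equiv> fun_equiv X Y `` {F}"

lemma equiv_fun_equiv: "equiv (functional X Y) (fun_equiv X Y)"
  by (rule equivI) (auto simp: refl_on_def sym_def trans_def fun_equiv_def
      intro: tripos_le_refl tripos_le_trans)

lemma rel_class_hom: "F \<in> functional X Y \<Longrightarrow> rel_class X Y F \<in> hom X Y"
  unfolding hom_def by (rule quotientI)

lemma homE:
  assumes "f \<in> hom X Y"
  obtains F where "F \<in> functional X Y" "f = rel_class X Y F"
  using assms unfolding hom_def by (auto elim: quotientE)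

text \<open>
  If one of the relations is functional, so is the other, and otherwise both classes are empty. This gives
  equations between composites without a proof that composites are functional.
\<close>
lemma rel_class_eqI:
  assumes FG: "equivalent (Car X \<times> Car Y) F G"
    and "F \<in> predicates (Car X \<times> Car Y)" "G \<in> predicates (Car X \<times> Car Y)"
  shows "rel_class X Y F = rel_class X Y G"
proof (cases "F \<in> functional X Y")
  case True
  then have "(F, G) \<in> fun_equiv X Y"
    using functional_transport[OF True FG] assms unfolding fun_equiv_def by blast
  then show ?thesis by (rule equiv_class_eq[OF equiv_fun_equiv])
next
  case False
  then have "G \<notin> functional X Y" using functional_transport[of G X Y F] assms by blast
  with False show ?thesis unfolding fun_equiv_def by blast
qed

lemma rel_class_self: "F \<in> functional X Y \<Longrightarrow> F \<in> rel_class X Y F"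
  by (rule equiv_class_self[OF equiv_fun_equiv])

lemma in_rel_classD: "G \<in> rel_class X Y F \<Longrightarrow> G \<in> functional X Y \<and> equivalent (Car X \<times> Car Y) F G"
  unfolding fun_equiv_def by blast

lemma rel_class_eqD: "F \<in> functional X Y \<Longrightarrow> rel_class X Y F = rel_class X Y G \<Longrightarrow> equivalent (Car X \<times> Car Y) F G"
  using rel_class_self in_rel_classD by blast

definition rel_comp :: "'a eff \<Rightarrow> 'b eff \<Rightarrow> 'c eff \<Rightarrow> ('a \<times> 'b \<Rightarrow> nat set) \<Rightarrow> ('b \<times> 'c \<Rightarrow> nat set) \<Rightarrow> 'a \<times> 'c \<Rightarrow> nat set"
  where "rel_comp X Y Z F G = restrict (\<lambda>(x, z). \<Union>y\<in>Car Y. F (x, y) \<^bold>\<and> G (y, z)) (Car X \<times> Car Z)"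

lemma restrict_predicates [simp]: "restrict p I \<in> predicates I"
  unfolding predicates_def by simp

lemma rel_comp_predicates [simp]: "rel_comp X Y Z F G \<in> predicates (Car X \<times> Car Z)"
  unfolding rel_comp_def by simp

lemma rel_comp_apply: "x \<in> Car X \<Longrightarrow> z \<in> Car Z \<Longrightarrow> rel_comp X Y Z F G (x, z) = (\<Union>y\<in>Car Y. F (x, y) \<^bold>\<and> G (y, z))"
  unfolding rel_comp_def by simp

lemma rel_comp_mono:
  assumes "tripos_le (Car X \<times> Car Y) F F'" "tripos_le (Car Y \<times> Car Z) G G'"
  shows "tripos_le (Car X \<times> Car Z) (rel_comp X Y Z F G) (rel_comp X Y Z F' G')"
proof -
  obtain f where f: "\<And>\<Gamma>. \<Gamma> \<turnstile> f \<triangleright> le_realizers (Car X \<times> Car Y) F F'" by (rule tripos_leE[OF assms(1)]) blast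
  obtain g where g: "\<And>\<Gamma>. \<Gamma> \<turnstile> g \<triangleright> le_realizers (Car Y \<times> Car Z) G G'" by (rule tripos_leE[OF assms(2)]) blast
  show ?thesis
  proof (rule tripos_leI2[where t = "MkPair (App f (Var 0)) (App g (Var 1))"])
    fix i v assume "i \<in> Car X \<times> Car Z" "v \<in> rel_comp X Y Z F G i"
    then obtain x y z a b where *: "i = (x, z)" "x \<in> Car X" "z \<in> Car Z" "y \<in> Car Y" "v = lpair a b"
      "a \<in> F (x, y)" "b \<in> G (y, z)" by (auto simp: rel_comp_apply rconj_def)
    have "[a, b] \<turnstile> MkPair (App f (Var 0)) (App g (Var 1)) \<triangleright> F' (x, y) \<^bold>\<and> G' (y, z)"
      by (intro has_MkPair has_App[OF f] has_App[OF g]) (simp_all add: * has_Var)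
    then have "[a, b] \<turnstile> MkPair (App f (Var 0)) (App g (Var 1)) \<triangleright> rel_comp X Y Z F' G' i"
      by (rule has_mono) (use * in \<open>auto simp: rel_comp_apply\<close>)
    with * show "\<exists>a b. v = lpair a b \<and> [a, b] \<turnstile> MkPair (App f (Var 0)) (App g (Var 1)) \<triangleright> rel_comp X Y Z F' G' i"
      by blast
  qed
qed

lemma eff_comp_rel_class:
  assumes F: "F \<in> functional X Y" and G: "G \<in> functional Y Z"
  shows "eff_comp X Y Z (rel_class Y Z G) (rel_class X Y F) = rel_class X Z (rel_comp X Y Z F G)"
proof -
  have "rel_class X Z (rel_comp X Y Z F' G') = rel_class X Z (rel_comp X Y Z F G)"
    if "F' \<in> rel_class X Y F" "G' \<in> rel_class Y Z G" for F' G'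
    by (rule rel_class_eqI) (use in_rel_classD[OF that(1)] in_rel_classD[OF that(2)] in \<open>auto intro: rel_comp_mono\<close>)
  then show ?thesis
    using rel_class_self[OF F] rel_class_self[OF G] unfolding eff_comp_def rel_comp_def[symmetric] by blast
qed

lemma has_Lam_rarrow: "(\<And>a. a \<in> A \<Longrightarrow> \<Gamma> @ [a] \<turnstile> t \<triangleright> B) \<Longrightarrow> \<Gamma> \<turnstile> Lam t \<triangleright> A \<^bold>\<rightarrow> \<J> B"
  using has_Lam[of "{()}" "\<lambda>_. A" \<Gamma> t "\<lambda>_. B"] by (simp add: le_realizers_def)

lemma tripos_le_term:
  assumes "tripos_le I p q"
  obtains f :: "trm \<Rightarrow> trm" where "\<And>\<Gamma> u i. \<Gamma> \<turnstile> u \<triangleright> p i \<Longrightarrow> i \<in> I \<Longrightarrow> \<Gamma> \<turnstile> f u \<triangleright> q i"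
proof -
  obtain t where t: "\<And>\<Gamma>. \<Gamma> \<turnstile> t \<triangleright> le_realizers I p q" by (rule tripos_leE[OF assms]) blast
  show thesis by (rule that[of "App t"]) (rule has_App[OF t])
qed

section \<open>Objects and maps between carriers\<close>

text \<open>Fixed realizers of symmetry and transitivity of an object, as operations on terms.\<close>
definition Sym :: "'a eff \<Rightarrow> trm \<Rightarrow> trm" where
  "Sym X u = App (Const (SOME e. e \<in> le_realizers (Car X \<times> Car X) (\<lambda>(x, x'). Eq X x x') (\<lambda>(x, x'). Eq X x' x))) u"

definition Trans :: "'a eff \<Rightarrow> trm \<Rightarrow> trm \<Rightarrow> trm" where
  "Trans X u v = App (Const (SOME e. e \<in> le_realizers (Car X \<times> Car X \<times> Car X)
     (\<lambda>(x, x', x''). Eq X x x' \<^bold>\<and> Eq X x' x'') (\<lambda>(x, x', x''). Eq X x x''))) (MkPair u v)"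

lemma has_Sym:
  assumes "eff_object X" "\<Gamma> \<turnstile> u \<triangleright> Eq X x y" "x \<in> Car X" "y \<in> Car X"
  shows "\<Gamma> \<turnstile> Sym X u \<triangleright> Eq X y x"
proof -
  have "\<exists>e. e \<in> le_realizers (Car X \<times> Car X) (\<lambda>(x, x'). Eq X x x') (\<lambda>(x, x'). Eq X x' x)"
    using assms(1) unfolding eff_object_def tripos_le_def by blast
  from has_App[where i = "(x, y)" and u = u, OF has_Const[OF someI_ex[OF this]]] show ?thesis
    using assms(2-4) unfolding Sym_def by simp
qed

lemma has_Trans:
  assumes "eff_object X" "\<Gamma> \<turnstile> u \<triangleright> Eq X x y" "\<Gamma> \<turnstile> v \<triangleright> Eq X y z" "x \<in> Car X" "y \<in> Car X" "z \<in> Car X"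
  shows "\<Gamma> \<turnstile> Trans X u v \<triangleright> Eq X x z"
proof -
  have "\<exists>e. e \<in> le_realizers (Car X \<times> Car X \<times> Car X)
     (\<lambda>(x, x', x''). Eq X x x' \<^bold>\<and> Eq X x' x'') (\<lambda>(x, x', x''). Eq X x x'')"
    using assms(1) unfolding eff_object_def tripos_le_def by blast
  from has_App[where i = "(x, y, z)" and u = "MkPair u v", OF has_Const[OF someI_ex[OF this]]] show ?thesis
    using has_MkPair[OF assms(2,3)] assms(4-6) unfolding Trans_def by simp
qed

lemma eff_objectI:
  assumes "\<And>x y a. x \<in> Car X \<Longrightarrow> y \<in> Car X \<Longrightarrow> a \<in> Eq X x y \<Longrightarrow> [a] \<turnstile> s \<triangleright> Eq X y x"
    and "\<And>x y z a b. x \<in> Car X \<Longrightarrow> y \<in> Car X \<Longrightarrow> z \<in> Car X \<Longrightarrow> a \<in> Eq X x y \<Longrightarrow> b \<in> Eq X y z \<Longrightarrow>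
      [a, b] \<turnstile> t \<triangleright> Eq X x z"
  shows "eff_object X"
  unfolding eff_object_def
proof
  show "tripos_le (Car X \<times> Car X) (\<lambda>(x, x'). Eq X x x') (\<lambda>(x, x'). Eq X x' x)"
    by (rule tripos_leI[where t = s]) (auto intro: assms(1))
  show "tripos_le (Car X \<times> Car X \<times> Car X) (\<lambda>(x, x', x''). Eq X x x' \<^bold>\<and> Eq X x' x'') (\<lambda>(x, x', x''). Eq X x x'')"
    by (rule tripos_leI2[where t = t]) (auto simp: rconj_def intro: assms(2))
qed

text \<open>
  A function \<open>k\<close> between carriers that preserves equality uniformly induces a morphism; it is represented
  by the relation ``\<open>x\<close> exists and \<open>k x = z\<close>''.
\<close>
definition graph_rel :: "'a eff \<Rightarrow> 'b eff \<Rightarrow> ('a \<Rightarrow> 'b) \<Rightarrow> 'a \<times> 'b \<Rightarrow> nat set" where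
  "graph_rel X Z k = restrict (\<lambda>(x, z). Eq X x x \<^bold>\<and> Eq Z (k x) z) (Car X \<times> Car Z)"

definition preserves_eq :: "'a eff \<Rightarrow> 'b eff \<Rightarrow> ('a \<Rightarrow> 'b) \<Rightarrow> bool" where
  "preserves_eq X Z k \<longleftrightarrow> k ` Car X \<subseteq> Car Z \<and>
     tripos_le (Car X \<times> Car X) (\<lambda>(x, x'). Eq X x x') (\<lambda>(x, x'). Eq Z (k x) (k x'))"

lemma graph_rel_apply: "x \<in> Car X \<Longrightarrow> z \<in> Car Z \<Longrightarrow> graph_rel X Z k (x, z) = Eq X x x \<^bold>\<and> Eq Z (k x) z"
  by (simp add: graph_rel_def)

lemma graph_rel_predicates [simp]: "graph_rel X Z k \<in> predicates (Car X \<times> Car Z)"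
  by (simp add: graph_rel_def)

lemma preserves_eqE:
  assumes "preserves_eq X Z k"
  obtains r :: "trm \<Rightarrow> trm" where "\<And>x. x \<in> Car X \<Longrightarrow> k x \<in> Car Z"
    "\<And>\<Gamma> u x y. \<Gamma> \<turnstile> u \<triangleright> Eq X x y \<Longrightarrow> x \<in> Car X \<Longrightarrow> y \<in> Car X \<Longrightarrow> \<Gamma> \<turnstile> r u \<triangleright> Eq Z (k x) (k y)"
proof -
  obtain f where f: "\<And>\<Gamma> u i. \<Gamma> \<turnstile> u \<triangleright> (case i of (x, x') \<Rightarrow> Eq X x x') \<Longrightarrow> i \<in> Car X \<times> Car X \<Longrightarrow>
      \<Gamma> \<turnstile> f u \<triangleright> (case i of (x, x') \<Rightarrow> Eq Z (k x) (k x'))"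
    by (rule tripos_le_term[OF conjunct2[OF assms[unfolded preserves_eq_def]]]) blast
  show thesis
    by (rule that[of f]) (use assms f[of _ _ "(_, _)"] in \<open>auto simp: preserves_eq_def\<close>)
qed

lemma graph_rel_functional:
  assumes X: "eff_object X" and Z: "eff_object Z" and k: "preserves_eq X Z k"
  shows "graph_rel X Z k \<in> functional X Z"
proof -
  note sX = has_Sym[OF X] and tX = has_Trans[OF X]
  note sZ = has_Sym[OF Z] and tZ = has_Trans[OF Z]
  obtain r where kZ: "\<And>x. x \<in> Car X \<Longrightarrow> k x \<in> Car Z"
    and r: "\<And>\<Gamma> u x y. \<Gamma> \<turnstile> u \<triangleright> Eq X x y \<Longrightarrow> x \<in> Car X \<Longrightarrow> y \<in> Car X \<Longrightarrow> \<Gamma> \<turnstile> r u \<triangleright> Eq Z (k x) (k y)"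
    by (rule preserves_eqE[OF k]) blast
  have "[] \<turnstile> Functional (MkPair (Fst (Var 0)) (Trans Z (Sym Z (Snd (Var 0))) (Snd (Var 0))))
      (MkPair (Trans X (Sym X (Var 0)) (Var 0)) (Trans Z (Sym Z (r (Var 0))) (Trans Z (Snd (Var 1)) (Var 2))))
      (Trans Z (Sym Z (Snd (Var 0))) (Snd (Var 1)))
      (MkPair (Var 0) (r (Var 0))) \<triangleright> functional_realizers X Z (graph_rel X Z k)"
  proof (rule has_Functional)
    fix x z a assume *: "x \<in> Car X" "z \<in> Car Z" and "a \<in> graph_rel X Z k (x, z)"
    then have V: "[] @ [a] \<turnstile> Var 0 \<triangleright> Eq X x x \<^bold>\<and> Eq Z (k x) z" by (simp add: has_Var graph_rel_apply)
    show "[] @ [a] \<turnstile> MkPair (Fst (Var 0)) (Trans Z (Sym Z (Snd (Var 0))) (Snd (Var 0))) \<triangleright> Eq X x x \<^bold>\<and> Eq Z z z"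
      by (rule has_MkPair[OF has_Fst[OF V] tZ[OF sZ[OF has_Snd[OF V]] has_Snd[OF V]]]) (simp_all add: * kZ)
  next
    fix x x' z z' a b c assume *: "x \<in> Car X" "x' \<in> Car X" "z \<in> Car Z" "z' \<in> Car Z"
      and "a \<in> Eq X x x'" "b \<in> graph_rel X Z k (x, z)" "c \<in> Eq Z z z'"
    then have V: "[] @ [a, b, c] \<turnstile> Var 0 \<triangleright> Eq X x x'" "[] @ [a, b, c] \<turnstile> Var 1 \<triangleright> Eq X x x \<^bold>\<and> Eq Z (k x) z"
      "[] @ [a, b, c] \<turnstile> Var 2 \<triangleright> Eq Z z z'" by (simp_all add: has_Var graph_rel_apply)
    have "[] @ [a, b, c] \<turnstile> MkPair (Trans X (Sym X (Var 0)) (Var 0)) (Trans Z (Sym Z (r (Var 0))) (Trans Z (Snd (Var 1)) (Var 2)))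
        \<triangleright> Eq X x' x' \<^bold>\<and> Eq Z (k x') z'"
      by (rule has_MkPair[OF tX[OF sX[OF V(1)] V(1)] tZ[OF sZ[OF r[OF V(1)]] tZ[OF has_Snd[OF V(2)] V(3)]]])
        (simp_all add: * kZ)
    then show "[] @ [a, b, c] \<turnstile> MkPair (Trans X (Sym X (Var 0)) (Var 0)) (Trans Z (Sym Z (r (Var 0))) (Trans Z (Snd (Var 1)) (Var 2)))
        \<triangleright> graph_rel X Z k (x', z')"
      by (simp add: graph_rel_apply *)
  next
    fix x z z' a b assume *: "x \<in> Car X" "z \<in> Car Z" "z' \<in> Car Z"
      and "a \<in> graph_rel X Z k (x, z)" "b \<in> graph_rel X Z k (x, z')"
    then have V: "[] @ [a, b] \<turnstile> Var 0 \<triangleright> Eq X x x \<^bold>\<and> Eq Z (k x) z"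
      "[] @ [a, b] \<turnstile> Var 1 \<triangleright> Eq X x x \<^bold>\<and> Eq Z (k x) z'" by (simp_all add: has_Var graph_rel_apply)
    show "[] @ [a, b] \<turnstile> Trans Z (Sym Z (Snd (Var 0))) (Snd (Var 1)) \<triangleright> Eq Z z z'"
      by (rule tZ[OF sZ[OF has_Snd[OF V(1)]] has_Snd[OF V(2)]]) (simp_all add: * kZ)
  next
    fix x a assume *: "x \<in> Car X" and "a \<in> Eq X x x"
    then have V: "[] @ [a] \<turnstile> Var 0 \<triangleright> Eq X x x" by (simp add: has_Var)
    have "[] @ [a] \<turnstile> MkPair (Var 0) (r (Var 0)) \<triangleright> Eq X x x \<^bold>\<and> Eq Z (k x) (k x)"
      by (rule has_MkPair[OF V r[OF V]]) (simp_all add: *)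
    then show "[] @ [a] \<turnstile> MkPair (Var 0) (r (Var 0)) \<triangleright> (\<Union>z\<in>Car Z. graph_rel X Z k (x, z))"
      by (rule has_mono) (use * kZ[OF *] in \<open>auto simp: graph_rel_apply\<close>)
  qed
  then show ?thesis by (rule functionalI) simp
qed

text \<open>
  The converse relation is single-valued by injectivity and total by surjectivity, and its two
  composites with the given relation are equality.
\<close>
lemma graph_rel_iso:
  assumes X: "eff_object X" and Z: "eff_object Z" and k: "preserves_eq X Z k"
    and inj: "tripos_le (Car X \<times> Car X) (\<lambda>(x, x'). Eq Z (k x) (k x')) (\<lambda>(x, x'). Eq X x x')"
    and surj: "tripos_le (Car Z) (\<lambda>z. Eq Z z z) (\<lambda>z. \<Union>x\<in>Car X. Eq X x x \<^bold>\<and> Eq Z (k x) z)"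
  shows "eff_iso X Z (rel_class X Z (graph_rel X Z k))"
proof -
  note sX = has_Sym[OF X] and tX = has_Trans[OF X]
  note sZ = has_Sym[OF Z] and tZ = has_Trans[OF Z]
  obtain r where kZ: "\<And>x. x \<in> Car X \<Longrightarrow> k x \<in> Car Z"
    and r: "\<And>\<Gamma> u x y. \<Gamma> \<turnstile> u \<triangleright> Eq X x y \<Longrightarrow> x \<in> Car X \<Longrightarrow> y \<in> Car X \<Longrightarrow> \<Gamma> \<turnstile> r u \<triangleright> Eq Z (k x) (k y)"
    by (rule preserves_eqE[OF k]) blast
  obtain i where i': "\<And>\<Gamma> u i'. \<Gamma> \<turnstile> u \<triangleright> (case i' of (x, x') \<Rightarrow> Eq Z (k x) (k x')) \<Longrightarrow> i' \<in> Car X \<times> Car X \<Longrightarrow>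
      \<Gamma> \<turnstile> i u \<triangleright> (case i' of (x, x') \<Rightarrow> Eq X x x')"
    by (rule tripos_le_term[OF inj]) blast
  have i: "\<Gamma> \<turnstile> i u \<triangleright> Eq X x x'" if "\<Gamma> \<turnstile> u \<triangleright> Eq Z (k x) (k x')" "x \<in> Car X" "x' \<in> Car X" for \<Gamma> u x x'
    using i'[of \<Gamma> u "(x, x')"] that by simp
  obtain e where e: "\<And>\<Gamma> u z. \<Gamma> \<turnstile> u \<triangleright> Eq Z z z \<Longrightarrow> z \<in> Car Z \<Longrightarrow>
      \<Gamma> \<turnstile> e u \<triangleright> (\<Union>x\<in>Car X. Eq X x x \<^bold>\<and> Eq Z (k x) z)"
    by (rule tripos_le_term[OF surj]) blast
  let ?F = "graph_rel X Z k"
  define G where "G = restrict (\<lambda>(z, x). Eq X x x \<^bold>\<and> Eq Z (k x) z) (Car Z \<times> Car X)"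
  have G_apply: "G (z, x) = Eq X x x \<^bold>\<and> Eq Z (k x) z" if "z \<in> Car Z" "x \<in> Car X" for x z
    using that by (simp add: G_def)
  have F: "?F \<in> functional X Z" by (rule graph_rel_functional[OF X Z k])
  have "[] \<turnstile> Functional (MkPair (Trans Z (Sym Z (Snd (Var 0))) (Snd (Var 0))) (Fst (Var 0)))
      (MkPair (Trans X (Sym X (Var 2)) (Var 2)) (Trans Z (Sym Z (r (Var 2))) (Trans Z (Snd (Var 1)) (Var 0))))
      (i (Trans Z (Snd (Var 0)) (Sym Z (Snd (Var 1)))))
      (e (Var 0)) \<triangleright> functional_realizers Z X G"
  proof (rule has_Functional)
    fix x z a assume *: "z \<in> Car Z" "x \<in> Car X" and "a \<in> G (z, x)"
    then have V: "[] @ [a] \<turnstile> Var 0 \<triangleright> Eq X x x \<^bold>\<and> Eq Z (k x) z" by (simp add: has_Var G_apply)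
    show "[] @ [a] \<turnstile> MkPair (Trans Z (Sym Z (Snd (Var 0))) (Snd (Var 0))) (Fst (Var 0)) \<triangleright> Eq Z z z \<^bold>\<and> Eq X x x"
      by (rule has_MkPair[OF tZ[OF sZ[OF has_Snd[OF V]] has_Snd[OF V]] has_Fst[OF V]]) (simp_all add: * kZ)
  next
    fix x x' z z' a b c assume *: "z \<in> Car Z" "z' \<in> Car Z" "x \<in> Car X" "x' \<in> Car X"
      and "a \<in> Eq Z z z'" "b \<in> G (z, x)" "c \<in> Eq X x x'"
    then have V: "[] @ [a, b, c] \<turnstile> Var 2 \<triangleright> Eq X x x'" "[] @ [a, b, c] \<turnstile> Var 1 \<triangleright> Eq X x x \<^bold>\<and> Eq Z (k x) z"
      "[] @ [a, b, c] \<turnstile> Var 0 \<triangleright> Eq Z z z'" by (simp_all add: has_Var G_apply)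
    have "[] @ [a, b, c] \<turnstile> MkPair (Trans X (Sym X (Var 2)) (Var 2)) (Trans Z (Sym Z (r (Var 2))) (Trans Z (Snd (Var 1)) (Var 0)))
        \<triangleright> Eq X x' x' \<^bold>\<and> Eq Z (k x') z'"
      by (rule has_MkPair[OF tX[OF sX[OF V(1)] V(1)] tZ[OF sZ[OF r[OF V(1)]] tZ[OF has_Snd[OF V(2)] V(3)]]])
        (simp_all add: * kZ)
    then show "[] @ [a, b, c] \<turnstile> MkPair (Trans X (Sym X (Var 2)) (Var 2)) (Trans Z (Sym Z (r (Var 2))) (Trans Z (Snd (Var 1)) (Var 0)))
        \<triangleright> G (z', x')"
      by (simp add: G_apply *)
  next
    fix x x' z a b assume *: "z \<in> Car Z" "x \<in> Car X" "x' \<in> Car X"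
      and "a \<in> G (z, x)" "b \<in> G (z, x')"
    then have V: "[] @ [a, b] \<turnstile> Var 0 \<triangleright> Eq X x x \<^bold>\<and> Eq Z (k x) z"
      "[] @ [a, b] \<turnstile> Var 1 \<triangleright> Eq X x' x' \<^bold>\<and> Eq Z (k x') z" by (simp_all add: has_Var G_apply)
    show "[] @ [a, b] \<turnstile> i (Trans Z (Snd (Var 0)) (Sym Z (Snd (Var 1)))) \<triangleright> Eq X x x'"
      by (rule i[OF tZ[OF has_Snd[OF V(1)] sZ[OF has_Snd[OF V(2)]]]]) (simp_all add: * kZ)
  next
    fix z a assume *: "z \<in> Car Z" and "a \<in> Eq Z z z"
    then have "[] @ [a] \<turnstile> e (Var 0) \<triangleright> (\<Union>x\<in>Car X. Eq X x x \<^bold>\<and> Eq Z (k x) z)" by (intro e) (simp_all add: has_Var)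
    then show "[] @ [a] \<turnstile> e (Var 0) \<triangleright> (\<Union>x\<in>Car X. G (z, x))" by (simp add: G_apply *)
  qed
  then have G: "G \<in> functional Z X" by (rule functionalI) (simp add: G_def)
  let ?t = "MkPair (MkPair (Trans X (Var 0) (Sym X (Var 0))) (r (Trans X (Var 0) (Sym X (Var 0)))))
    (MkPair (Trans X (Sym X (Var 0)) (Var 0)) (r (Sym X (Var 0))))"
  have "rel_class X X (rel_comp X Z X ?F G) = eff_id X"
    unfolding eff_id_def
  proof (rule rel_class_eqI)
    show "equivalent (Car X \<times> Car X) (rel_comp X Z X ?F G) (restrict (\<lambda>(x, x'). Eq X x x') (Car X \<times> Car X))"
    proof
      show "tripos_le (Car X \<times> Car X) (rel_comp X Z X ?F G) (restrict (\<lambda>(x, x'). Eq X x x') (Car X \<times> Car X))"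
      proof (rule tripos_leI2[where t = "i (Trans Z (Snd (Var 0)) (Sym Z (Snd (Var 1))))"])
        fix j v assume "j \<in> Car X \<times> Car X" "v \<in> rel_comp X Z X ?F G j"
        then obtain x z x' a b where *: "j = (x, x')" "x \<in> Car X" "x' \<in> Car X" "z \<in> Car Z" "v = lpair a b"
          "a \<in> ?F (x, z)" "b \<in> G (z, x')" by (auto simp: rel_comp_apply rconj_def[of "graph_rel _ _ _ _"])
        then have V: "[a, b] \<turnstile> Var 0 \<triangleright> Eq X x x \<^bold>\<and> Eq Z (k x) z"
          "[a, b] \<turnstile> Var 1 \<triangleright> Eq X x' x' \<^bold>\<and> Eq Z (k x') z" by (simp_all add: has_Var G_apply graph_rel_apply)
        have "[a, b] \<turnstile> i (Trans Z (Snd (Var 0)) (Sym Z (Snd (Var 1)))) \<triangleright> Eq X x x'"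
          by (rule i[OF tZ[OF has_Snd[OF V(1)] sZ[OF has_Snd[OF V(2)]]]]) (simp_all add: * kZ)
        with * show "\<exists>a b. v = lpair a b \<and> [a, b] \<turnstile> i (Trans Z (Snd (Var 0)) (Sym Z (Snd (Var 1))))
            \<triangleright> restrict (\<lambda>(x, x'). Eq X x x') (Car X \<times> Car X) j" by auto
      qed
      show "tripos_le (Car X \<times> Car X) (restrict (\<lambda>(x, x'). Eq X x x') (Car X \<times> Car X)) (rel_comp X Z X ?F G)"
      proof (rule tripos_leI[where t = "?t"])
        fix j a assume "j \<in> Car X \<times> Car X" "a \<in> restrict (\<lambda>(x, x'). Eq X x x') (Car X \<times> Car X) j"
        then obtain x x' where *: "j = (x, x')" "x \<in> Car X" "x' \<in> Car X" "a \<in> Eq X x x'" by auto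
        then have V: "[a] \<turnstile> Var 0 \<triangleright> Eq X x x'" by (simp add: has_Var)
        have 1: "[a] \<turnstile> Trans X (Var 0) (Sym X (Var 0)) \<triangleright> Eq X x x" by (rule tX[OF V sX[OF V]]) (simp_all add: *)
        have 2: "[a] \<turnstile> Trans X (Sym X (Var 0)) (Var 0) \<triangleright> Eq X x' x'" by (rule tX[OF sX[OF V] V]) (simp_all add: *)
        have "[a] \<turnstile> ?t \<triangleright> ?F (x, k x) \<^bold>\<and> G (k x, x')"
          using has_MkPair[OF has_MkPair[OF 1 r[OF 1]] has_MkPair[OF 2 r[OF sX[OF V]]]] *
          by (simp add: graph_rel_apply G_apply kZ)
        then show "[a] \<turnstile> ?t \<triangleright> rel_comp X Z X ?F G j"
          by (rule has_mono) (use * kZ in \<open>auto simp: rel_comp_apply\<close>)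
      qed
    qed
  qed simp_all
  moreover have "rel_class Z Z (rel_comp Z X Z G ?F) = eff_id Z"
    unfolding eff_id_def
  proof (rule rel_class_eqI)
    show "equivalent (Car Z \<times> Car Z) (rel_comp Z X Z G ?F) (restrict (\<lambda>(x, x'). Eq Z x x') (Car Z \<times> Car Z))"
    proof
      show "tripos_le (Car Z \<times> Car Z) (rel_comp Z X Z G ?F) (restrict (\<lambda>(x, x'). Eq Z x x') (Car Z \<times> Car Z))"
      proof (rule tripos_leI2[where t = "Trans Z (Sym Z (Snd (Var 0))) (Snd (Var 1))"])
        fix j v assume "j \<in> Car Z \<times> Car Z" "v \<in> rel_comp Z X Z G ?F j"
        then obtain z x z' a b where *: "j = (z, z')" "z \<in> Car Z" "z' \<in> Car Z" "x \<in> Car X" "v = lpair a b"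
          "a \<in> G (z, x)" "b \<in> ?F (x, z')" by (auto simp: rel_comp_apply rconj_def[of "G _"])
        then have V: "[a, b] \<turnstile> Var 0 \<triangleright> Eq X x x \<^bold>\<and> Eq Z (k x) z"
          "[a, b] \<turnstile> Var 1 \<triangleright> Eq X x x \<^bold>\<and> Eq Z (k x) z'" by (simp_all add: has_Var G_apply graph_rel_apply)
        have "[a, b] \<turnstile> Trans Z (Sym Z (Snd (Var 0))) (Snd (Var 1)) \<triangleright> Eq Z z z'"
          by (rule tZ[OF sZ[OF has_Snd[OF V(1)]] has_Snd[OF V(2)]]) (simp_all add: * kZ)
        with * show "\<exists>a b. v = lpair a b \<and> [a, b] \<turnstile> Trans Z (Sym Z (Snd (Var 0))) (Snd (Var 1))
            \<triangleright> restrict (\<lambda>(x, x'). Eq Z x x') (Car Z \<times> Car Z) j" by auto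
      qed
      show "tripos_le (Car Z \<times> Car Z) (restrict (\<lambda>(x, x'). Eq Z x x') (Car Z \<times> Car Z)) (rel_comp Z X Z G ?F)"
      proof (rule tripos_leI[where t = "LetIn (e (Trans Z (Var 0) (Sym Z (Var 0))))
          (MkPair (Var 1) (MkPair (Fst (Var 1)) (Trans Z (Snd (Var 1)) (Var 0))))"])
        fix j a assume "j \<in> Car Z \<times> Car Z" "a \<in> restrict (\<lambda>(x, x'). Eq Z x x') (Car Z \<times> Car Z) j"
        then obtain z z' where *: "j = (z, z')" "z \<in> Car Z" "z' \<in> Car Z" "a \<in> Eq Z z z'" by auto
        then have V: "[a] \<turnstile> Var 0 \<triangleright> Eq Z z z'" by (simp add: has_Var)
        show "[a] \<turnstile> LetIn (e (Trans Z (Var 0) (Sym Z (Var 0)))) (MkPair (Var 1) (MkPair (Fst (Var 1)) (Trans Z (Snd (Var 1)) (Var 0))))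
          \<triangleright> rel_comp Z X Z G ?F j"
        proof (rule has_Let_UN)
          show "[a] \<turnstile> e (Trans Z (Var 0) (Sym Z (Var 0))) \<triangleright> (\<Union>x\<in>Car X. Eq X x x \<^bold>\<and> Eq Z (k x) z)"
            by (rule e[OF tZ[OF V sZ[OF V]]]) (simp_all add: *)
          fix x b assume x: "x \<in> Car X" "b \<in> Eq X x x \<^bold>\<and> Eq Z (k x) z"
          then have W: "[a] @ [b] \<turnstile> Var 0 \<triangleright> Eq Z z z'" "[a] @ [b] \<turnstile> Var 1 \<triangleright> Eq X x x \<^bold>\<and> Eq Z (k x) z"
            using * by (simp_all add: has_Var)
          have "[a] @ [b] \<turnstile> Trans Z (Snd (Var 1)) (Var 0) \<triangleright> Eq Z (k x) z'"
            by (rule tZ[OF has_Snd[OF W(2)] W(1)]) (simp_all add: * x kZ)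
          from has_MkPair[OF W(2) has_MkPair[OF has_Fst[OF W(2)] this]]
          show "[a] @ [b] \<turnstile> MkPair (Var 1) (MkPair (Fst (Var 1)) (Trans Z (Snd (Var 1)) (Var 0))) \<triangleright> rel_comp Z X Z G ?F j"
            by (rule has_mono) (use * x in \<open>auto simp: rel_comp_apply G_apply graph_rel_apply\<close>)
        qed
      qed
    qed
  qed simp_all
  ultimately show ?thesis
    unfolding eff_iso_def using rel_class_hom[OF F] rel_class_hom[OF G] eff_comp_rel_class[OF F G] eff_comp_rel_class[OF G F]
    by metis
qed

lemma graph_rel_cong:
  assumes Z: "eff_object Z" and kZ: "\<And>x. x \<in> Car X \<Longrightarrow> k x \<in> Car Z" and lZ: "\<And>x. x \<in> Car X \<Longrightarrow> l x \<in> Car Z"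
    and kl: "tripos_le (Car X) (\<lambda>x. Eq X x x) (\<lambda>x. Eq Z (k x) (l x))"
  shows "rel_class X Z (graph_rel X Z k) = rel_class X Z (graph_rel X Z l)"
proof -
  note sZ = has_Sym[OF Z] and tZ = has_Trans[OF Z]
  have le: "tripos_le (Car X \<times> Car Z) (graph_rel X Z k) (graph_rel X Z l)"
    if kZ: "\<And>x. x \<in> Car X \<Longrightarrow> k x \<in> Car Z" and lZ: "\<And>x. x \<in> Car X \<Longrightarrow> l x \<in> Car Z"
    and r: "\<And>\<Gamma> u x. \<Gamma> \<turnstile> u \<triangleright> Eq X x x \<Longrightarrow> x \<in> Car X \<Longrightarrow> \<Gamma> \<turnstile> r u \<triangleright> Eq Z (l x) (k x)" for k l r
  proof (rule tripos_leI[where t = "MkPair (Fst (Var 0)) (Trans Z (r (Fst (Var 0))) (Snd (Var 0)))"])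
    fix j a assume "j \<in> Car X \<times> Car Z" "a \<in> graph_rel X Z k j"
    then obtain x z where *: "j = (x, z)" "x \<in> Car X" "z \<in> Car Z" "a \<in> Eq X x x \<^bold>\<and> Eq Z (k x) z"
      by (auto simp: graph_rel_apply)
    then have V: "[a] \<turnstile> Var 0 \<triangleright> Eq X x x \<^bold>\<and> Eq Z (k x) z" by (simp add: has_Var)
    have "[a] \<turnstile> MkPair (Fst (Var 0)) (Trans Z (r (Fst (Var 0))) (Snd (Var 0))) \<triangleright> Eq X x x \<^bold>\<and> Eq Z (l x) z"
      by (rule has_MkPair[OF has_Fst[OF V] tZ[OF r[OF has_Fst[OF V]] has_Snd[OF V]]]) (simp_all add: * kZ lZ)
    then show "[a] \<turnstile> MkPair (Fst (Var 0)) (Trans Z (r (Fst (Var 0))) (Snd (Var 0))) \<triangleright> graph_rel X Z l j"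
      using * by (simp add: graph_rel_apply)
  qed
  obtain r where r: "\<And>\<Gamma> u x. \<Gamma> \<turnstile> u \<triangleright> Eq X x x \<Longrightarrow> x \<in> Car X \<Longrightarrow> \<Gamma> \<turnstile> r u \<triangleright> Eq Z (k x) (l x)"
    by (rule tripos_le_term[OF kl]) blast
  show ?thesis
  proof (rule rel_class_eqI)
    show "equivalent (Car X \<times> Car Z) (graph_rel X Z k) (graph_rel X Z l)"
    proof
      show "tripos_le (Car X \<times> Car Z) (graph_rel X Z l) (graph_rel X Z k)" by (rule le[OF lZ kZ r])
      show "tripos_le (Car X \<times> Car Z) (graph_rel X Z k) (graph_rel X Z l)"
        by (rule le[OF kZ lZ, where r = "\<lambda>u. Sym Z (r u)"]) (auto intro!: sZ r kZ lZ)
    qed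
  qed simp_all
qed

section \<open>Exponentials\<close>

lemma eff_exp_simps [simp]: "Car (eff_exp Y X) = predicates (Car X \<times> Car Y)"
  "Eq (eff_exp Y X) F G = functional_realizers X Y F \<^bold>\<and>
     le_realizers (Car X \<times> Car Y) F G \<^bold>\<and> le_realizers (Car X \<times> Car Y) G F"
  by (simp_all add: eff_exp_def)

lemma has_Lam_comp:
  assumes "\<And>a. \<Gamma> @ [a] \<turnstile> g \<triangleright> le_realizers I q r" "\<And>a. \<Gamma> @ [a] \<turnstile> f \<triangleright> le_realizers I p q"
  shows "\<Gamma> \<turnstile> Lam (App g (App f (Var (length \<Gamma>)))) \<triangleright> le_realizers I p r"
  by (rule has_Lam, rule has_App[OF assms(1) has_App[OF assms(2)]]) (simp_all add: has_Var)

lemma eff_object_exp: "eff_object (eff_exp Y X)"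
proof -
  let ?le = "le_realizers (Car X \<times> Car Y)"
  obtain f where f': "\<And>\<Gamma> u i. \<Gamma> \<turnstile> u \<triangleright> (case i of (F, G) \<Rightarrow> functional_realizers X Y F \<^bold>\<and>
      ?le F G \<^bold>\<and> ?le G F) \<Longrightarrow> i \<in> UNIV \<Longrightarrow> \<Gamma> \<turnstile> f u \<triangleright> (case i of (F, G) \<Rightarrow> functional_realizers X Y G)"
    by (rule tripos_le_term[OF functional_realizers_transport[of X Y]]) blast
  have f: "\<Gamma> \<turnstile> f u \<triangleright> functional_realizers X Y G"
    if "\<Gamma> \<turnstile> u \<triangleright> functional_realizers X Y F \<^bold>\<and> ?le F G \<^bold>\<and> ?le G F" for \<Gamma> u F G
    using f'[of \<Gamma> u "(F, G)"] that by simp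
  show ?thesis
  proof (rule eff_objectI)
    fix F G a assume "a \<in> Eq (eff_exp Y X) F G"
    then have V: "[a] \<turnstile> Var 0 \<triangleright> functional_realizers X Y F \<^bold>\<and> ?le F G \<^bold>\<and> ?le G F" by (simp add: has_Var)
    show "[a] \<turnstile> MkPair (f (Var 0)) (MkPair (Snd (Snd (Var 0))) (Fst (Snd (Var 0)))) \<triangleright> Eq (eff_exp Y X) G F"
      using has_MkPair[OF f[OF V] has_MkPair[OF has_Snd[OF has_Snd[OF V]] has_Fst[OF has_Snd[OF V]]]] by simp
  next
    fix F G H a b assume ab: "a \<in> Eq (eff_exp Y X) F G" "b \<in> Eq (eff_exp Y X) G H"
    have V: "[a, b] @ \<Delta> \<turnstile> Var 0 \<triangleright> functional_realizers X Y F \<^bold>\<and> ?le F G \<^bold>\<and> ?le G F"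
      "[a, b] @ \<Delta> \<turnstile> Var 1 \<triangleright> functional_realizers X Y G \<^bold>\<and> ?le G H \<^bold>\<and> ?le H G" for \<Delta>
      using ab by (simp_all add: has_Var)
    have "[a, b] \<turnstile> Lam (App (Fst (Snd (Var 1))) (App (Fst (Snd (Var 0))) (Var (length [a, b])))) \<triangleright> ?le F H"
      by (rule has_Lam_comp[where q = G]) (rule has_Fst[OF has_Snd[OF V(2)]], rule has_Fst[OF has_Snd[OF V(1)]])
    moreover have "[a, b] \<turnstile> Lam (App (Snd (Snd (Var 0))) (App (Snd (Snd (Var 1))) (Var (length [a, b])))) \<triangleright> ?le H F"
      by (rule has_Lam_comp[where q = G]) (rule has_Snd[OF has_Snd[OF V(1)]], rule has_Snd[OF has_Snd[OF V(2)]])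
    moreover have "[a, b] \<turnstile> Fst (Var 0) \<triangleright> functional_realizers X Y F" using has_Fst[OF V(1)[of "[]"]] by simp
    ultimately show "[a, b] \<turnstile> MkPair (Fst (Var 0)) (MkPair (Lam (App (Fst (Snd (Var 1))) (App (Fst (Snd (Var 0))) (Var 2))))
        (Lam (App (Snd (Snd (Var 0))) (App (Snd (Snd (Var 1))) (Var 2))))) \<triangleright> Eq (eff_exp Y X) F H"
      by (simp add: numeral_2_eq_2 has_MkPair)
  qed
qed

section \<open>Modest objects\<close>

text \<open>
  A realizer of the existence of an element determines this element, and does so effectively: from a
  number that realizes the existence of \<open>x\<close> and of \<open>x'\<close> one computes a realizer of \<open>x = x'\<close>.
\<close>
definition modest :: "'a eff \<Rightarrow> bool" where
  "modest X \<longleftrightarrow> tripos_le (Car X \<times> Car X) (\<lambda>(x, x'). Eq X x x \<inter> Eq X x' x') (\<lambda>(x, x'). Eq X x x')"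

lemma modestE:
  assumes "modest X"
  obtains m :: "trm \<Rightarrow> trm" where "\<And>\<Gamma> u x y. \<Gamma> \<turnstile> u \<triangleright> Eq X x x \<Longrightarrow> \<Gamma> \<turnstile> u \<triangleright> Eq X y y \<Longrightarrow> x \<in> Car X \<Longrightarrow> y \<in> Car X \<Longrightarrow>
    \<Gamma> \<turnstile> m u \<triangleright> Eq X x y"
proof -
  obtain f where f: "\<And>\<Gamma> u i. \<Gamma> \<turnstile> u \<triangleright> (case i of (x, x') \<Rightarrow> Eq X x x \<inter> Eq X x' x') \<Longrightarrow> i \<in> Car X \<times> Car X \<Longrightarrow>
      \<Gamma> \<turnstile> f u \<triangleright> (case i of (x, x') \<Rightarrow> Eq X x x')"
    by (rule tripos_le_term[OF assms[unfolded modest_def]]) blast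
  show thesis
  proof (rule that[of f])
    fix \<Gamma> u x y assume "\<Gamma> \<turnstile> u \<triangleright> Eq X x x" "\<Gamma> \<turnstile> u \<triangleright> Eq X y y" "x \<in> Car X" "y \<in> Car X"
    then show "\<Gamma> \<turnstile> f u \<triangleright> Eq X x y" using f[of \<Gamma> u "(x, y)"] by (simp add: has_Int)
  qed
qed

lemma has_Let_Int_UN:
  assumes "\<Gamma> \<turnstile> t \<triangleright> (\<Union>y\<in>Y. A y)" "\<Gamma> \<turnstile> t \<triangleright> (\<Union>z\<in>Z. B z)"
    and "\<And>y z a. y \<in> Y \<Longrightarrow> z \<in> Z \<Longrightarrow> a \<in> A y \<Longrightarrow> a \<in> B z \<Longrightarrow> \<Gamma> @ [a] \<turnstile> u \<triangleright> C"
  shows "\<Gamma> \<turnstile> LetIn t u \<triangleright> C"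
  by (rule has_Let[OF has_Int[OF assms(1,2)]]) (use assms(3) in blast)

lemma modest_assembly:
  assumes "\<And>x y e. x \<in> X \<Longrightarrow> y \<in> X \<Longrightarrow> e \<in> E x \<Longrightarrow> e \<in> E y \<Longrightarrow> x = y"
  shows "modest (assembly X E)"
  unfolding modest_def
proof (rule tripos_leI[where t = "Var 0"])
  fix i e assume "i \<in> Car (assembly X E) \<times> Car (assembly X E)"
    "e \<in> (case i of (x, x') \<Rightarrow> Eq (assembly X E) x x \<inter> Eq (assembly X E) x' x')"
  then obtain x y where "i = (x, y)" "x \<in> X" "y \<in> X" "e \<in> E x" "e \<in> E y"
    by (cases i) (auto simp: assembly_def)
  with assms[of x y e] show "[e] \<turnstile> Var 0 \<triangleright> (case i of (x, x') \<Rightarrow> Eq (assembly X E) x x')"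
    by (simp add: has_Var assembly_def)
qed

lemma eff_object_assembly: "eff_object (assembly X E)"
  by (rule eff_objectI[where s = "Var 0" and t = "Var 0"]) (auto simp: assembly_def has_Var split: if_splits)

lemma modest_N: "modest eff_N"
  unfolding eff_N_def by (rule modest_assembly) simp

text \<open>The value of the index at \<open>n\<close> lies in \<open>\<J> ({f n} \<inter> {g n})\<close>, which is empty if \<open>f n\<close> and \<open>g n\<close> differ.\<close>
lemma represents_unique:
  assumes "represents e f" "represents e g"
  shows "f = g"
proof
  fix n
  obtain m where "m \<in> \<J> {f n}" "m \<in> \<J> {g n}" using assms unfolding represents_def by (metis option.inject)
  from J_Int[OF this] show "f n = g n" using J_empty by (cases "f n = g n") auto
qed

lemma modest_ns_model: "modest (ns_model a)"
  unfolding ns_model_def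
proof (rule modest_assembly)
  fix c d e
  assume c: "c \<in> {f. arithmetical f} // ns_equiv a" and d: "d \<in> {f. arithmetical f} // ns_equiv a"
    and "e \<in> {e. \<exists>f\<in>c. represents e (\<lambda>n. f (\<psi> a n))}" "e \<in> {e. \<exists>f\<in>d. represents e (\<lambda>n. f (\<psi> a n))}"
  then obtain f g where f: "f \<in> c" "represents e (\<lambda>n. f (\<psi> a n))" and g: "g \<in> d" "represents e (\<lambda>n. g (\<psi> a n))"
    by blast
  have eq: "equiv {f. arithmetical f} (ns_equiv a)"
    by (rule equivI) (auto simp: refl_on_def sym_def trans_def ns_equiv_def elim: eventually_elim2 eventually_mono)
  have "arithmetical f" "arithmetical g" using c d f g in_quotient_imp_subset[OF eq] by blast+
  moreover have "(\<lambda>n. f (\<psi> a n)) = (\<lambda>n. g (\<psi> a n))" by (rule represents_unique[OF f(2) g(2)])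
  ultimately have "(f, g) \<in> ns_equiv a" unfolding ns_equiv_def by (auto simp: fun_eq_iff)
  then show "c = d" using quotient_eqI[OF eq c d f(1) g(1)] by blast
qed

text \<open>
  Let \<open>f\<close> realize that \<open>F\<close> and that \<open>G\<close> is functional. At the same \<open>x\<close> the totality component of \<open>f\<close>
  computes an element of \<open>F (x, y\<^sub>1) \<inter> G (x, y\<^sub>2)\<close>, which strictness turns into a common realizer of
  \<open>y\<^sub>1\<close> and \<open>y\<^sub>2\<close>. So \<open>y\<^sub>1 = y\<^sub>2\<close>, and \<open>F\<close> and \<open>G\<close> agree at \<open>x\<close>.
\<close>
lemma modest_exp:
  assumes Y: "eff_object Y" and mod: "modest Y"
  shows "modest (eff_exp Y X)"
proof -
  obtain m where m: "\<And>\<Gamma> u x y. \<Gamma> \<turnstile> u \<triangleright> Eq Y x x \<Longrightarrow> \<Gamma> \<turnstile> u \<triangleright> Eq Y y y \<Longrightarrow> x \<in> Car Y \<Longrightarrow> y \<in> Car Y \<Longrightarrow>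
    \<Gamma> \<turnstile> m u \<triangleright> Eq Y x y"
    by (rule modestE[OF mod]) blast
  note sY = has_Sym[OF Y] and tY = has_Trans[OF Y]
  let ?le = "le_realizers (Car X \<times> Car Y)"
  let ?t = "LetIn (Total (Var 0) (Fst (Strict (Var 0) (Var 3))))
    (Respect (Var 0) (Fst (Strict (Var 0) (Var 3))) (Var 4) (Trans Y (Sym Y (m (Snd (Strict (Var 0) (Var 4))))) (Single (Var 0) (Var 4) (Var 3))))"
  have t: "[f, a, b] \<turnstile> Lam ?t \<triangleright> ?le F G"
    if f: "f \<in> functional_realizers X Y F" "f \<in> functional_realizers X Y G" for f a b F G
  proof (rule has_Lam)
    fix i c assume "i \<in> Car X \<times> Car Y" "c \<in> F i"
    then obtain x y where i: "i = (x, y)" "x \<in> Car X" "y \<in> Car Y" "c \<in> F (x, y)" by (cases i) auto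
    have V: "([f, a, b] @ [c]) @ \<Delta> \<turnstile> Var 0 \<triangleright> functional_realizers X Y F"
      "([f, a, b] @ [c]) @ \<Delta> \<turnstile> Var 0 \<triangleright> functional_realizers X Y G"
      "([f, a, b] @ [c]) @ \<Delta> \<turnstile> Var 3 \<triangleright> F (x, y)" for \<Delta>
      using f i by (simp_all add: has_Var)
    have x: "([f, a, b] @ [c]) @ \<Delta> \<turnstile> Fst (Strict (Var 0) (Var 3)) \<triangleright> Eq X x x" for \<Delta>
      by (rule has_Fst[OF has_Strict[OF V(1,3) i(2,3)]])
    have "[f, a, b] @ [c] \<turnstile> ?t \<triangleright> G (x, y)"
    proof (rule has_Let_Int_UN)
      show "[f, a, b] @ [c] \<turnstile> Total (Var 0) (Fst (Strict (Var 0) (Var 3))) \<triangleright> (\<Union>y\<in>Car Y. F (x, y))"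
        using has_Total[OF V(1) x i(2), of "[]"] by simp
      show "[f, a, b] @ [c] \<turnstile> Total (Var 0) (Fst (Strict (Var 0) (Var 3))) \<triangleright> (\<Union>y\<in>Car Y. G (x, y))"
        using has_Total[OF V(2) x i(2), of "[]"] by simp
    next
      fix y1 y2 d assume y: "y1 \<in> Car Y" "y2 \<in> Car Y" and d: "d \<in> F (x, y1)" "d \<in> G (x, y2)"
      have W: "([f, a, b] @ [c]) @ [d] \<turnstile> Var 4 \<triangleright> F (x, y1)" "([f, a, b] @ [c]) @ [d] \<turnstile> Var 4 \<triangleright> G (x, y2)"
        using d by (simp_all add: has_Var)
      have "([f, a, b] @ [c]) @ [d] \<turnstile> m (Snd (Strict (Var 0) (Var 4))) \<triangleright> Eq Y y1 y2"
        by (rule m[OF has_Snd[OF has_Strict[OF V(1) W(1)]] has_Snd[OF has_Strict[OF V(2) W(2)]]]) (use i y in simp_all)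
      from tY[OF sY[OF this] has_Single[OF V(1) W(1) V(3)]]
      have "([f, a, b] @ [c]) @ [d] \<turnstile> Trans Y (Sym Y (m (Snd (Strict (Var 0) (Var 4))))) (Single (Var 0) (Var 4) (Var 3)) \<triangleright> Eq Y y2 y"
        using i y by blast
      from has_Respect[OF V(2) x W(2) this] show "([f, a, b] @ [c]) @ [d] \<turnstile>
          Respect (Var 0) (Fst (Strict (Var 0) (Var 3))) (Var 4) (Trans Y (Sym Y (m (Snd (Strict (Var 0) (Var 4))))) (Single (Var 0) (Var 4) (Var 3)))
          \<triangleright> G (x, y)"
        using i y by blast
    qed
    with i show "[f, a, b] @ [c] \<turnstile> ?t \<triangleright> G i" by simp
  qed
  show ?thesis
    unfolding modest_def
  proof (rule tripos_leI3[where t = "MkPair (Var 0) (MkPair (Lam ?t) (Lam ?t))"])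
    fix i v assume "v \<in> (case i of (F, G) \<Rightarrow> Eq (eff_exp Y X) F F \<inter> Eq (eff_exp Y X) G G)"
    then obtain F G f a b where i: "i = (F, G)" and v: "v = lpair f (lpair a b)"
      and f: "f \<in> functional_realizers X Y F" "f \<in> functional_realizers X Y G"
      by (cases i) (auto simp: rconj_def)
    have "[f, a, b] \<turnstile> Var 0 \<triangleright> functional_realizers X Y F" using f by (simp add: has_Var)
    from has_MkPair[OF this has_MkPair[OF t[OF f] t[OF f(2,1)]]] i v
    show "\<exists>a b c. v = lpair a (lpair b c) \<and> [a, b, c] \<turnstile> MkPair (Var 0) (MkPair (Lam ?t) (Lam ?t)) \<triangleright>
      (case i of (F, G) \<Rightarrow> Eq (eff_exp Y X) F G)" by auto
  qed
qed

section \<open>Subquotients\<close>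

text \<open>
  A common realizer of \<open>s\<close> and \<open>s'\<close> is mapped by totality of \<open>M\<close> to one number in
  \<open>M (s, n) \<inter> M (s', n')\<close>; modesty of \<open>Y\<close> gives \<open>n = n'\<close>, and injectivity gives \<open>s = s'\<close>.
\<close>
lemma modest_subobject:
  assumes Y: "modest Y" and M: "M \<in> functional S Y"
    and inj: "tripos_le (Car S \<times> Car S \<times> Car Y) (\<lambda>(s, s', n). M (s, n) \<^bold>\<and> M (s', n)) (\<lambda>(s, s', n). Eq S s s')"
    and S: "eff_object S"
  shows "modest S"
proof -
  obtain m where m: "\<And>\<Gamma> u x y. \<Gamma> \<turnstile> u \<triangleright> Eq Y x x \<Longrightarrow> \<Gamma> \<turnstile> u \<triangleright> Eq Y y y \<Longrightarrow> x \<in> Car Y \<Longrightarrow> y \<in> Car Y \<Longrightarrow>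
    \<Gamma> \<turnstile> m u \<triangleright> Eq Y x y"
    by (rule modestE[OF Y]) blast
  obtain f where f: "\<And>\<Gamma>. \<Gamma> \<turnstile> f \<triangleright> functional_realizers S Y M" by (rule functionalE[OF M]) blast
  obtain i where i': "\<And>\<Gamma> u j. \<Gamma> \<turnstile> u \<triangleright> (case j of (s, s', n) \<Rightarrow> M (s, n) \<^bold>\<and> M (s', n)) \<Longrightarrow>
      j \<in> Car S \<times> Car S \<times> Car Y \<Longrightarrow> \<Gamma> \<turnstile> i u \<triangleright> (case j of (s, s', n) \<Rightarrow> Eq S s s')"
    by (rule tripos_le_term[OF inj]) blast
  have i: "\<Gamma> \<turnstile> i (MkPair u v) \<triangleright> Eq S s s'"
    if "\<Gamma> \<turnstile> u \<triangleright> M (s, n)" "\<Gamma> \<turnstile> v \<triangleright> M (s', n)" "s \<in> Car S" "s' \<in> Car S" "n \<in> Car Y" for \<Gamma> u v s s' n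
    using i'[of \<Gamma> "MkPair u v" "(s, s', n)"] that by (simp add: has_MkPair)
  let ?e = "Respect f (Fst (Strict f (Var 1))) (Var 1) (m (Snd (Strict f (Var 1))))"
  show ?thesis
    unfolding modest_def
  proof (rule tripos_leI[where t = "LetIn (Total f (Var 0)) (i (MkPair ?e (Var 1)))"])
    fix j a assume "j \<in> Car S \<times> Car S" "a \<in> (case j of (s, s') \<Rightarrow> Eq S s s \<inter> Eq S s' s')"
    then obtain s s' where j: "j = (s, s')" and s: "s \<in> Car S" "s' \<in> Car S" "a \<in> Eq S s s" "a \<in> Eq S s' s'"
      by (cases j) auto
    have V: "[a] \<turnstile> Var 0 \<triangleright> Eq S s s" "[a] \<turnstile> Var 0 \<triangleright> Eq S s' s'" using s by (simp_all add: has_Var)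
    have "[a] \<turnstile> LetIn (Total f (Var 0)) (i (MkPair ?e (Var 1))) \<triangleright> Eq S s s'"
    proof (rule has_Let_Int_UN[OF has_Total[OF f V(1) s(1)] has_Total[OF f V(2) s(2)]])
      fix n n' b assume n: "n \<in> Car Y" "n' \<in> Car Y" and b: "b \<in> M (s, n)" "b \<in> M (s', n')"
      have W: "[a] @ [b] \<turnstile> Var 1 \<triangleright> M (s, n)" "[a] @ [b] \<turnstile> Var 1 \<triangleright> M (s', n')" using b by (simp_all add: has_Var)
      note S1 = has_Strict[OF f W(1) s(1) n(1)] and S2 = has_Strict[OF f W(2) s(2) n(2)]
      have "[a] @ [b] \<turnstile> ?e \<triangleright> M (s, n')"
        by (rule has_Respect[OF f has_Fst[OF S1] W(1) m[OF has_Snd[OF S1] has_Snd[OF S2]]]) (use s n in simp_all)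
      from i[OF this W(2)] show "[a] @ [b] \<turnstile> i (MkPair ?e (Var 1)) \<triangleright> Eq S s s'" using s n by blast
    qed
    with j show "[a] \<turnstile> LetIn (Total f (Var 0)) (i (MkPair ?e (Var 1))) \<triangleright> (case j of (s, s') \<Rightarrow> Eq S s s')" by simp
  qed
qed

text \<open>
  A common realizer of \<open>x\<close> and \<open>x'\<close> yields by surjectivity one number in \<open>Q (s, x) \<inter> Q (s', x')\<close>;
  modesty of \<open>S\<close> gives \<open>s = s'\<close>, and \<open>Q\<close> is single-valued.
\<close>
lemma modest_quotient:
  assumes S: "modest S" and Q: "Q \<in> functional S X"
    and surj: "tripos_le (Car X) (\<lambda>x. Eq X x x) (\<lambda>x. \<Union>s\<in>Car S. Q (s, x))"
  shows "modest X"
proof -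
  obtain m where m: "\<And>\<Gamma> u x y. \<Gamma> \<turnstile> u \<triangleright> Eq S x x \<Longrightarrow> \<Gamma> \<turnstile> u \<triangleright> Eq S y y \<Longrightarrow> x \<in> Car S \<Longrightarrow> y \<in> Car S \<Longrightarrow>
    \<Gamma> \<turnstile> m u \<triangleright> Eq S x y"
    by (rule modestE[OF S]) blast
  obtain f where f: "\<And>\<Gamma>. \<Gamma> \<turnstile> f \<triangleright> functional_realizers S X Q" by (rule functionalE[OF Q]) blast
  obtain e where e: "\<And>\<Gamma> u x. \<Gamma> \<turnstile> u \<triangleright> Eq X x x \<Longrightarrow> x \<in> Car X \<Longrightarrow> \<Gamma> \<turnstile> e u \<triangleright> (\<Union>s\<in>Car S. Q (s, x))"
    by (rule tripos_le_term[OF surj]) blast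
  let ?r = "Respect f (m (Fst (Strict f (Var 1)))) (Var 1) (Var 0)"
  show ?thesis
    unfolding modest_def
  proof (rule tripos_leI[where t = "LetIn (e (Var 0)) (Single f ?r (Var 1))"])
    fix j a assume "j \<in> Car X \<times> Car X" "a \<in> (case j of (s, s') \<Rightarrow> Eq X s s \<inter> Eq X s' s')"
    then obtain x x' where j: "j = (x, x')" and x: "x \<in> Car X" "x' \<in> Car X" "a \<in> Eq X x x" "a \<in> Eq X x' x'"
      by (cases j) auto
    have V: "[a] \<turnstile> Var 0 \<triangleright> Eq X x x" "[a] \<turnstile> Var 0 \<triangleright> Eq X x' x'" using x by (simp_all add: has_Var)
    have "[a] \<turnstile> LetIn (e (Var 0)) (Single f ?r (Var 1)) \<triangleright> Eq X x x'"
    proof (rule has_Let_Int_UN[OF e[OF V(1) x(1)] e[OF V(2) x(2)]])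
      fix s s' b assume s: "s \<in> Car S" "s' \<in> Car S" and b: "b \<in> Q (s, x)" "b \<in> Q (s', x')"
      have W: "[a] @ [b] \<turnstile> Var 1 \<triangleright> Q (s, x)" "[a] @ [b] \<turnstile> Var 1 \<triangleright> Q (s', x')" "[a] @ [b] \<turnstile> Var 0 \<triangleright> Eq X x x"
        using b x by (simp_all add: has_Var)
      note S1 = has_Strict[OF f W(1) s(1) x(1)] and S2 = has_Strict[OF f W(2) s(2) x(2)]
      have "[a] @ [b] \<turnstile> ?r \<triangleright> Q (s', x)"
        by (rule has_Respect[OF f m[OF has_Fst[OF S1] has_Fst[OF S2]] W(1,3)]) (use s x in simp_all)
      from has_Single[OF f this W(2)] show "[a] @ [b] \<turnstile> Single f ?r (Var 1) \<triangleright> Eq X x x'" using s x by blast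
    qed
    with j show "[a] \<turnstile> LetIn (e (Var 0)) (Single f ?r (Var 1)) \<triangleright> (case j of (s, s') \<Rightarrow> Eq X s s')" by simp
  qed
qed

definition kernel_pair :: "'a eff \<Rightarrow> 'b eff \<Rightarrow> ('a \<times> 'b \<Rightarrow> nat set) \<Rightarrow> ('a \<times> 'a) eff" where
  "kernel_pair S Y M = \<lparr>Car = Car S \<times> Car S,
     Eq = (\<lambda>(s, s') (t, t'). Eq S s t \<^bold>\<and> Eq S s' t' \<^bold>\<and> (\<Union>n\<in>Car Y. M (s, n) \<^bold>\<and> M (s', n)))\<rparr>"

lemma kernel_pair_simps [simp]: "Car (kernel_pair S Y M) = Car S \<times> Car S"
  "Eq (kernel_pair S Y M) (s, s') (t, t') = Eq S s t \<^bold>\<and> Eq S s' t' \<^bold>\<and> (\<Union>n\<in>Car Y. M (s, n) \<^bold>\<and> M (s', n))"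
  by (simp_all add: kernel_pair_def)

lemma eff_object_kernel_pair:
  assumes S: "eff_object S" and M: "M \<in> functional S Y"
  shows "eff_object (kernel_pair S Y M)"
proof -
  note sS = has_Sym[OF S] and tS = has_Trans[OF S]
  obtain m where m: "\<And>\<Gamma>. \<Gamma> \<turnstile> m \<triangleright> functional_realizers S Y M" by (rule functionalE[OF M]) blast
  let ?K = "\<lambda>s s'. \<Union>n\<in>Car Y. M (s, n) \<^bold>\<and> M (s', n)"
  let ?n = "Snd (Strict m (Fst (Var 1)))"
  let ?s = "LetIn (Snd (Snd (Var 0))) (MkPair (Sym S (Fst (Var 0))) (MkPair (Sym S (Fst (Snd (Var 0))))
      (MkPair (Respect m (Fst (Var 0)) (Fst (Var 1)) ?n) (Respect m (Fst (Snd (Var 0))) (Snd (Var 1)) ?n))))"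
  show ?thesis
  proof (rule eff_objectI)
    fix p q a assume "p \<in> Car (kernel_pair S Y M)" "q \<in> Car (kernel_pair S Y M)" "a \<in> Eq (kernel_pair S Y M) p q"
    then obtain s s' t t' where pq: "p = (s, s')" "q = (t, t')"
      and st: "s \<in> Car S" "s' \<in> Car S" "t \<in> Car S" "t' \<in> Car S"
      and a: "a \<in> Eq S s t \<^bold>\<and> Eq S s' t' \<^bold>\<and> ?K s s'" by (cases p; cases q) auto
    have V: "[a] @ \<Delta> \<turnstile> Var 0 \<triangleright> Eq S s t \<^bold>\<and> Eq S s' t' \<^bold>\<and> ?K s s'" for \<Delta> using a by (simp add: has_Var)
    have "[a] \<turnstile> ?s \<triangleright> Eq S t s \<^bold>\<and> Eq S t' s' \<^bold>\<and> ?K t t'"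
    proof (rule has_Let_UN)
      show "[a] \<turnstile> Snd (Snd (Var 0)) \<triangleright> ?K s s'" using has_Snd[OF has_Snd[OF V[of "[]"]]] by simp
      fix n b assume n: "n \<in> Car Y" and "b \<in> M (s, n) \<^bold>\<and> M (s', n)"
      then have W: "[a] @ [b] \<turnstile> Var 1 \<triangleright> M (s, n) \<^bold>\<and> M (s', n)" by (simp add: has_Var)
      note N = has_Snd[OF has_Strict[OF m has_Fst[OF W] st(1) n]]
      have "[a] @ [b] \<turnstile> Respect m (Fst (Var 0)) (Fst (Var 1)) ?n \<triangleright> M (t, n)"
        by (rule has_Respect[OF m has_Fst[OF V] has_Fst[OF W] N]) (use st n in simp_all)
      moreover have "[a] @ [b] \<turnstile> Respect m (Fst (Snd (Var 0))) (Snd (Var 1)) ?n \<triangleright> M (t', n)"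
        by (rule has_Respect[OF m has_Fst[OF has_Snd[OF V]] has_Snd[OF W] N]) (use st n in simp_all)
      ultimately have "[a] @ [b] \<turnstile> MkPair (Respect m (Fst (Var 0)) (Fst (Var 1)) ?n) (Respect m (Fst (Snd (Var 0))) (Snd (Var 1)) ?n) \<triangleright> ?K t t'"
        by (intro has_mono[OF has_MkPair]) (use n in auto)
      from has_MkPair[OF sS[OF has_Fst[OF V]] has_MkPair[OF sS[OF has_Fst[OF has_Snd[OF V]]] this]]
      show "[a] @ [b] \<turnstile> MkPair (Sym S (Fst (Var 0))) (MkPair (Sym S (Fst (Snd (Var 0))))
          (MkPair (Respect m (Fst (Var 0)) (Fst (Var 1)) ?n) (Respect m (Fst (Snd (Var 0))) (Snd (Var 1)) ?n)))
        \<triangleright> Eq S t s \<^bold>\<and> Eq S t' s' \<^bold>\<and> ?K t t'" using st by blast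
    qed
    with pq show "[a] \<turnstile> ?s \<triangleright> Eq (kernel_pair S Y M) q p" by simp
  next
    fix p q r a b assume "p \<in> Car (kernel_pair S Y M)" "q \<in> Car (kernel_pair S Y M)" "r \<in> Car (kernel_pair S Y M)"
      "a \<in> Eq (kernel_pair S Y M) p q" "b \<in> Eq (kernel_pair S Y M) q r"
    then obtain s s' t t' u u' where pq: "p = (s, s')" "q = (t, t')" "r = (u, u')"
      and st: "s \<in> Car S" "s' \<in> Car S" "t \<in> Car S" "t' \<in> Car S" "u \<in> Car S" "u' \<in> Car S"
      and a: "a \<in> Eq S s t \<^bold>\<and> Eq S s' t' \<^bold>\<and> ?K s s'" "b \<in> Eq S t u \<^bold>\<and> Eq S t' u' \<^bold>\<and> ?K t t'"
      by (cases p; cases q; cases r) auto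
    have V: "[a, b] \<turnstile> Var 0 \<triangleright> Eq S s t \<^bold>\<and> Eq S s' t' \<^bold>\<and> ?K s s'" "[a, b] \<turnstile> Var 1 \<triangleright> Eq S t u \<^bold>\<and> Eq S t' u' \<^bold>\<and> ?K t t'"
      using a by (simp_all add: has_Var)
    have "[a, b] \<turnstile> MkPair (Trans S (Fst (Var 0)) (Fst (Var 1)))
        (MkPair (Trans S (Fst (Snd (Var 0))) (Fst (Snd (Var 1)))) (Snd (Snd (Var 0)))) \<triangleright> Eq S s u \<^bold>\<and> Eq S s' u' \<^bold>\<and> ?K s s'"
      by (rule has_MkPair[OF tS[OF has_Fst[OF V(1)] has_Fst[OF V(2)]] has_MkPair[OF
            tS[OF has_Fst[OF has_Snd[OF V(1)]] has_Fst[OF has_Snd[OF V(2)]]] has_Snd[OF has_Snd[OF V(1)]]]])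
        (use st in simp_all)
    with pq show "[a, b] \<turnstile> MkPair (Trans S (Fst (Var 0)) (Fst (Var 1)))
        (MkPair (Trans S (Fst (Snd (Var 0))) (Fst (Snd (Var 1)))) (Snd (Snd (Var 0)))) \<triangleright> Eq (kernel_pair S Y M) p r" by simp
  qed
qed

text \<open>
  The two projections of the kernel pair have the same composite with the monomorphism, so they are
  equal. Evaluated at a pair \<open>(s, s')\<close> with \<open>M (s, n)\<close> and \<open>M (s', n)\<close>, this says \<open>s = s'\<close>.
\<close>
lemma eff_mono_injective:
  assumes S: "eff_object S" and mono: "eff_mono S Y (rel_class S Y M)" and M: "M \<in> functional S Y"
  shows "tripos_le (Car S \<times> Car S \<times> Car Y) (\<lambda>(s, s', n). M (s, n) \<^bold>\<and> M (s', n)) (\<lambda>(s, s', n). Eq S s s')"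
proof -
  note sS = has_Sym[OF S] and tS = has_Trans[OF S]
  obtain m where m: "\<And>\<Gamma>. \<Gamma> \<turnstile> m \<triangleright> functional_realizers S Y M" by (rule functionalE[OF M]) blast
  let ?K = "\<lambda>s s'. \<Union>n\<in>Car Y. M (s, n) \<^bold>\<and> M (s', n)"
  define T where "T = kernel_pair S Y M"
  have T: "eff_object T" unfolding T_def by (rule eff_object_kernel_pair[OF S M])
  have P: "graph_rel T S fst \<in> functional T S" "graph_rel T S snd \<in> functional T S"
  proof -
    have V: "[a] \<turnstile> Fst (Var 0) \<triangleright> Eq S (fst p) (fst q)" "[a] \<turnstile> Fst (Snd (Var 0)) \<triangleright> Eq S (snd p) (snd q)"
      if "a \<in> Eq T p q" for a p q
    proof -
      have V: "[a] \<turnstile> Var 0 \<triangleright> Eq S (fst p) (fst q) \<^bold>\<and> Eq S (snd p) (snd q) \<^bold>\<and> ?K (fst p) (snd p)"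
        using that by (cases p; cases q) (simp add: has_Var T_def)
      show "[a] \<turnstile> Fst (Var 0) \<triangleright> Eq S (fst p) (fst q)" by (rule has_Fst[OF V])
      show "[a] \<turnstile> Fst (Snd (Var 0)) \<triangleright> Eq S (snd p) (snd q)" by (rule has_Fst[OF has_Snd[OF V]])
    qed
    have "preserves_eq T S fst"
      unfolding preserves_eq_def
      by (intro conjI tripos_leI[where t = "Fst (Var 0)"]) (auto simp: T_def[THEN arg_cong[where f = Car]] dest: V(1))
    moreover have "preserves_eq T S snd"
      unfolding preserves_eq_def
      by (intro conjI tripos_leI[where t = "Fst (Snd (Var 0))"])
        (auto simp: T_def[THEN arg_cong[where f = Car]] dest: V(2))
    ultimately show "graph_rel T S fst \<in> functional T S" "graph_rel T S snd \<in> functional T S"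
      by (auto intro: graph_rel_functional[OF T S])
  qed
  \<comment> \<open>Both composites relate \<open>(s, s')\<close> to the common value \<open>n\<close> of \<open>s\<close> and \<open>s'\<close>; an element of the kernel
    pair contains realizers for some common value \<open>n'\<close>, which transfers \<open>n\<close> from one side to the other.\<close>
  have "equivalent (Car T \<times> Car Y) (rel_comp T S Y (graph_rel T S fst) M) (rel_comp T S Y (graph_rel T S snd) M)"
  proof
    let ?e = "Fst (Var 0)" and ?q = "Snd (Var 0)"
    let ?ms = "Respect m (Sym S ?q) (Var 1) (Snd (Strict m (Var 1)))"
    let ?t = "LetIn (Snd (Snd ?e)) (MkPair (MkPair ?e (Fst (Snd ?e))) (Respect m (Fst (Snd ?e)) (Snd (Var 2)) (Single m (Fst (Var 2)) ?ms)))"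
    show "tripos_le (Car T \<times> Car Y) (rel_comp T S Y (graph_rel T S fst) M) (rel_comp T S Y (graph_rel T S snd) M)"
    proof (rule tripos_leI2[where t = ?t])
      fix j v assume "j \<in> Car T \<times> Car Y" "v \<in> rel_comp T S Y (graph_rel T S fst) M j"
      then obtain s s' t n a b where j: "j = ((s, s'), n)" and v: "v = lpair a b"
        and st: "s \<in> Car S" "s' \<in> Car S" "t \<in> Car S" "n \<in> Car Y"
        and a: "a \<in> Eq T (s, s') (s, s') \<^bold>\<and> Eq S s t" "b \<in> M (t, n)"
        by (auto simp: rel_comp_apply graph_rel_apply T_def rconj_def[of _ "M _"])
      have V: "[a, b] @ \<Delta> \<turnstile> Var 0 \<triangleright> (Eq S s s \<^bold>\<and> Eq S s' s' \<^bold>\<and> ?K s s') \<^bold>\<and> Eq S s t"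
        "[a, b] @ \<Delta> \<turnstile> Var 1 \<triangleright> M (t, n)" for \<Delta>
        using a by (simp_all add: has_Var T_def)
      have "[a, b] \<turnstile> ?t \<triangleright> rel_comp T S Y (graph_rel T S snd) M j"
      proof (rule has_Let_UN)
        show "[a, b] \<turnstile> Snd (Snd ?e) \<triangleright> ?K s s'" using has_Snd[OF has_Snd[OF has_Fst[OF V(1)[of "[]"]]]] by simp
        fix n' c assume n': "n' \<in> Car Y" and "c \<in> M (s, n') \<^bold>\<and> M (s', n')"
        then have W: "[a, b] @ [c] \<turnstile> Var 2 \<triangleright> M (s, n') \<^bold>\<and> M (s', n')" by (simp add: has_Var)
        have ms: "[a, b] @ [c] \<turnstile> ?ms \<triangleright> M (s, n)"
          by (rule has_Respect[OF m sS[OF has_Snd[OF V(1)]] V(2) has_Snd[OF has_Strict[OF m V(2)]]]) (use st in simp_all)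
        have "[a, b] @ [c] \<turnstile> Respect m (Fst (Snd ?e)) (Snd (Var 2)) (Single m (Fst (Var 2)) ?ms) \<triangleright> M (s', n)"
          by (rule has_Respect[OF m has_Fst[OF has_Snd[OF has_Fst[OF V(1)]]] has_Snd[OF W] has_Single[OF m has_Fst[OF W] ms]])
            (use st n' in simp_all)
        from has_MkPair[OF has_MkPair[OF has_Fst[OF V(1)] has_Fst[OF has_Snd[OF has_Fst[OF V(1)]]]] this]
        show "[a, b] @ [c] \<turnstile> MkPair (MkPair ?e (Fst (Snd ?e))) (Respect m (Fst (Snd ?e)) (Snd (Var 2)) (Single m (Fst (Var 2)) ?ms))
            \<triangleright> rel_comp T S Y (graph_rel T S snd) M j"
          by (rule has_mono) (use st in \<open>auto simp: j rel_comp_apply graph_rel_apply T_def\<close>)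
      qed
      with v show "\<exists>a b. v = lpair a b \<and> [a, b] \<turnstile> ?t \<triangleright> rel_comp T S Y (graph_rel T S snd) M j" by blast
    qed
    let ?t = "LetIn (Snd (Snd ?e)) (MkPair (MkPair ?e (Fst ?e)) (Respect m (Fst ?e) (Fst (Var 2)) (Single m (Snd (Var 2)) ?ms)))"
    show "tripos_le (Car T \<times> Car Y) (rel_comp T S Y (graph_rel T S snd) M) (rel_comp T S Y (graph_rel T S fst) M)"
    proof (rule tripos_leI2[where t = ?t])
      fix j v assume "j \<in> Car T \<times> Car Y" "v \<in> rel_comp T S Y (graph_rel T S snd) M j"
      then obtain s s' t n a b where j: "j = ((s, s'), n)" and v: "v = lpair a b"
        and st: "s \<in> Car S" "s' \<in> Car S" "t \<in> Car S" "n \<in> Car Y"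
        and a: "a \<in> Eq T (s, s') (s, s') \<^bold>\<and> Eq S s' t" "b \<in> M (t, n)"
        by (auto simp: rel_comp_apply graph_rel_apply T_def rconj_def[of _ "M _"])
      have V: "[a, b] @ \<Delta> \<turnstile> Var 0 \<triangleright> (Eq S s s \<^bold>\<and> Eq S s' s' \<^bold>\<and> ?K s s') \<^bold>\<and> Eq S s' t"
        "[a, b] @ \<Delta> \<turnstile> Var 1 \<triangleright> M (t, n)" for \<Delta>
        using a by (simp_all add: has_Var T_def)
      have "[a, b] \<turnstile> ?t \<triangleright> rel_comp T S Y (graph_rel T S fst) M j"
      proof (rule has_Let_UN)
        show "[a, b] \<turnstile> Snd (Snd ?e) \<triangleright> ?K s s'" using has_Snd[OF has_Snd[OF has_Fst[OF V(1)[of "[]"]]]] by simp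
        fix n' c assume n': "n' \<in> Car Y" and "c \<in> M (s, n') \<^bold>\<and> M (s', n')"
        then have W: "[a, b] @ [c] \<turnstile> Var 2 \<triangleright> M (s, n') \<^bold>\<and> M (s', n')" by (simp add: has_Var)
        have ms: "[a, b] @ [c] \<turnstile> ?ms \<triangleright> M (s', n)"
          by (rule has_Respect[OF m sS[OF has_Snd[OF V(1)]] V(2) has_Snd[OF has_Strict[OF m V(2)]]]) (use st in simp_all)
        have "[a, b] @ [c] \<turnstile> Respect m (Fst ?e) (Fst (Var 2)) (Single m (Snd (Var 2)) ?ms) \<triangleright> M (s, n)"
          by (rule has_Respect[OF m has_Fst[OF has_Fst[OF V(1)]] has_Fst[OF W] has_Single[OF m has_Snd[OF W] ms]])
            (use st n' in simp_all)
        from has_MkPair[OF has_MkPair[OF has_Fst[OF V(1)] has_Fst[OF has_Fst[OF V(1)]]] this]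
        show "[a, b] @ [c] \<turnstile> MkPair (MkPair ?e (Fst ?e)) (Respect m (Fst ?e) (Fst (Var 2)) (Single m (Snd (Var 2)) ?ms))
            \<triangleright> rel_comp T S Y (graph_rel T S fst) M j"
          by (rule has_mono) (use st in \<open>auto simp: j rel_comp_apply graph_rel_apply T_def\<close>)
      qed
      with v show "\<exists>a b. v = lpair a b \<and> [a, b] \<turnstile> ?t \<triangleright> rel_comp T S Y (graph_rel T S fst) M j" by blast
    qed
  qed
  then have "rel_class T Y (rel_comp T S Y (graph_rel T S fst) M) = rel_class T Y (rel_comp T S Y (graph_rel T S snd) M)"
    by (rule rel_class_eqI) simp_all
  then have "eff_comp T S Y (rel_class S Y M) (rel_class T S (graph_rel T S fst)) = eff_comp T S Y (rel_class S Y M) (rel_class T S (graph_rel T S snd))"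
    by (simp add: eff_comp_rel_class P M)
  with mono T P have "rel_class T S (graph_rel T S fst) = rel_class T S (graph_rel T S snd)"
    unfolding eff_mono_def by (blast intro: rel_class_hom)
  note le = conjunct1[OF rel_class_eqD[OF P(1) this]]
  obtain f where
    f: "\<And>\<Gamma> u i. \<Gamma> \<turnstile> u \<triangleright> graph_rel T S fst i \<Longrightarrow> i \<in> Car T \<times> Car S \<Longrightarrow> \<Gamma> \<turnstile> f u \<triangleright> graph_rel T S snd i"
    by (rule tripos_le_term[OF le]) blast
  let ?e = "Fst (Strict m (Var 0))" and ?e' = "Fst (Strict m (Var 1))"
  let ?t = "Sym S (Snd (f (MkPair (MkPair ?e (MkPair ?e' (MkPair (Var 0) (Var 1)))) ?e)))"
  show ?thesis
  proof (rule tripos_leI2[where t = ?t])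
    fix j v assume "j \<in> Car S \<times> Car S \<times> Car Y" "v \<in> (case j of (s, s', n) \<Rightarrow> M (s, n) \<^bold>\<and> M (s', n))"
    then obtain s s' n a b where j: "j = (s, s', n)" and v: "v = lpair a b"
      and st: "s \<in> Car S" "s' \<in> Car S" "n \<in> Car Y" and ab: "a \<in> M (s, n)" "b \<in> M (s', n)"
      by (auto simp: rconj_def)
    have V: "[a, b] \<turnstile> Var 0 \<triangleright> M (s, n)" "[a, b] \<turnstile> Var 1 \<triangleright> M (s', n)" using ab by (simp_all add: has_Var)
    note E = has_Fst[OF has_Strict[OF m V(1) st(1,3)]] and E' = has_Fst[OF has_Strict[OF m V(2) st(2,3)]]
    have "[a, b] \<turnstile> MkPair (Var 0) (Var 1) \<triangleright> ?K s s'"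
      by (rule has_mono[OF has_MkPair[OF V]]) (use st in auto)
    from has_MkPair[OF has_MkPair[OF E has_MkPair[OF E' this]] E]
    have "[a, b] \<turnstile> MkPair (MkPair ?e (MkPair ?e' (MkPair (Var 0) (Var 1)))) ?e \<triangleright> graph_rel T S fst ((s, s'), s)"
      using st by (simp add: graph_rel_apply T_def)
    from f[OF this] have "[a, b] \<turnstile> f (MkPair (MkPair ?e (MkPair ?e' (MkPair (Var 0) (Var 1)))) ?e) \<triangleright> Eq T (s, s') (s, s') \<^bold>\<and> Eq S s' s"
      using st by (simp add: graph_rel_apply T_def)
    from sS[OF has_Snd[OF this]] j v st show "\<exists>a b. v = lpair a b \<and> [a, b] \<turnstile> ?t \<triangleright> (case j of (s, s', n) \<Rightarrow> Eq S s s')"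
      by auto
  qed
qed

text \<open>
  For a predicate \<open>I\<close> on \<open>X\<close> this is the subobject of \<open>X \<times> \<Omega>\<close> formed by the points \<open>(x, \<top>)\<close> and \<open>(x, I x)\<close>,
  coded as \<open>Inl x\<close> and \<open>Inr x\<close>. The two copies of \<open>X\<close> coincide where \<open>I\<close> holds. Compared with a disjoint
  sum that is glued along \<open>I\<close>, no realizer of equality has to say from which copy an element comes.
\<close>
definition cokernel_test :: "'a eff \<Rightarrow> ('a \<Rightarrow> nat set) \<Rightarrow> ('a + 'a) eff" where
  "cokernel_test X I = (let p = (\<lambda>c. case c of Inl x \<Rightarrow> UNIV | Inr x \<Rightarrow> I x); u = case_sum id id
     in \<lparr>Car = Car X <+> Car X,
         Eq = (\<lambda>c d. Eq X (u c) (u d) \<^bold>\<and> (p c \<^bold>\<rightarrow> \<J> (p d)) \<^bold>\<and> (p d \<^bold>\<rightarrow> \<J> (p c)))\<rparr>)"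

lemma has_rarrow_comp:
  assumes "\<And>a. \<Gamma> @ [a] \<turnstile> g \<triangleright> B \<^bold>\<rightarrow> \<J> C" "\<And>a. \<Gamma> @ [a] \<turnstile> f \<triangleright> A \<^bold>\<rightarrow> \<J> B"
  shows "\<Gamma> \<turnstile> Lam (App g (App f (Var (length \<Gamma>)))) \<triangleright> A \<^bold>\<rightarrow> \<J> C"
  by (rule has_Lam_rarrow, rule has_App_rarrow[OF assms(1) has_App_rarrow[OF assms(2)]]) (simp_all add: has_Var)

lemma eff_object_cokernel_test:
  assumes X: "eff_object X"
  shows "eff_object (cokernel_test X I)"
proof -
  note sX = has_Sym[OF X] and tX = has_Trans[OF X]
  define p :: "'a + 'a \<Rightarrow> nat set" where "p = (\<lambda>c. case c of Inl x \<Rightarrow> UNIV | Inr x \<Rightarrow> I x)"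
  define u :: "'a + 'a \<Rightarrow> 'a" where "u = case_sum id id"
  let ?T = "cokernel_test X I"
  have eq: "Eq ?T c d = Eq X (u c) (u d) \<^bold>\<and> (p c \<^bold>\<rightarrow> \<J> (p d)) \<^bold>\<and> (p d \<^bold>\<rightarrow> \<J> (p c))" for c d
    unfolding cokernel_test_def Let_def p_def u_def by simp
  have u: "u c \<in> Car X" if "c \<in> Car ?T" for c
    using that unfolding cokernel_test_def Let_def u_def by auto
  show ?thesis
  proof (rule eff_objectI)
    fix c d a assume cd: "c \<in> Car ?T" "d \<in> Car ?T" and "a \<in> Eq ?T c d"
    then have V: "[a] \<turnstile> Var 0 \<triangleright> Eq X (u c) (u d) \<^bold>\<and> (p c \<^bold>\<rightarrow> \<J> (p d)) \<^bold>\<and> (p d \<^bold>\<rightarrow> \<J> (p c))"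
      by (simp add: has_Var eq)
    from has_MkPair[OF sX[OF has_Fst[OF V]] has_MkPair[OF has_Snd[OF has_Snd[OF V]] has_Fst[OF has_Snd[OF V]]]]
    show "[a] \<turnstile> MkPair (Sym X (Fst (Var 0))) (MkPair (Snd (Snd (Var 0))) (Fst (Snd (Var 0)))) \<triangleright> Eq ?T d c"
      using u cd by (simp add: eq)
  next
    fix c d e a b assume cde: "c \<in> Car ?T" "d \<in> Car ?T" "e \<in> Car ?T" and ab: "a \<in> Eq ?T c d" "b \<in> Eq ?T d e"
    have V: "[a, b] @ \<Delta> \<turnstile> Var 0 \<triangleright> Eq X (u c) (u d) \<^bold>\<and> (p c \<^bold>\<rightarrow> \<J> (p d)) \<^bold>\<and> (p d \<^bold>\<rightarrow> \<J> (p c))"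
      "[a, b] @ \<Delta> \<turnstile> Var 1 \<triangleright> Eq X (u d) (u e) \<^bold>\<and> (p d \<^bold>\<rightarrow> \<J> (p e)) \<^bold>\<and> (p e \<^bold>\<rightarrow> \<J> (p d))" for \<Delta>
      using ab by (simp_all add: has_Var eq)
    have "[a, b] \<turnstile> Lam (App (Fst (Snd (Var 1))) (App (Fst (Snd (Var 0))) (Var (length [a, b])))) \<triangleright> p c \<^bold>\<rightarrow> \<J> (p e)"
      by (rule has_rarrow_comp[where B = "p d"]) (rule has_Fst[OF has_Snd[OF V(2)]], rule has_Fst[OF has_Snd[OF V(1)]])
    moreover have "[a, b] \<turnstile> Lam (App (Snd (Snd (Var 0))) (App (Snd (Snd (Var 1))) (Var (length [a, b])))) \<triangleright> p e \<^bold>\<rightarrow> \<J> (p c)"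
      by (rule has_rarrow_comp[where B = "p d"]) (rule has_Snd[OF has_Snd[OF V(1)]], rule has_Snd[OF has_Snd[OF V(2)]])
    moreover have "[a, b] \<turnstile> Trans X (Fst (Var 0)) (Fst (Var 1)) \<triangleright> Eq X (u c) (u e)"
      using tX[OF has_Fst[OF V(1)[of "[]"]] has_Fst[OF V(2)[of "[]"]]] u cde by simp
    ultimately show "[a, b] \<turnstile> MkPair (Trans X (Fst (Var 0)) (Fst (Var 1)))
        (MkPair (Lam (App (Fst (Snd (Var 1))) (App (Fst (Snd (Var 0))) (Var 2))))
        (Lam (App (Snd (Snd (Var 0))) (App (Snd (Snd (Var 1))) (Var 2))))) \<triangleright> Eq ?T c e"
      by (simp add: numeral_2_eq_2 has_MkPair eq)
  qed
qed

text \<open>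
  For cancellation: two maps that agree on everything that \<open>Q\<close> hits have the same composite with \<open>Q\<close>.
\<close>
lemma rel_comp_graph_le:
  assumes Q: "Q \<in> functional S X" and Z: "eff_object Z"
    and kZ: "\<And>x. x \<in> Car X \<Longrightarrow> k x \<in> Car Z" and lZ: "\<And>x. x \<in> Car X \<Longrightarrow> l x \<in> Car Z"
    and kl: "tripos_le (Car S \<times> Car X) Q (\<lambda>(s, x). Eq Z (l x) (k x))"
  shows "tripos_le (Car S \<times> Car Z) (rel_comp S X Z Q (graph_rel X Z k)) (rel_comp S X Z Q (graph_rel X Z l))"
proof -
  note tZ = has_Trans[OF Z]
  obtain f where f': "\<And>\<Gamma> u i. \<Gamma> \<turnstile> u \<triangleright> Q i \<Longrightarrow> i \<in> Car S \<times> Car X \<Longrightarrow>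
      \<Gamma> \<turnstile> f u \<triangleright> (case i of (s, x) \<Rightarrow> Eq Z (l x) (k x))"
    by (rule tripos_le_term[OF kl]) blast
  show ?thesis
  proof (rule tripos_leI2[where t = "MkPair (Var 0) (MkPair (Fst (Var 1)) (Trans Z (f (Var 0)) (Snd (Var 1))))"])
    fix j v assume "j \<in> Car S \<times> Car Z" "v \<in> rel_comp S X Z Q (graph_rel X Z k) j"
    then obtain s x z a b where j: "j = (s, z)" and v: "v = lpair a b"
      and sxz: "s \<in> Car S" "x \<in> Car X" "z \<in> Car Z" and ab: "a \<in> Q (s, x)" "b \<in> Eq X x x \<^bold>\<and> Eq Z (k x) z"
      by (auto simp: rel_comp_apply graph_rel_apply rconj_def[of "Q _"])
    have V: "[a, b] \<turnstile> Var 0 \<triangleright> Q (s, x)" "[a, b] \<turnstile> Var 1 \<triangleright> Eq X x x \<^bold>\<and> Eq Z (k x) z"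
      using ab by (simp_all add: has_Var)
    have "[a, b] \<turnstile> f (Var 0) \<triangleright> Eq Z (l x) (k x)" using f'[OF V(1)] sxz by simp
    from tZ[OF this has_Snd[OF V(2)]] have "[a, b] \<turnstile> Trans Z (f (Var 0)) (Snd (Var 1)) \<triangleright> Eq Z (l x) z"
      using sxz kZ lZ by blast
    from has_MkPair[OF V(1) has_MkPair[OF has_Fst[OF V(2)] this]]
    have "[a, b] \<turnstile> MkPair (Var 0) (MkPair (Fst (Var 1)) (Trans Z (f (Var 0)) (Snd (Var 1)))) \<triangleright> rel_comp S X Z Q (graph_rel X Z l) j"
      by (rule has_mono) (use sxz in \<open>auto simp: j rel_comp_apply graph_rel_apply\<close>)
    with v show "\<exists>a b. v = lpair a b \<and> [a, b] \<turnstile> MkPair (Var 0) (MkPair (Fst (Var 1)) (Trans Z (f (Var 0)) (Snd (Var 1))))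
        \<triangleright> rel_comp S X Z Q (graph_rel X Z l) j" by blast
  qed
qed

text \<open>
  With \<open>I\<close> the image of \<open>Q\<close>, the two inclusions of \<open>X\<close> agree after the epimorphism, hence they agree.
  So \<open>(x, \<top>) = (x, I x)\<close> for every \<open>x\<close>, that is, \<open>I x\<close> holds.
\<close>
lemma eff_epi_surjective:
  assumes X: "eff_object X" and epi: "eff_epi S X (rel_class S X Q)" and Q: "Q \<in> functional S X"
  shows "tripos_le (Car X) (\<lambda>x. Eq X x x) (\<lambda>x. \<Union>s\<in>Car S. Q (s, x))"
proof -
  note sX = has_Sym[OF X] and tX = has_Trans[OF X]
  obtain q where q: "\<And>\<Gamma>. \<Gamma> \<turnstile> q \<triangleright> functional_realizers S X Q" by (rule functionalE[OF Q]) blast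
  let ?I = "\<lambda>x. \<Union>s\<in>Car S. Q (s, x)"
  define T where "T = cokernel_test X ?I"
  have T: "eff_object T" unfolding T_def by (rule eff_object_cokernel_test[OF X])
  have car: "Inl x \<in> Car T" "Inr x \<in> Car T" if "x \<in> Car X" for x
    using that by (auto simp: T_def cokernel_test_def Let_def)
  have eq: "Eq T (Inl x) (Inl y) = Eq X x y \<^bold>\<and> (UNIV \<^bold>\<rightarrow> \<J> UNIV) \<^bold>\<and> (UNIV \<^bold>\<rightarrow> \<J> UNIV)"
    "Eq T (Inl x) (Inr y) = Eq X x y \<^bold>\<and> (UNIV \<^bold>\<rightarrow> \<J> (?I y)) \<^bold>\<and> (?I y \<^bold>\<rightarrow> \<J> UNIV)"
    "Eq T (Inr x) (Inl y) = Eq X x y \<^bold>\<and> (?I x \<^bold>\<rightarrow> \<J> UNIV) \<^bold>\<and> (UNIV \<^bold>\<rightarrow> \<J> (?I x))"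
    "Eq T (Inr x) (Inr y) = Eq X x y \<^bold>\<and> (?I x \<^bold>\<rightarrow> \<J> (?I y)) \<^bold>\<and> (?I y \<^bold>\<rightarrow> \<J> (?I x))" for x y
    by (simp_all add: T_def cokernel_test_def Let_def)
  have "preserves_eq X T Inl"
    unfolding preserves_eq_def
  proof (intro conjI tripos_leI[where t = "MkPair (Var 0) (MkPair (Lam (Var 1)) (Lam (Var 1)))"])
    fix i a assume "i \<in> Car X \<times> Car X" "a \<in> (case i of (x, y) \<Rightarrow> Eq X x y)"
    then show "[a] \<turnstile> MkPair (Var 0) (MkPair (Lam (Var 1)) (Lam (Var 1))) \<triangleright> (case i of (x, y) \<Rightarrow> Eq T (Inl x) (Inl y))"
      by (cases i) (auto simp: eq has_Var intro!: has_MkPair has_Lam_rarrow)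
  qed (use car in auto)
  moreover have "preserves_eq X T Inr"
    unfolding preserves_eq_def
  proof (intro conjI tripos_leI[where t = "MkPair (Var 0) (MkPair (Lam (Respect q (Fst (Strict q (Var 1))) (Var 1) (Var 0)))
      (Lam (Respect q (Fst (Strict q (Var 1))) (Var 1) (Sym X (Var 0)))))"])
    fix i a assume "i \<in> Car X \<times> Car X" "a \<in> (case i of (x, y) \<Rightarrow> Eq X x y)"
    then obtain x y where i: "i = (x, y)" and xy: "x \<in> Car X" "y \<in> Car X" "a \<in> Eq X x y" by (cases i) auto
    have V: "[a] @ \<Delta> \<turnstile> Var 0 \<triangleright> Eq X x y" for \<Delta> using xy by (simp add: has_Var)
    have I: "[a] \<turnstile> Lam (Respect q (Fst (Strict q (Var 1))) (Var 1) e) \<triangleright> ?I x \<^bold>\<rightarrow> \<J> (?I y)"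
      if e: "\<And>b. [a] @ [b] \<turnstile> e \<triangleright> Eq X x y" and xy: "x \<in> Car X" "y \<in> Car X" for x y e
    proof (rule has_Lam_rarrow)
      fix b assume "b \<in> ?I x"
      then obtain s where s: "s \<in> Car S" and b: "b \<in> Q (s, x)" by blast
      then have W: "[a] @ [b] \<turnstile> Var 1 \<triangleright> Q (s, x)" by (simp add: has_Var)
      have "[a] @ [b] \<turnstile> Respect q (Fst (Strict q (Var 1))) (Var 1) e \<triangleright> Q (s, y)"
        by (rule has_Respect[OF q has_Fst[OF has_Strict[OF q W]] W e]) (use s xy in simp_all)
      then show "[a] @ [b] \<turnstile> Respect q (Fst (Strict q (Var 1))) (Var 1) e \<triangleright> ?I y"
        by (rule has_mono) (use s in blast)
    qed
    have "[a] \<turnstile> Var 0 \<triangleright> Eq X x y" using V[of "[]"] by simp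
    from has_MkPair[OF this has_MkPair[OF I[OF V] I[OF sX[OF V]]]] i xy
    show "[a] \<turnstile> MkPair (Var 0) (MkPair (Lam (Respect q (Fst (Strict q (Var 1))) (Var 1) (Var 0)))
      (Lam (Respect q (Fst (Strict q (Var 1))) (Var 1) (Sym X (Var 0))))) \<triangleright> (case i of (x, y) \<Rightarrow> Eq T (Inr x) (Inr y))"
      by (simp add: eq)
  qed (use car in auto)
  ultimately have F: "graph_rel X T Inl \<in> functional X T" "graph_rel X T Inr \<in> functional X T"
    by (auto intro: graph_rel_functional[OF X T])
  have "equivalent (Car S \<times> Car T) (rel_comp S X T Q (graph_rel X T Inl)) (rel_comp S X T Q (graph_rel X T Inr))"
  proof
    have V: "[a] \<turnstile> Snd (Strict q (Var 0)) \<triangleright> Eq X x x" "[a] \<turnstile> Lam (Var 0) \<triangleright> UNIV \<^bold>\<rightarrow> \<J> (?I x)"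
      "[a] \<turnstile> Lam (Var 0) \<triangleright> ?I x \<^bold>\<rightarrow> \<J> UNIV"
      if "s \<in> Car S" "x \<in> Car X" "a \<in> Q (s, x)" for s x a
    proof -
      have "[a] \<turnstile> Var 0 \<triangleright> Q (s, x)" using that by (simp add: has_Var)
      from has_Snd[OF has_Strict[OF q this]] that show "[a] \<turnstile> Snd (Strict q (Var 0)) \<triangleright> Eq X x x" by blast
      show "[a] \<turnstile> Lam (Var 0) \<triangleright> UNIV \<^bold>\<rightarrow> \<J> (?I x)"
        by (rule has_Lam_rarrow, rule has_Var) (use that in auto)
      show "[a] \<turnstile> Lam (Var 0) \<triangleright> ?I x \<^bold>\<rightarrow> \<J> UNIV"
        by (rule has_Lam_rarrow, rule has_Var) simp_all
    qed
    show "tripos_le (Car S \<times> Car T) (rel_comp S X T Q (graph_rel X T Inl)) (rel_comp S X T Q (graph_rel X T Inr))"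
      by (rule rel_comp_graph_le[OF Q T car], assumption+,
          rule tripos_leI[where t = "MkPair (Snd (Strict q (Var 0))) (MkPair (Lam (Var 0)) (Lam (Var 0)))"])
        (auto simp: eq intro!: has_MkPair dest: V)
    show "tripos_le (Car S \<times> Car T) (rel_comp S X T Q (graph_rel X T Inr)) (rel_comp S X T Q (graph_rel X T Inl))"
      by (rule rel_comp_graph_le[OF Q T car(2,1)], assumption+,
          rule tripos_leI[where t = "MkPair (Snd (Strict q (Var 0))) (MkPair (Lam (Var 0)) (Lam (Var 0)))"])
        (auto simp: eq intro!: has_MkPair dest: V)
  qed
  then have "rel_class S T (rel_comp S X T Q (graph_rel X T Inl)) = rel_class S T (rel_comp S X T Q (graph_rel X T Inr))"
    by (rule rel_class_eqI) simp_all
  then have "eff_comp S X T (rel_class X T (graph_rel X T Inl)) (rel_class S X Q) = eff_comp S X T (rel_class X T (graph_rel X T Inr)) (rel_class S X Q)"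
    by (simp add: eff_comp_rel_class F Q)
  with epi T F have "rel_class X T (graph_rel X T Inl) = rel_class X T (graph_rel X T Inr)"
    unfolding eff_epi_def by (blast intro: rel_class_hom)
  note le = conjunct1[OF rel_class_eqD[OF F(1) this]]
  obtain f where f: "\<And>\<Gamma> u i. \<Gamma> \<turnstile> u \<triangleright> graph_rel X T Inl i \<Longrightarrow> i \<in> Car X \<times> Car T \<Longrightarrow> \<Gamma> \<turnstile> f u \<triangleright> graph_rel X T Inr i"
    by (rule tripos_le_term[OF le]) blast
  let ?g = "MkPair (Var 0) (MkPair (Var 0) (MkPair (Lam (Var 1)) (Lam (Var 1))))"
  show ?thesis
  proof (rule tripos_leI[where t = "App (Snd (Snd (Snd (f ?g)))) (Var 0)"])
    fix x a assume x: "x \<in> Car X" "a \<in> Eq X x x"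
    have V: "[a] \<turnstile> Var 0 \<triangleright> Eq X x x" "[a] \<turnstile> Var 0 \<triangleright> UNIV" using x by (simp_all add: has_Var)
    have "[a] \<turnstile> Lam (Var 1) \<triangleright> UNIV \<^bold>\<rightarrow> \<J> UNIV" by (rule has_Lam_rarrow, rule has_Var) simp_all
    from has_MkPair[OF V(1) has_MkPair[OF V(1) has_MkPair[OF this this]]]
    have "[a] \<turnstile> ?g \<triangleright> graph_rel X T Inl (x, Inl x)" using x car by (simp add: graph_rel_apply eq)
    from f[OF this] have "[a] \<turnstile> f ?g \<triangleright> Eq X x x \<^bold>\<and> Eq X x x \<^bold>\<and> (?I x \<^bold>\<rightarrow> \<J> UNIV) \<^bold>\<and> (UNIV \<^bold>\<rightarrow> \<J> (?I x))"
      using x car by (simp add: graph_rel_apply eq)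
    from has_App_rarrow[OF has_Snd[OF has_Snd[OF has_Snd[OF this]]] V(2)]
    show "[a] \<turnstile> App (Snd (Snd (Snd (f ?g)))) (Var 0) \<triangleright> ?I x" .
  qed
qed

lemma modest_subquotient:
  assumes X: "eff_object X" and sub: "subquotient TYPE('s) X Y" and Y: "modest Y"
  shows "modest X"
proof -
  obtain S :: "'s eff" and m q where S: "eff_object S" and m: "eff_mono S Y m" and q: "eff_epi S X q"
    using sub unfolding subquotient_def by blast
  obtain M where M: "M \<in> functional S Y" "m = rel_class S Y M"
    using m unfolding eff_mono_def by (blast elim: homE)
  obtain Q where Q: "Q \<in> functional S X" "q = rel_class S X Q"
    using q unfolding eff_epi_def by (blast elim: homE)
  have "modest S"
    by (rule modest_subobject[OF Y M(1) eff_mono_injective[OF S m[unfolded M(2)] M(1)] S])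
  then show ?thesis
    by (rule modest_quotient[OF _ Q(1) eff_epi_surjective[OF X q[unfolded Q(2)] Q(1)]])
qed

section \<open>The natural map to the exponential by the subobject classifier\<close>

text \<open>
  The map \<open>a \<mapsto> \<langle>0, a\<rangle>\<close> realizes \<open>p \<^bold>\<rightarrow> \<J> p\<close> for every \<open>p\<close>, so one number realizes the existence of
  all truth values.
\<close>
definition Top :: trm where "Top = Const (SOME e. \<forall>p. e \<in> Eq eff_Omega p p)"

lemma eff_Omega_simps [simp]: "Car eff_Omega = UNIV" "Eq eff_Omega p q = (p \<^bold>\<rightarrow> \<J> q) \<^bold>\<and> (q \<^bold>\<rightarrow> \<J> p)"
  by (simp_all add: eff_Omega_def)

lemma has_Top: "\<Gamma> \<turnstile> Top \<triangleright> Eq eff_Omega p p"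
proof -
  have "[] \<turnstile> Lam (Var 0) \<triangleright> le_realizers UNIV (\<lambda>p. p) (\<lambda>p. p)"
    by (rule has_Lam) (simp add: has_Var)
  from has_nonempty[OF this] obtain k where k: "k \<in> p \<^bold>\<rightarrow> \<J> p" for p
    unfolding le_realizers_def by blast
  have "\<exists>e. \<forall>p. e \<in> Eq eff_Omega p p"
    by (rule exI[of _ "lpair k k"]) (use k in \<open>auto simp: rconj_def\<close>)
  from someI_ex[OF this] show ?thesis unfolding Top_def by (intro has_Const) blast
qed

lemma eff_prod_simps [simp]: "Car (eff_prod X Y) = Car X \<times> Car Y"
  "Eq (eff_prod X Y) (x, y) (x', y') = Eq X x x' \<^bold>\<and> Eq Y y y'"
  by (simp_all add: eff_prod_def)

text \<open>The representative of the projection \<open>X \<times> \<Omega> \<rightarrow> X\<close> in the definition of \<^const>\<open>eff_fst\<close>.\<close>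
definition fst_rel :: "'a eff \<Rightarrow> ('a \<times> nat set) \<times> 'a \<Rightarrow> nat set" where
  "fst_rel X = restrict (\<lambda>((x, p), y). Eq X x y \<^bold>\<and> Eq eff_Omega p p) ((Car X \<times> UNIV) \<times> Car X)"

lemma fst_rel_apply: "x \<in> Car X \<Longrightarrow> y \<in> Car X \<Longrightarrow> fst_rel X ((x, p), y) = Eq X x y \<^bold>\<and> Eq eff_Omega p p"
  by (simp add: fst_rel_def)

lemma fst_rel_functional:
  assumes X: "eff_object X"
  shows "fst_rel X \<in> functional (eff_prod X eff_Omega) X"
proof -
  note sX = has_Sym[OF X] and tX = has_Trans[OF X]
  note [simp del] = eff_Omega_simps(2)
  let ?P = "eff_prod X eff_Omega"
  let ?u = "Fst (Var 0)"
  have "[] \<turnstile> Functional (MkPair (MkPair (Trans X ?u (Sym X ?u)) (Snd (Var 0))) (Trans X (Sym X ?u) ?u))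
      (MkPair (Trans X (Trans X (Sym X ?u) (Fst (Var 1))) (Var 2)) Top)
      (Trans X (Sym X ?u) (Fst (Var 1))) (Var 0) \<triangleright> functional_realizers ?P X (fst_rel X)"
  proof (rule has_Functional)
    fix z y a assume "z \<in> Car ?P" "y \<in> Car X" "a \<in> fst_rel X (z, y)"
    then obtain x p where z: "z = (x, p)" and xy: "x \<in> Car X" "y \<in> Car X" and "a \<in> Eq X x y \<^bold>\<and> Eq eff_Omega p p"
      by (cases z) (auto simp: fst_rel_apply)
    then have V: "[] @ [a] \<turnstile> Var 0 \<triangleright> Eq X x y \<^bold>\<and> Eq eff_Omega p p" by (simp add: has_Var)
    from has_MkPair[OF has_MkPair[OF tX[OF has_Fst[OF V] sX[OF has_Fst[OF V]]] has_Snd[OF V]]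
        tX[OF sX[OF has_Fst[OF V]] has_Fst[OF V]]] xy
    show "[] @ [a] \<turnstile> MkPair (MkPair (Trans X ?u (Sym X ?u)) (Snd (Var 0))) (Trans X (Sym X ?u) ?u) \<triangleright> Eq ?P z z \<^bold>\<and> Eq X y y"
      by (simp add: z)
  next
    fix z z' y y' a b c assume "z \<in> Car ?P" "z' \<in> Car ?P" and y: "y \<in> Car X" "y' \<in> Car X"
      and a: "a \<in> Eq ?P z z'" and b: "b \<in> fst_rel X (z, y)" and c: "c \<in> Eq X y y'"
    then obtain x p x' p' where z: "z = (x, p)" "z' = (x', p')" and x: "x \<in> Car X" "x' \<in> Car X"
      by (cases z; cases z') auto
    have V: "[] @ [a, b, c] \<turnstile> Var 0 \<triangleright> Eq X x x' \<^bold>\<and> Eq eff_Omega p p'"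
      "[] @ [a, b, c] \<turnstile> Var 1 \<triangleright> Eq X x y \<^bold>\<and> Eq eff_Omega p p" "[] @ [a, b, c] \<turnstile> Var 2 \<triangleright> Eq X y y'"
      using a b c z x y by (simp_all add: has_Var fst_rel_apply)
    have "[] @ [a, b, c] \<turnstile> Trans X (Trans X (Sym X ?u) (Fst (Var 1))) (Var 2) \<triangleright> Eq X x' y'"
      by (rule tX[OF tX[OF sX[OF has_Fst[OF V(1)]] has_Fst[OF V(2)]] V(3)]) (use x y in simp_all)
    from has_MkPair[OF this has_Top[where p = p']]
    show "[] @ [a, b, c] \<turnstile> MkPair (Trans X (Trans X (Sym X ?u) (Fst (Var 1))) (Var 2)) Top \<triangleright> fst_rel X (z', y')"
      using x y by (simp add: z fst_rel_apply)
  next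
    fix z y y' a b assume "z \<in> Car ?P" and y: "y \<in> Car X" "y' \<in> Car X" and ab: "a \<in> fst_rel X (z, y)" "b \<in> fst_rel X (z, y')"
    then obtain x p where z: "z = (x, p)" and x: "x \<in> Car X" by (cases z) auto
    have V: "[] @ [a, b] \<turnstile> Var 0 \<triangleright> Eq X x y \<^bold>\<and> Eq eff_Omega p p" "[] @ [a, b] \<turnstile> Var 1 \<triangleright> Eq X x y' \<^bold>\<and> Eq eff_Omega p p"
      using ab z x y by (simp_all add: has_Var fst_rel_apply)
    show "[] @ [a, b] \<turnstile> Trans X (Sym X ?u) (Fst (Var 1)) \<triangleright> Eq X y y'"
      by (rule tX[OF sX[OF has_Fst[OF V(1)]] has_Fst[OF V(2)]]) (use x y in simp_all)
  next
    fix z a assume "z \<in> Car ?P" "a \<in> Eq ?P z z"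
    then show "[] @ [a] \<turnstile> Var 0 \<triangleright> (\<Union>y\<in>Car X. fst_rel X (z, y))"
      by (cases z) (auto simp: fst_rel_apply intro!: has_Var)
  qed
  then show ?thesis by (rule functionalI) (simp add: fst_rel_def)
qed

text \<open>
  The transpose of \<open>F\<close> sends \<open>x\<close> to the relation \<open>F ((x, -), -)\<close>. For the projection this is the relation
  of the constant map with value \<open>x\<close>.
\<close>
definition slice :: "'a eff \<Rightarrow> (('a \<times> nat set) \<times> 'a \<Rightarrow> nat set) \<Rightarrow> 'a \<Rightarrow> nat set \<times> 'a \<Rightarrow> nat set" where
  "slice X F x = restrict (\<lambda>(p, y). F ((x, p), y)) (UNIV \<times> Car X)"

lemma slice_apply: "y \<in> Car X \<Longrightarrow> slice X F x (p, y) = F ((x, p), y)"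
  by (simp add: slice_def)

lemma slice_predicates [simp]: "slice X F x \<in> predicates (UNIV \<times> Car X)"
  by (simp add: slice_def)

lemma slice_fst_rel_apply:
  "x \<in> Car X \<Longrightarrow> y \<in> Car X \<Longrightarrow> slice X (fst_rel X) x (p, y) = Eq X x y \<^bold>\<and> Eq eff_Omega p p"
  by (simp add: slice_apply fst_rel_apply)

lemma slice_fst_rel_preserves_eq:
  assumes X: "eff_object X"
  shows "preserves_eq X (eff_exp X eff_Omega) (slice X (fst_rel X))"
proof -
  note sX = has_Sym[OF X] and tX = has_Trans[OF X]
  note [simp del] = eff_Omega_simps(2)
  let ?K = "slice X (fst_rel X)"
  let ?fr = "Functional (MkPair (Snd (Var 1)) (Trans X (Sym X (Fst (Var 1))) (Fst (Var 1)))) (MkPair (Trans X (Fst (Var 2)) (Var 3)) Top)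
      (Trans X (Sym X (Fst (Var 1))) (Fst (Var 2))) (MkPair (Trans X (Var 0) (Sym X (Var 0))) (Var 1))"
  have fr: "[a] \<turnstile> ?fr \<triangleright> functional_realizers eff_Omega X (?K x)"
    if a: "a \<in> Eq X x x'" and x: "x \<in> Car X" "x' \<in> Car X" for a x x'
  proof (rule has_Functional)
    fix p y b assume y: "y \<in> Car X" and "b \<in> ?K x (p, y)"
    then have V: "[a] @ [b] \<turnstile> Var 1 \<triangleright> Eq X x y \<^bold>\<and> Eq eff_Omega p p" using x by (simp add: has_Var slice_fst_rel_apply)
    show "[a] @ [b] \<turnstile> MkPair (Snd (Var 1)) (Trans X (Sym X (Fst (Var 1))) (Fst (Var 1))) \<triangleright> Eq eff_Omega p p \<^bold>\<and> Eq X y y"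
      by (rule has_MkPair[OF has_Snd[OF V] tX[OF sX[OF has_Fst[OF V]] has_Fst[OF V]]]) (use x y in simp_all)
  next
    fix p p' y y' b c d assume y: "y \<in> Car X" "y' \<in> Car X" and "c \<in> ?K x (p, y)" "d \<in> Eq X y y'"
    then have V: "[a] @ [b, c, d] \<turnstile> Var 2 \<triangleright> Eq X x y \<^bold>\<and> Eq eff_Omega p p" "[a] @ [b, c, d] \<turnstile> Var 3 \<triangleright> Eq X y y'"
      using x by (simp_all add: has_Var slice_fst_rel_apply)
    have "[a] @ [b, c, d] \<turnstile> MkPair (Trans X (Fst (Var 2)) (Var 3)) Top \<triangleright> Eq X x y' \<^bold>\<and> Eq eff_Omega p' p'"
      by (rule has_MkPair[OF tX[OF has_Fst[OF V(1)] V(2)] has_Top]) (use x y in simp_all)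
    then show "[a] @ [b, c, d] \<turnstile> MkPair (Trans X (Fst (Var 2)) (Var 3)) Top \<triangleright> ?K x (p', y')"
      using x y by (simp add: slice_fst_rel_apply)
  next
    fix p y y' b c assume y: "y \<in> Car X" "y' \<in> Car X" and "b \<in> ?K x (p, y)" "c \<in> ?K x (p, y')"
    then have V: "[a] @ [b, c] \<turnstile> Var 1 \<triangleright> Eq X x y \<^bold>\<and> Eq eff_Omega p p"
      "[a] @ [b, c] \<turnstile> Var 2 \<triangleright> Eq X x y' \<^bold>\<and> Eq eff_Omega p p"
      using x by (simp_all add: has_Var slice_fst_rel_apply)
    show "[a] @ [b, c] \<turnstile> Trans X (Sym X (Fst (Var 1))) (Fst (Var 2)) \<triangleright> Eq X y y'"
      by (rule tX[OF sX[OF has_Fst[OF V(1)]] has_Fst[OF V(2)]]) (use x y in simp_all)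
  next
    fix p b assume "b \<in> Eq eff_Omega p p"
    then have V: "[a] @ [b] \<turnstile> Var 1 \<triangleright> Eq eff_Omega p p" "[a] @ [b] \<turnstile> Var 0 \<triangleright> Eq X x x'" using a by (simp_all add: has_Var)
    have "[a] @ [b] \<turnstile> MkPair (Trans X (Var 0) (Sym X (Var 0))) (Var 1) \<triangleright> Eq X x x \<^bold>\<and> Eq eff_Omega p p"
      by (rule has_MkPair[OF tX[OF V(2) sX[OF V(2)]] V(1)]) (use x in simp_all)
    then show "[a] @ [b] \<turnstile> MkPair (Trans X (Var 0) (Sym X (Var 0))) (Var 1) \<triangleright> (\<Union>y\<in>Car X. ?K x (p, y))"
      by (rule has_mono) (use x in \<open>auto simp: slice_fst_rel_apply\<close>)
  qed
  have le: "[a] \<turnstile> Lam (MkPair (Trans X e (Fst (Var 1))) (Snd (Var 1))) \<triangleright> le_realizers (UNIV \<times> Car X) (?K x) (?K x')"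
    if e: "\<And>b. [a] @ [b] \<turnstile> e \<triangleright> Eq X x' x" and x: "x \<in> Car X" "x' \<in> Car X" for a e x x'
  proof (rule has_Lam)
    fix i b assume "i \<in> UNIV \<times> Car X" "b \<in> ?K x i"
    then obtain p y where i: "i = (p, y)" and y: "y \<in> Car X" and "b \<in> Eq X x y \<^bold>\<and> Eq eff_Omega p p"
      using x by (auto simp: slice_fst_rel_apply)
    then have V: "[a] @ [b] \<turnstile> Var 1 \<triangleright> Eq X x y \<^bold>\<and> Eq eff_Omega p p" by (simp add: has_Var)
    from has_MkPair[OF tX[OF e has_Fst[OF V]] has_Snd[OF V]] x y
    show "[a] @ [b] \<turnstile> MkPair (Trans X e (Fst (Var 1))) (Snd (Var 1)) \<triangleright> ?K x' i"
      by (simp add: i slice_fst_rel_apply)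
  qed
  have "tripos_le (Car X \<times> Car X) (\<lambda>(x, x'). Eq X x x') (\<lambda>(x, x'). Eq (eff_exp X eff_Omega) (?K x) (?K x'))"
  proof (rule tripos_leI)
    fix i a assume "i \<in> Car X \<times> Car X" "a \<in> (case i of (x, x') \<Rightarrow> Eq X x x')"
    then obtain x x' where i: "i = (x, x')" and x: "x \<in> Car X" "x' \<in> Car X" and a: "a \<in> Eq X x x'" by (cases i) auto
    have V: "[a] @ [b] \<turnstile> Var 0 \<triangleright> Eq X x x'" for b using a by (simp add: has_Var)
    from has_MkPair[OF fr[OF a x] has_MkPair[OF le[OF sX[OF V]] le[OF V]]] x
    show "[a] \<turnstile> MkPair ?fr (MkPair (Lam (MkPair (Trans X (Sym X (Var 0)) (Fst (Var 1))) (Snd (Var 1))))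
        (Lam (MkPair (Trans X (Var 0) (Fst (Var 1))) (Snd (Var 1)))))
        \<triangleright> (case i of (x, x') \<Rightarrow> Eq (eff_exp X eff_Omega) (?K x) (?K x'))"
      by (simp add: i)
  qed
  then show ?thesis unfolding preserves_eq_def by auto
qed

text \<open>
  The transpose is defined as a union over all representatives of the projection; equivalent
  representatives have uniformly equal slices, so this is a single class.
\<close>
lemma eff_const_eq:
  assumes X: "eff_object X"
  shows "eff_const X = rel_class X (eff_exp X eff_Omega) (graph_rel X (eff_exp X eff_Omega) (slice X (fst_rel X)))"
proof -
  let ?Z = "eff_exp X eff_Omega" and ?P = "eff_prod X eff_Omega"
  note [simp del] = eff_Omega_simps(2)
  have pi: "fst_rel X \<in> functional ?P X" by (rule fst_rel_functional[OF X])
  obtain r where r: "\<And>\<Gamma> u x y. \<Gamma> \<turnstile> u \<triangleright> Eq X x y \<Longrightarrow> x \<in> Car X \<Longrightarrow> y \<in> Car X \<Longrightarrow>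
      \<Gamma> \<turnstile> r u \<triangleright> Eq ?Z (slice X (fst_rel X) x) (slice X (fst_rel X) y)"
    by (rule preserves_eqE[OF slice_fst_rel_preserves_eq[OF X]]) blast
  have "rel_class X ?Z (graph_rel X ?Z (slice X F)) = rel_class X ?Z (graph_rel X ?Z (slice X (fst_rel X)))"
    if F: "F \<in> rel_class ?P X (fst_rel X)" for F
  proof (rule graph_rel_cong[OF eff_object_exp, symmetric])
    note le = in_rel_classD[OF F, THEN conjunct2]
    obtain f where f: "\<And>\<Gamma> u i. \<Gamma> \<turnstile> u \<triangleright> fst_rel X i \<Longrightarrow> i \<in> Car ?P \<times> Car X \<Longrightarrow> \<Gamma> \<turnstile> f u \<triangleright> F i"
      by (rule tripos_le_term[OF le[THEN conjunct1]]) blast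
    obtain g where g: "\<And>\<Gamma> u i. \<Gamma> \<turnstile> u \<triangleright> F i \<Longrightarrow> i \<in> Car ?P \<times> Car X \<Longrightarrow> \<Gamma> \<turnstile> g u \<triangleright> fst_rel X i"
      by (rule tripos_le_term[OF le[THEN conjunct2]]) blast
    show "tripos_le (Car X) (\<lambda>x. Eq X x x) (\<lambda>x. Eq ?Z (slice X (fst_rel X) x) (slice X F x))"
    proof (rule tripos_leI[where t = "MkPair (Fst (r (Var 0))) (MkPair (Lam (f (Var 1))) (Lam (g (Var 1))))"])
      fix x a assume x: "x \<in> Car X" and a: "a \<in> Eq X x x"
      have V: "[a] \<turnstile> Var 0 \<triangleright> Eq X x x" using a by (simp add: has_Var)
      have "[a] \<turnstile> Fst (r (Var 0)) \<triangleright> functional_realizers eff_Omega X (slice X (fst_rel X) x)"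
        by (rule has_Fst[OF r[OF V x x, unfolded eff_exp_simps]])
      moreover have "[a] \<turnstile> Lam (f (Var 1)) \<triangleright> le_realizers (UNIV \<times> Car X) (slice X (fst_rel X) x) (slice X F x)"
        by (rule has_Lam) (use x in \<open>auto simp: slice_apply has_Var intro!: f\<close>)
      moreover have "[a] \<turnstile> Lam (g (Var 1)) \<triangleright> le_realizers (UNIV \<times> Car X) (slice X F x) (slice X (fst_rel X) x)"
        by (rule has_Lam) (use x in \<open>auto simp: slice_apply has_Var intro!: g\<close>)
      ultimately show "[a] \<turnstile> MkPair (Fst (r (Var 0))) (MkPair (Lam (f (Var 1))) (Lam (g (Var 1))))
          \<triangleright> Eq ?Z (slice X (fst_rel X) x) (slice X F x)"
        by (simp add: has_MkPair)
    qed
  qed simp_all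
  moreover have "eff_fst X eff_Omega = rel_class ?P X (fst_rel X)"
    by (simp add: eff_fst_def fst_rel_def)
  moreover have "eff_transpose X eff_Omega X f = (\<Union>F\<in>f. rel_class X ?Z (graph_rel X ?Z (slice X F)))" for f
    unfolding eff_transpose_def graph_rel_def slice_def eff_Omega_simps(1) ..
  ultimately show ?thesis
    unfolding eff_const_def using rel_class_self[OF pi] by blast
qed

text \<open>Two equal constant maps are compared at one truth value; any would do, and \<open>{}\<close> is taken.\<close>
lemma slice_fst_rel_injective:
  assumes X: "eff_object X"
  shows "tripos_le (Car X \<times> Car X)
    (\<lambda>(x, x'). Eq (eff_exp X eff_Omega) (slice X (fst_rel X) x) (slice X (fst_rel X) x')) (\<lambda>(x, x'). Eq X x x')"
proof -
  note sX = has_Sym[OF X] and tX = has_Trans[OF X]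
  note [simp del] = eff_Omega_simps(2)
  let ?K = "slice X (fst_rel X)"
  let ?t = "LetIn (Total (Var 0) Top) (Trans X (Fst (Var 3)) (Sym X (Fst (App (Var 1) (Var 3)))))"
  show ?thesis
  proof (rule tripos_leI3[where t = ?t])
    fix i v assume "i \<in> Car X \<times> Car X" "v \<in> (case i of (x, x') \<Rightarrow> Eq (eff_exp X eff_Omega) (?K x) (?K x'))"
    then obtain x x' f a b where i: "i = (x, x')" and x: "x \<in> Car X" "x' \<in> Car X" and v: "v = lpair f (lpair a b)"
      and fa: "f \<in> functional_realizers eff_Omega X (?K x)" "a \<in> le_realizers (UNIV \<times> Car X) (?K x) (?K x')"
      by (cases i) (auto simp: rconj_def[of "functional_realizers _ _ _"] rconj_def[of "le_realizers _ _ _"])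
    have "[f, a, b] \<turnstile> ?t \<triangleright> Eq X x x'"
    proof (rule has_Let_UN)
      have "[f, a, b] \<turnstile> Var 0 \<triangleright> functional_realizers eff_Omega X (?K x)" using fa by (simp add: has_Var)
      from has_Total[OF this has_Top] show "[f, a, b] \<turnstile> Total (Var 0) Top \<triangleright> (\<Union>y\<in>Car X. ?K x ({}, y))" by simp
      fix y c assume y: "y \<in> Car X" and c: "c \<in> ?K x ({}, y)"
      have V: "[f, a, b] @ [c] \<turnstile> Var 1 \<triangleright> le_realizers (UNIV \<times> Car X) (?K x) (?K x')"
        "[f, a, b] @ [c] \<turnstile> Var 3 \<triangleright> ?K x ({}, y)" "[f, a, b] @ [c] \<turnstile> Var 3 \<triangleright> Eq X x y \<^bold>\<and> Eq eff_Omega {} {}"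
        using fa c x y by (simp_all add: has_Var slice_fst_rel_apply)
      from has_App[OF V(1,2)] have "[f, a, b] @ [c] \<turnstile> App (Var 1) (Var 3) \<triangleright> Eq X x' y \<^bold>\<and> Eq eff_Omega {} {}"
        using x y by (simp add: slice_fst_rel_apply)
      from tX[OF has_Fst[OF V(3)] sX[OF has_Fst[OF this]]]
      show "[f, a, b] @ [c] \<turnstile> Trans X (Fst (Var 3)) (Sym X (Fst (App (Var 1) (Var 3)))) \<triangleright> Eq X x x'" using x y by blast
    qed
    with i v show "\<exists>a b c. v = lpair a (lpair b c) \<and> [a, b, c] \<turnstile> ?t \<triangleright> (case i of (x, x') \<Rightarrow> Eq X x x')" by auto
  qed
qed

text \<open>
  The term \<open>?v\<close> is the value of \<open>R\<close> at the common realizer of all truth values. Evaluated at \<open>\<top>\<close>, that is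
  \<open>UNIV\<close>, it gives the constant value \<open>x0\<close>; evaluated a second time, in \<open>\<J>\<close> of an intersection, it gives
  an element of \<open>R (\<top>, x1) \<inter> R (p, x)\<close>, from which \<open>?q\<close> computes a realizer of \<open>x0 = x1 = x\<close>.
\<close>
lemma slice_fst_rel_surjective:
  assumes X: "eff_object X" and mod: "modest X"
  shows "tripos_le (Car (eff_exp X eff_Omega)) (\<lambda>R. Eq (eff_exp X eff_Omega) R R)
    (\<lambda>R. \<Union>x\<in>Car X. Eq X x x \<^bold>\<and> Eq (eff_exp X eff_Omega) (slice X (fst_rel X) x) R)"
proof -
  note sX = has_Sym[OF X] and tX = has_Trans[OF X]
  note [simp del] = eff_Omega_simps(2)
  let ?Z = "eff_exp X eff_Omega" and ?K = "slice X (fst_rel X)"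
  obtain r where r: "\<And>\<Gamma> u x y. \<Gamma> \<turnstile> u \<triangleright> Eq X x y \<Longrightarrow> x \<in> Car X \<Longrightarrow> y \<in> Car X \<Longrightarrow> \<Gamma> \<turnstile> r u \<triangleright> Eq ?Z (?K x) (?K y)"
    by (rule preserves_eqE[OF slice_fst_rel_preserves_eq[OF X]]) blast
  obtain m where m: "\<And>\<Gamma> u x y. \<Gamma> \<turnstile> u \<triangleright> Eq X x x \<Longrightarrow> \<Gamma> \<turnstile> u \<triangleright> Eq X y y \<Longrightarrow> x \<in> Car X \<Longrightarrow> y \<in> Car X \<Longrightarrow>
    \<Gamma> \<turnstile> m u \<triangleright> Eq X x y"
    by (rule modestE[OF mod]) blast
  let ?v = "Total (Var 0) Top" and ?e = "Snd (Strict (Var 0) (Var 3))"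
  let ?q = "Trans X (Single (Var 0) (Var 3) (Var 5)) (m (Snd (Strict (Var 0) (Var 5))))"
  let ?a = "LetIn ?v (Respect (Var 0) Top (Var 5) (Trans X (Sym X ?q) (Fst (Var 4))))"
  let ?b = "LetIn ?v (MkPair (Trans X ?q (Single (Var 0) (Var 5) (Var 4))) Top)"
  let ?t = "LetIn ?v (MkPair ?e (MkPair (Fst (r ?e)) (MkPair (Lam ?a) (Lam ?b))))"
  show ?thesis
  proof (rule tripos_leI3[where t = ?t])
    fix R v assume "v \<in> Eq ?Z R R"
    then obtain f a b where v: "v = lpair f (lpair a b)" and f: "f \<in> functional_realizers eff_Omega X R"
      by (auto simp: rconj_def[of "functional_realizers _ _ _"] rconj_def[of "le_realizers _ _ _"])
    have F: "f # a # b # \<Delta> \<turnstile> Var 0 \<triangleright> functional_realizers eff_Omega X R" for \<Delta> using f by (simp add: has_Var)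
    have v_R: "f # a # b # \<Delta> \<turnstile> ?v \<triangleright> (\<Union>x\<in>Car X. R (p, x))" for \<Delta> p
      using has_Total[OF F has_Top] by simp
    have "[f, a, b] \<turnstile> ?t \<triangleright> (\<Union>x\<in>Car X. Eq X x x \<^bold>\<and> Eq ?Z (?K x) R)"
    proof (rule has_Let_UN[OF v_R])
      fix x0 c assume x0: "x0 \<in> Car X" and c: "c \<in> R (UNIV, x0)"
      have C: "f # a # b # c # \<Delta> \<turnstile> Var 3 \<triangleright> R (UNIV, x0)" for \<Delta> using c by (simp add: has_Var)
      have E: "[f, a, b, c] \<turnstile> ?e \<triangleright> Eq X x0 x0"
        by (rule has_Snd[OF has_Strict[OF F C]]) (use x0 in simp_all)
      have step: "[f, a, b, c, d] \<turnstile> LetIn ?v u \<triangleright> B"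
        if u: "\<And>x z. x \<in> Car X \<Longrightarrow> z \<in> R (p, x) \<Longrightarrow> [f, a, b, c, d, z] \<turnstile> ?q \<triangleright> Eq X x0 x \<Longrightarrow>
          [f, a, b, c, d, z] \<turnstile> u \<triangleright> B" for d p u B
      proof (rule has_Let_Int_UN[OF v_R v_R])
        fix x1 x z assume x: "x1 \<in> Car X" "x \<in> Car X" and z: "z \<in> R (UNIV, x1)" "z \<in> R (p, x)"
        have Z: "[f, a, b, c, d, z] \<turnstile> Var 5 \<triangleright> R (UNIV, x1)" "[f, a, b, c, d, z] \<turnstile> Var 5 \<triangleright> R (p, x)"
          using z by (simp_all add: has_Var)
        have "[f, a, b, c, d, z] \<turnstile> m (Snd (Strict (Var 0) (Var 5))) \<triangleright> Eq X x1 x"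
          by (rule m[OF has_Snd[OF has_Strict[OF F Z(1)]] has_Snd[OF has_Strict[OF F Z(2)]]]) (use x in simp_all)
        from tX[OF has_Single[OF F C Z(1)] this] have "[f, a, b, c, d, z] \<turnstile> ?q \<triangleright> Eq X x0 x" using x x0 by simp
        from u[OF x(2) z(2) this] show "[f, a, b, c, d] @ [z] \<turnstile> u \<triangleright> B" by simp
      qed
      have "[f, a, b, c] \<turnstile> Lam ?a \<triangleright> le_realizers (UNIV \<times> Car X) (?K x0) R"
      proof (rule has_Lam)
        fix i d assume "i \<in> UNIV \<times> Car X" "d \<in> ?K x0 i"
        then obtain p y where i: "i = (p, y)" and y: "y \<in> Car X" and d: "d \<in> Eq X x0 y \<^bold>\<and> Eq eff_Omega p p"
          using x0 by (auto simp: slice_fst_rel_apply)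
        have "[f, a, b, c, d] \<turnstile> ?a \<triangleright> R (p, y)"
        proof (rule step)
          fix x z assume x: "x \<in> Car X" and z: "z \<in> R (p, x)" and q: "[f, a, b, c, d, z] \<turnstile> ?q \<triangleright> Eq X x0 x"
          have D: "[f, a, b, c, d, z] \<turnstile> Var 4 \<triangleright> Eq X x0 y \<^bold>\<and> Eq eff_Omega p p"
            "[f, a, b, c, d, z] \<turnstile> Var 5 \<triangleright> R (p, x)" using d z by (simp_all add: has_Var)
          show "[f, a, b, c, d, z] \<turnstile> Respect (Var 0) Top (Var 5) (Trans X (Sym X ?q) (Fst (Var 4))) \<triangleright> R (p, y)"
            by (rule has_Respect[OF F has_Top D(2) tX[OF sX[OF q] has_Fst[OF D(1)]]]) (use x x0 y in simp_all)
        qed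
        then show "[f, a, b, c] @ [d] \<turnstile> ?a \<triangleright> R i" by (simp add: i)
      qed
      moreover have "[f, a, b, c] \<turnstile> Lam ?b \<triangleright> le_realizers (UNIV \<times> Car X) R (?K x0)"
      proof (rule has_Lam)
        fix i d assume "i \<in> UNIV \<times> Car X" "d \<in> R i"
        then obtain p y where i: "i = (p, y)" and y: "y \<in> Car X" and d: "d \<in> R (p, y)" by auto
        have "[f, a, b, c, d] \<turnstile> ?b \<triangleright> Eq X x0 y \<^bold>\<and> Eq eff_Omega p p"
        proof (rule step)
          fix x z assume x: "x \<in> Car X" and z: "z \<in> R (p, x)" and q: "[f, a, b, c, d, z] \<turnstile> ?q \<triangleright> Eq X x0 x"
          have D: "[f, a, b, c, d, z] \<turnstile> Var 4 \<triangleright> R (p, y)"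
            "[f, a, b, c, d, z] \<turnstile> Var 5 \<triangleright> R (p, x)" using d z by (simp_all add: has_Var)
          show "[f, a, b, c, d, z] \<turnstile> MkPair (Trans X ?q (Single (Var 0) (Var 5) (Var 4))) Top
              \<triangleright> Eq X x0 y \<^bold>\<and> Eq eff_Omega p p"
            by (rule has_MkPair[OF tX[OF q has_Single[OF F D(2,1)]] has_Top]) (use x x0 y in simp_all)
        qed
        then show "[f, a, b, c] @ [d] \<turnstile> ?b \<triangleright> ?K x0 i" using x0 y by (simp add: i slice_fst_rel_apply)
      qed
      moreover have "[f, a, b, c] \<turnstile> Fst (r ?e) \<triangleright> functional_realizers eff_Omega X (?K x0)"
        by (rule has_Fst[OF r[OF E x0 x0, unfolded eff_exp_simps]])
      ultimately have "[f, a, b, c] \<turnstile> MkPair ?e (MkPair (Fst (r ?e)) (MkPair (Lam ?a) (Lam ?b)))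
          \<triangleright> Eq X x0 x0 \<^bold>\<and> Eq ?Z (?K x0) R"
        using E by (simp add: has_MkPair)
      then have "[f, a, b, c] \<turnstile> MkPair ?e (MkPair (Fst (r ?e)) (MkPair (Lam ?a) (Lam ?b)))
          \<triangleright> (\<Union>x\<in>Car X. Eq X x x \<^bold>\<and> Eq ?Z (?K x) R)"
        by (rule has_mono) (use x0 in blast)
      then show "[f, a, b] @ [c] \<turnstile> MkPair ?e (MkPair (Fst (r ?e)) (MkPair (Lam ?a) (Lam ?b)))
          \<triangleright> (\<Union>x\<in>Car X. Eq X x x \<^bold>\<and> Eq ?Z (?K x) R)"
        unfolding append.simps .
    qed
    with v show "\<exists>a b c. v = lpair a (lpair b c) \<and> [a, b, c] \<turnstile> ?t \<triangleright> (\<Union>x\<in>Car X. Eq X x x \<^bold>\<and> Eq ?Z (?K x) R)"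
      by blast
  qed
qed

theorem eff_const_iso:
  assumes "eff_object X" "modest X"
  shows "eff_iso X (eff_exp X eff_Omega) (eff_const X)"
  unfolding eff_const_eq[OF assms(1)]
  by (rule graph_rel_iso[OF assms(1) eff_object_exp slice_fst_rel_preserves_eq slice_fst_rel_injective
        slice_fst_rel_surjective]) (rule assms)+

theorem proposition4p1:
  fixes \<alpha> :: "nat \<Rightarrow> nat \<Rightarrow> nat"
  assumes "range \<alpha> = {f. arithmetical f}"
    and "construction_recursive \<alpha>"
  shows "(\<forall>X :: 'a eff. eff_object X \<longrightarrow> subquotient TYPE('s) X eff_N \<longrightarrow>
            eff_iso X (eff_exp X eff_Omega) (eff_const X)) \<and>
         eff_iso eff_N (eff_exp eff_N eff_Omega) (eff_const eff_N) \<and>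
         (let NN = eff_exp eff_N eff_N in
            eff_iso NN (eff_exp NN eff_Omega) (eff_const NN)) \<and>
         (let M = ns_model \<alpha> in
            eff_iso M (eff_exp M eff_Omega) (eff_const M)) \<and>
         (let MM = eff_exp (ns_model \<alpha>) (ns_model \<alpha>) in
            eff_iso MM (eff_exp MM eff_Omega) (eff_const MM))"
proof -
  have N: "eff_object eff_N" and M: "eff_object (ns_model \<alpha>)"
    unfolding eff_N_def ns_model_def by (rule eff_object_assembly)+
  show ?thesis
    unfolding Let_def
    by (intro conjI allI impI eff_const_iso modest_N modest_ns_model modest_exp N M eff_object_exp;
        auto intro: modest_subquotient modest_N)
qed

end
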